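(* Let $n\ge 1$ and let $V\in C^2(\mathbb{T}^n)$ satisfy $V\ge 0$ on $\mathbb{T}^n$, $\{V=0\}=\{x_1,\ldots,x_m\}$ (a finite nonempty set of distinct points), and $D^2V(x_i)$ positive definite for every $1\le i\le m$. Fix $\eta>0$ and, for $\varepsilon>0$, let $v^{\eta,\varepsilon}$ be the solution of $$\varepsilon\eta\, v^{\eta,\varepsilon}-\varepsilon\Delta v^{\eta,\varepsilon}+|Dv^{\eta,\varepsilon}|^2=V\qquad\text{in }\mathbb{T}^n.$$ Then, uniformly for $x\in\mathbb{T}^n$, $$\lim_{\varepsilon\to 0}v^{\eta,\varepsilon}(x)=\min_{1\le i\le m}\left\{\frac{\kappa_i}{\eta}+d(x_i,x)\right\}.$$
   Context: $\mathbb{T}^n=\mathbb{R}^n/\mathbb{Z}^n$ is the flat torus. The equation has, for each $\varepsilon>0$, a unique viscosity solution, which is classical. For $1\le i\le m$ set $A_i:=\left(\tfrac12 D^2V(x_i)\right)^{1/2}$ (the positive definite symmetric square root) and $\kappa_i:=\operatorname{tr}A_i$. The critical Mañé potential is $$d(y,x):=\inf_{T>0}\ \inf_{\gamma}\int_0^T\left(\frac{|\dot\gamma(t)|^2}{4}+V(\gamma(t))\right)dt,$$ where the inner infimum is over absolutely continuous curves $\gamma:[0,T]\to\mathbb{T}^n$ with $\gamma(0)=y$, $\gamma(T)=x$. *)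

theory Defs
  imports "HOL-Analysis.Analysis"
begin

(* The torus R^n/Z^n is represented by R^n together with the congruence below: its points are
   represented by vectors, and functions on it are Z^n-periodic functions on R^n. *)

definition torus_eq :: "real^'n \<Rightarrow> real^'n \<Rightarrow> bool" where
  "torus_eq x y \<longleftrightarrow> (\<forall>i. (x - y) $ i \<in> \<int>)"

definition torus_fun :: "(real^'n \<Rightarrow> 'b) \<Rightarrow> bool" where
  "torus_fun f \<longleftrightarrow> (\<forall>x y. torus_eq x y \<longrightarrow> f x = f y)"

definition partial :: "'n \<Rightarrow> (real^'n \<Rightarrow> real) \<Rightarrow> real^'n \<Rightarrow> real" where
  "partial i f x = frechet_derivative f (at x) (axis i 1)"

definition C2 :: "(real^'n \<Rightarrow> real) \<Rightarrow> bool" where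
  "C2 f \<longleftrightarrow> (\<forall>x. f differentiable (at x)) \<and>
     (\<forall>i x. partial i f differentiable (at x)) \<and>
     (\<forall>i j. continuous_on UNIV (partial j (partial i f)))"

definition grad :: "(real^'n \<Rightarrow> real) \<Rightarrow> real^'n \<Rightarrow> real^'n" where
  "grad f x = (\<chi> i. partial i f x)"

definition hessian :: "(real^'n \<Rightarrow> real) \<Rightarrow> real^'n \<Rightarrow> real^'n^'n" where
  "hessian f x = (\<chi> i j. partial j (partial i f) x)"

definition laplacian :: "(real^'n \<Rightarrow> real) \<Rightarrow> real^'n \<Rightarrow> real" where
  "laplacian f x = (\<Sum>i\<in>UNIV. partial i (partial i f) x)"

definition sym_pos_def :: "real^'n^'n \<Rightarrow> bool" where
  "sym_pos_def A \<longleftrightarrow> transpose A = A \<and> (\<forall>z. z \<noteq> 0 \<longrightarrow> z \<bullet> (A *v z) > 0)"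

(* Only meaningful for symmetric positive definite arguments, for which the root exists
   and is unique. *)
definition spd_sqrt :: "real^'n^'n \<Rightarrow> real^'n^'n" where
  "spd_sqrt M = (THE A. sym_pos_def A \<and> A ** A = M)"

definition kappa :: "(real^'n \<Rightarrow> real) \<Rightarrow> real^'n \<Rightarrow> real" where
  "kappa V x = trace (spd_sqrt ((1/2) *\<^sub>R hessian V x))"

(* Viscosity sub- and supersolutions of  e * eta * u - e * Laplacian u + |Du|^2 = V.
   The test function need not be periodic, since the extremum is only local. *)

definition viscosity_subsolution ::
    "(real^'n \<Rightarrow> real) \<Rightarrow> real \<Rightarrow> real \<Rightarrow> (real^'n \<Rightarrow> real) \<Rightarrow> bool" where
  "viscosity_subsolution V \<eta> \<epsilon> u \<longleftrightarrow>
     (\<forall>\<phi> x. C2 \<phi> \<and> (\<forall>\<^sub>F y in at x. u y - \<phi> y \<le> u x - \<phi> x) \<longrightarrow>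
        \<epsilon> * \<eta> * u x - \<epsilon> * laplacian \<phi> x + (norm (grad \<phi> x))\<^sup>2 \<le> V x)"

definition viscosity_supersolution ::
    "(real^'n \<Rightarrow> real) \<Rightarrow> real \<Rightarrow> real \<Rightarrow> (real^'n \<Rightarrow> real) \<Rightarrow> bool" where
  "viscosity_supersolution V \<eta> \<epsilon> u \<longleftrightarrow>
     (\<forall>\<phi> x. C2 \<phi> \<and> (\<forall>\<^sub>F y in at x. u y - \<phi> y \<ge> u x - \<phi> x) \<longrightarrow>
        \<epsilon> * \<eta> * u x - \<epsilon> * laplacian \<phi> x + (norm (grad \<phi> x))\<^sup>2 \<ge> V x)"

definition viscosity_solution ::
    "(real^'n \<Rightarrow> real) \<Rightarrow> real \<Rightarrow> real \<Rightarrow> (real^'n \<Rightarrow> real) \<Rightarrow> bool" where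
  "viscosity_solution V \<eta> \<epsilon> u \<longleftrightarrow> torus_fun u \<and> continuous_on UNIV u \<and>
     viscosity_subsolution V \<eta> \<epsilon> u \<and> viscosity_supersolution V \<eta> \<epsilon> u"

definition abs_continuous_on_Icc :: "real \<Rightarrow> real \<Rightarrow> (real \<Rightarrow> 'a::metric_space) \<Rightarrow> bool" where
  "abs_continuous_on_Icc a b \<gamma> \<longleftrightarrow>
     (\<forall>e>0. \<exists>\<delta>>0. \<forall>(N::nat) l r.
        (\<forall>k<N. a \<le> l k \<and> l k \<le> r k \<and> r k \<le> b) \<and>
        disjoint_family_on (\<lambda>k. {l k<..<r k}) {..<N} \<and>
        (\<Sum>k<N. r k - l k) < \<delta> \<longrightarrow>
        (\<Sum>k<N. dist (\<gamma> (l k)) (\<gamma> (r k))) < e)"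

(* Absolutely continuous curves in the torus are described by their absolutely continuous
   lifts to R^n; the lift may start and end at any representatives of the two points. *)
definition torus_curves :: "real \<Rightarrow> real^'n \<Rightarrow> real^'n \<Rightarrow> (real \<Rightarrow> real^'n) set" where
  "torus_curves T y x =
     {\<gamma>. abs_continuous_on_Icc 0 T \<gamma> \<and> torus_eq (\<gamma> 0) y \<and> torus_eq (\<gamma> T) x}"

(* An absolutely continuous curve is differentiable almost everywhere. For V >= 0 the integrand
   is nonnegative; the integral may be infinite, whence the type ennreal. *)
definition action :: "(real^'n \<Rightarrow> real) \<Rightarrow> real \<Rightarrow> (real \<Rightarrow> real^'n) \<Rightarrow> ennreal" where
  "action V T \<gamma> =
     (\<integral>\<^sup>+ t\<in>{0..T}. ennreal ((norm (vector_derivative \<gamma> (at t)))\<^sup>2 / 4 + V (\<gamma> t)) \<partial>lborel)"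

(* Critical Mane potential d(y,x). The infimum is finite because affine curves have finite
   action, so enn2real loses nothing. *)
definition mane :: "(real^'n \<Rightarrow> real) \<Rightarrow> real^'n \<Rightarrow> real^'n \<Rightarrow> real" where
  "mane V y x = enn2real (INF T\<in>{0<..}. INF \<gamma>\<in>torus_curves T y x. action V T \<gamma>)"

end

theory Submission
  imports Defs
begin

text \<open>
  The limit is governed by the functions \<open>w\<close> whose local Lipschitz constant at every point \<open>y\<close> is at
  most \<open>sqrt (V y)\<close>, the subsolutions of the eikonal equation \<open>|Dw|\<^sup>2 = V\<close> (here called eikonal_sub).
  Along an absolutely continuous curve such a function grows by at most the action, because
  \<open>sqrt V |\<gamma>'| \<le> |\<gamma>'|\<^sup>2 / 4 + V\<close> (lemma eikonal_sub_action); conversely \<open>d(x\<^sub>i, \<cdot>)\<close> is itself such a function, since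
  any curve can be prolonged by a short segment (lemma eikonal_sub_mane). Hence
  \<open>U = min\<^sub>i (\<kappa>\<^sub>i / \<eta> + d(x\<^sub>i, \<cdot>))\<close> is the largest periodic eikonal subsolution with \<open>U(x\<^sub>i) \<le> \<kappa>\<^sub>i / \<eta>\<close> for all \<open>i\<close>.

  The numbers \<open>\<kappa>\<^sub>i / \<eta>\<close> come from the wells. With \<open>z = x - x\<^sub>i\<close> one has \<open>V = |A\<^sub>i z|\<^sup>2 + o(|z|\<^sup>2)\<close>, and the
  quadratic \<open>q = z \<bullet> A\<^sub>i z / 2\<close> satisfies \<open>|Dq|\<^sup>2 = |A\<^sub>i z|\<^sup>2\<close> and \<open>\<Delta>q = \<kappa>\<^sub>i\<close>. Testing the equation with a
  multiple \<open>(1 \<plusminus> \<theta>) q\<close> therefore leaves, after division by \<open>\<epsilon>\<close>, the inequality \<open>\<eta> v \<le> (1 + \<theta>) \<kappa>\<^sub>i\<close> or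
  \<open>\<eta> v \<ge> (1 - \<theta>) \<kappa>\<^sub>i\<close> at the contact point, the factor \<open>1 \<plusminus> \<theta>\<close> absorbing all errors.

  Upper bound. A multiple with the plus sign, made steep at infinity, is a barrier on the whole space
  (upper_barrier): it bounds \<open>v\<close> uniformly and gives \<open>limsup v \<le> \<kappa>\<^sub>i / \<eta>\<close> at \<open>x\<^sub>i\<close>. Comparison with smoothed cones
  (cone_comparison) shows that the upper relaxed limit of \<open>v\<close> is an eikonal subsolution. Being at most
  \<open>\<kappa>\<^sub>i / \<eta>\<close> at \<open>x\<^sub>i\<close>, it is at most \<open>U\<close>.

  Lower bound. Let \<open>W\<close> be any periodic eikonal subsolution with \<open>W(x\<^sub>i) \<le> \<kappa>\<^sub>i / \<eta>\<close>, for instance \<open>U\<close>. A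
  contraction \<open>\<tau>\<close> of the real line that is constant near each value \<open>W(x\<^sub>i)\<close> makes \<open>\<tau> \<circ> W\<close> locally constant
  near the zeros of \<open>V\<close>. Minimise \<open>v(x) - (1 - \<theta>) \<tau>(W(y)) + s |x - y|\<^sup>2\<close>. If \<open>x\<close> is far from the zeros, the
  slope of the penalty is at most \<open>(1 - \<theta>) sqrt (V y)\<close>, which contradicts the equation for small \<open>\<epsilon>\<close>. If \<open>x\<close> is near a
  zero, then flatness makes \<open>x\<close> a minimum of \<open>v\<close> over a neighbourhood of that zero, and the quadratic with
  the minus sign yields \<open>v(x) \<ge> \<kappa>\<^sub>i / \<eta>\<close> up to a small error (lower_bound_at_well). Either way \<open>v \<ge> W\<close> up to a
  small error (lower_comparison).

  Points of the torus are vectors throughout, so barriers need not be periodic: they only have to grow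
  at infinity. The integrand of the action is meaningful only where the curve is differentiable, which
  makes Lebesgue's theorem on the differentiability of functions of bounded variation necessary; it is proved
  by Austin's argument from the Vitali covering lemma.
\<close>

section \<open>Differentiability almost everywhere of functions of bounded variation\<close>

definition incr :: "(real \<Rightarrow> real) \<Rightarrow> real set \<Rightarrow> real" where
  "incr f k = f (Sup k) - f (Inf k)"

lemma sum_incr_division:
  assumes "q division_of {c..d}" "c \<le> (d::real)"
  shows "(\<Sum>k\<in>q. incr f k) = f d - f c"
proof -
  let ?p = "(\<lambda>k. (Inf k, k)) ` q"
  note D = division_ofD[OF assms(1)]
  have ne: "Inf K \<in> K" if Kq: "K \<in> q" for K
  proof -
    obtain u v where "K = cbox u v" using D(4)[OF Kq] by blast
    with D(3)[OF Kq] show ?thesis by auto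
  qed
  have "?p tagged_division_of {c..d}"
  proof (rule tagged_division_ofI)
    have "{K. \<exists>x. (x, K) \<in> ?p} = q" by auto
    then show "\<Union>{K. \<exists>x. (x, K) \<in> ?p} = {c..d}" using D(6) by simp
    fix x1 K1 x2 K2 assume "(x1,K1) \<in> ?p" "(x2,K2) \<in> ?p" "(x1,K1) \<noteq> (x2,K2)"
    then show "interior K1 \<inter> interior K2 = {}" using D(5)[of K1 K2] by auto
  qed (use D(1,2,4) ne in auto)
  from additive_tagged_division_1[OF assms(2) this, of f]
  show ?thesis
    by (subst (asm) sum.reindex) (auto simp: inj_on_def incr_def o_def)
qed

lemma division_of_disjoint_intervals:
  assumes "finite F" "\<And>s t. (s,t) \<in> F \<Longrightarrow> s < (t::real)"
    and "pairwise (\<lambda>i j. disjnt {fst i..snd i} {fst j..snd j}) F"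
  shows "((\<lambda>(s,t). {s..t}) ` F) division_of (\<Union>(s,t)\<in>F. {s..t})"
proof (rule division_ofI)
  fix K1 K2 assume "K1 \<in> (\<lambda>(s,t). {s..t}) ` F" "K2 \<in> (\<lambda>(s,t). {s..t}) ` F" "K1 \<noteq> K2"
  then obtain i j where ij: "i \<in> F" "j \<in> F" "i \<noteq> j" "K1 = {fst i..snd i}" "K2 = {fst j..snd j}"
    by (auto simp: case_prod_beta)
  with assms(3) have "disjnt K1 K2" unfolding pairwise_def by blast
  then show "interior K1 \<inter> interior K2 = {}"
    using interior_subset unfolding disjnt_def by blast
next
  fix K assume "K \<in> (\<lambda>(s,t). {s..t}) ` F"
  with assms(2) show "K \<noteq> {}" by fastforce
next
  fix K assume "K \<in> (\<lambda>(s,t). {s..t}) ` F"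
  then show "\<exists>a b. K = cbox a b" by (metis (mono_tags, lifting) box_real(2) case_prod_beta imageE)
qed (use assms in auto)

lemma inj_on_intervals:
  assumes "\<And>s t. (s,t) \<in> F \<Longrightarrow> s < (t::real)"
  shows "inj_on (\<lambda>(s,t). {s..t}) F"
  using assms by (fastforce simp: inj_on_def Icc_eq_Icc)

lemma sum_intervals:
  assumes "\<And>s t. (s,t) \<in> F \<Longrightarrow> s < (t::real)"
  shows "(\<Sum>k\<in>(\<lambda>(s,t). {s..t}) ` F. g (Inf k) (Sup k)) = (\<Sum>(s,t)\<in>F. g s t)"
  using assms by (subst sum.reindex[OF inj_on_intervals]) (force simp: o_def intro!: sum.cong)+

text \<open>
  Intervals on which \<open>f\<close> moves against its net direction on the cell contribute twice to the
  variation: once themselves, and once because the remaining intervals have to make up for them.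
\<close>

lemma cell_gain:
  assumes F: "finite F" "\<And>s t. (s,t) \<in> F \<Longrightarrow> c \<le> s \<and> s < t \<and> t \<le> (d::real)"
    and disj: "pairwise (\<lambda>i j. disjnt {fst i..snd i} {fst j..snd j}) F"
    and cd: "c \<le> d"
    and opp: "\<And>s t. (s,t) \<in> F \<Longrightarrow>
        (if f c \<le> f d then f t - f s \<le> - \<alpha> * (t - s) else f t - f s \<ge> \<alpha> * (t - s))"
  obtains q where "q division_of {c..d}" "(\<Sum>k\<in>q. \<bar>incr f k\<bar>) \<ge> \<bar>f d - f c\<bar> + 2 * \<alpha> * (\<Sum>(s,t)\<in>F. t - s)"
proof -
  let ?p = "(\<lambda>(s,t). {s..t}) ` F"
  have pd: "?p division_of \<Union>?p"
    using division_of_disjoint_intervals[OF F(1) _ disj] F(2) by auto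
  have "\<Union>?p \<subseteq> cbox c d" using F(2) by fastforce
  then obtain q where q: "?p \<subseteq> q" "q division_of cbox c d"
    using partial_division_extend_interval[OF pd] by metis
  have fq: "finite q" using q(2) by blast
  have tot: "(\<Sum>k\<in>q. incr f k) = f d - f c" using sum_incr_division q(2) cd by simp
  have s1: "(\<Sum>k\<in>?p. incr f k) = (\<Sum>(s,t)\<in>F. f t - f s)"
    unfolding incr_def by (rule sum_intervals) (use F(2) in blast)
  have s2: "(\<Sum>k\<in>?p. \<bar>incr f k\<bar>) = (\<Sum>(s,t)\<in>F. \<bar>f t - f s\<bar>)"
    unfolding incr_def by (rule sum_intervals) (use F(2) in blast)
  have split: "(\<Sum>k\<in>q. g k) = (\<Sum>k\<in>?p. g k) + (\<Sum>k\<in>q - ?p. g k)" for g :: "real set \<Rightarrow> real"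
    using sum.subset_diff[OF q(1) fq] by (simp add: add.commute)
  have "\<bar>\<Sum>k\<in>q - ?p. incr f k\<bar> \<le> (\<Sum>k\<in>q - ?p. \<bar>incr f k\<bar>)" by (rule sum_abs)
  then have *: "(\<Sum>k\<in>q. \<bar>incr f k\<bar>) \<ge> (\<Sum>(s,t)\<in>F. \<bar>f t - f s\<bar>) + \<bar>f d - f c - (\<Sum>(s,t)\<in>F. f t - f s)\<bar>"
    using split[of "incr f"] split[of "\<lambda>k. \<bar>incr f k\<bar>"] tot s1 s2 by simp
  have "\<bar>f d - f c\<bar> + 2 * \<alpha> * (\<Sum>(s,t)\<in>F. t - s) \<le> (\<Sum>(s,t)\<in>F. \<bar>f t - f s\<bar>) + \<bar>f d - f c - (\<Sum>(s,t)\<in>F. f t - f s)\<bar>"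
  proof (cases "f c \<le> f d")
    case True
    have "(\<Sum>(s,t)\<in>F. f t - f s) \<le> (\<Sum>(s,t)\<in>F. - \<alpha> * (t - s))"
      using opp True by (intro sum_mono) auto
    moreover have "- (\<Sum>(s,t)\<in>F. f t - f s) \<le> (\<Sum>(s,t)\<in>F. \<bar>f t - f s\<bar>)"
      unfolding sum_negf[symmetric] by (intro sum_mono) auto
    moreover have "(\<Sum>(s,t)\<in>F. - \<alpha> * (t - s)) = - \<alpha> * (\<Sum>(s,t)\<in>F. t - s)"
      by (simp add: sum_distrib_left case_prod_beta)
    ultimately show ?thesis using True by linarith
  next
    case False
    have "(\<Sum>(s,t)\<in>F. f t - f s) \<ge> (\<Sum>(s,t)\<in>F. \<alpha> * (t - s))"
      using opp False by (intro sum_mono) auto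
    moreover have "(\<Sum>(s,t)\<in>F. f t - f s) \<le> (\<Sum>(s,t)\<in>F. \<bar>f t - f s\<bar>)"
      by (intro sum_mono) auto
    moreover have "(\<Sum>(s,t)\<in>F. \<alpha> * (t - s)) = \<alpha> * (\<Sum>(s,t)\<in>F. t - s)"
      by (simp add: sum_distrib_left case_prod_beta)
    ultimately show ?thesis using False by linarith
  qed
  with * that q(2) show ?thesis by auto
qed

text \<open>
  Divisions of neighbouring cells may share a degenerate interval \<open>{c}\<close>; hence the condition on \<open>g\<close>.
\<close>

lemma division_of_Union_divisions:
  fixes g :: "real set \<Rightarrow> real"
  assumes d: "D division_of {a..b}" and Q: "\<And>K. K \<in> D \<Longrightarrow> Q K division_of K"
    and g: "\<And>c. g {c} = 0"
  shows "(\<Union>K\<in>D. Q K) division_of {a..b}" "(\<Sum>k\<in>(\<Union>K\<in>D. Q K). g k) = (\<Sum>K\<in>D. \<Sum>k\<in>Q K. g k)"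
proof -
  note D = division_ofD[OF d]
  note QD = division_ofD[OF Q]
  have int: "interior k1 \<inter> interior k2 = {}" if "K1 \<in> D" "k1 \<in> Q K1" "K2 \<in> D" "k2 \<in> Q K2" "K1 \<noteq> K2" for k1 k2 K1 K2
  proof -
    have "interior k1 \<subseteq> interior K1" "interior k2 \<subseteq> interior K2"
      using QD(2)[OF that(1,2)] QD(2)[OF that(3,4)] interior_mono by blast+
    with D(5)[OF that(1,3,5)] show ?thesis by blast
  qed
  show "(\<Union>K\<in>D. Q K) division_of {a..b}"
  proof (rule division_ofI)
    fix k1 k2 assume "k1 \<in> (\<Union>K\<in>D. Q K)" "k2 \<in> (\<Union>K\<in>D. Q K)" and ne: "k1 \<noteq> k2"
    then obtain K1 K2 where "K1 \<in> D" "k1 \<in> Q K1" "K2 \<in> D" "k2 \<in> Q K2" by blast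
    then show "interior k1 \<inter> interior k2 = {}"
      using int[of K1 k1 K2 k2] QD(5)[of K1 k1 k2] ne by (cases "K1 = K2") auto
  next
    show "\<Union>(\<Union>K\<in>D. Q K) = {a..b}"
    proof -
      have "\<Union>(\<Union>K\<in>D. Q K) = (\<Union>K\<in>D. \<Union>(Q K))" by blast
      also have "\<dots> = (\<Union>K\<in>D. K)" using QD(6) by simp
      finally show ?thesis using D(6) by simp
    qed
  next
    fix k assume "k \<in> (\<Union>K\<in>D. Q K)"
    then obtain K where "K \<in> D" "k \<in> Q K" by blast
    from D(2)[OF this(1)] QD(2)[OF this] show "k \<subseteq> {a..b}" by (rule order_trans[rotated])
  next
    show "finite (\<Union>K\<in>D. Q K)" using D(1) QD(1) by simp
  next
    fix k assume "k \<in> (\<Union>K\<in>D. Q K)"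
    then obtain K where "K \<in> D" "k \<in> Q K" by blast
    from QD(3,4)[OF this] show "k \<noteq> {}" "\<exists>u v. k = cbox u v" by simp_all
  qed
  have "sum g (snd ` Sigma D Q) = sum (g \<circ> snd) (Sigma D Q)"
  proof (rule sum.reindex_nontrivial)
    show "finite (Sigma D Q)" using D(1) QD(1) by auto
    fix x y assume xy: "x \<in> Sigma D Q" "y \<in> Sigma D Q" "x \<noteq> y" "snd x = snd y"
    then obtain K1 K2 k where "K1 \<in> D" "k \<in> Q K1" "K2 \<in> D" "k \<in> Q K2" "K1 \<noteq> K2" "k = snd x"
      by (cases x, cases y) auto
    with int[of K1 k K2 k] have "interior k = {}" by simp
    moreover obtain u v where "k = cbox u v" "k \<noteq> {}"
      using QD(3,4)[OF \<open>K1 \<in> D\<close> \<open>k \<in> Q K1\<close>] by auto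
    ultimately have "k = {u}" by auto
    with g \<open>k = snd x\<close> show "g (snd x) = 0" by metis
  qed
  moreover have "snd ` Sigma D Q = (\<Union>K\<in>D. Q K)" by force
  ultimately show "(\<Sum>k\<in>(\<Union>K\<in>D. Q K). g k) = (\<Sum>K\<in>D. \<Sum>k\<in>Q K. g k)"
    using D(1) QD(1) by (simp add: sum.Sigma o_def case_prod_beta)
qed

text \<open>
  The form in which the Vitali covering lemma is applied: a bound for the total length of disjoint
  subfamilies bounds the outer measure of whatever the whole family covers. The factor 5 is that of the
  covering lemma.
\<close>

lemma Vitali_intervals:
  fixes J :: "(real \<times> real) set"
  assumes J: "\<And>s t. (s,t) \<in> J \<Longrightarrow> s < t \<and> t - s \<le> B"
    and S: "S \<subseteq> (\<Union>(s,t)\<in>J. {s..t})"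
    and bound: "\<And>F. finite F \<Longrightarrow> F \<subseteq> J \<Longrightarrow> pairwise (\<lambda>i j. disjnt {fst i..snd i} {fst j..snd j}) F
       \<Longrightarrow> (\<Sum>(s,t)\<in>F. t - s) \<le> c"
  obtains T where "S \<subseteq> T" "T \<in> lmeasurable" "measure lebesgue T \<le> 5 * c"
proof -
  define ce where "ce = (\<lambda>i::real\<times>real. (fst i + snd i) / 2)"
  define ra where "ra = (\<lambda>i::real\<times>real. (snd i - fst i) / 2)"
  have cb: "cball (ce i) (ra i) = {fst i..snd i}" for i
    unfolding ce_def ra_def cball_eq_atLeastAtMost by (simp add: field_simps)
  have "S \<subseteq> (\<Union>i\<in>J. cball (ce i) (ra i))" using S unfolding cb by (auto simp: case_prod_beta)
  moreover have "0 < ra i \<and> ra i \<le> B" if "i \<in> J" for i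
    using J[of "fst i" "snd i"] that unfolding ra_def by auto
  ultimately obtain C where C: "countable C" "C \<subseteq> J"
     "pairwise (\<lambda>i j. disjnt (cball (ce i) (ra i)) (cball (ce j) (ra j))) C"
     "S \<subseteq> (\<Union>i\<in>C. cball (ce i) (5 * ra i))"
    by (rule Vitali_covering_lemma_cballs)
  have meas: "measure lebesgue (cball (ce i) (5 * ra i)) = 5 * (snd i - fst i)" if "i \<in> C" for i
  proof -
    have "fst i < snd i" using J[of "fst i" "snd i"] that C(2) by auto
    then show ?thesis unfolding cball_eq_atLeastAtMost ra_def by (simp add: field_simps)
  qed
  have b: "measure lebesgue (\<Union>i\<in>F. cball (ce i) (5 * ra i)) \<le> 5 * c" if "F \<subseteq> C" "finite F" for F
  proof -
    have "measure lebesgue (\<Union>i\<in>F. cball (ce i) (5 * ra i)) \<le> (\<Sum>i\<in>F. measure lebesgue (cball (ce i) (5 * ra i)))"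
      using that by (intro measure_UNION_le) auto
    also have "\<dots> = (\<Sum>i\<in>F. 5 * (snd i - fst i))" using that meas by (intro sum.cong) auto
    also have "\<dots> = 5 * (\<Sum>(s,t)\<in>F. t - s)" by (simp add: sum_distrib_left case_prod_beta)
    also have "\<dots> \<le> 5 * c"
      using bound[of F] that C(2) pairwise_subset[OF C(3) that(1)] unfolding cb by auto
    finally show ?thesis .
  qed
  show ?thesis
    by (rule that[OF C(4)]) (auto intro!: fmeasurable_UN_bound[OF C(1) _ b] measure_UN_bound[OF C(1) _ b])
qed

text \<open>
  Austin's argument. Choose a division whose variation is nearly maximal. Within each cell almost every
  point of the exceptional set is an endpoint of an interval on which \<open>f\<close> has slope of size \<open>\<alpha>\<close> against the
  direction of the cell. Disjoint intervals of this kind would increase the variation by \<open>2\<alpha>\<close> times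
  their total length, so that this length is small.
\<close>

lemma negligible_oscillating_slopes:
  fixes f :: "real \<Rightarrow> real"
  assumes BV: "\<And>q. q division_of {a..b} \<Longrightarrow> (\<Sum>k\<in>q. \<bar>incr f k\<bar>) \<le> T" and "\<alpha> > 0" "a < b"
  shows "negligible {x\<in>{a<..<b}. (\<exists>\<^sub>F y in at x. (f y - f x) / (y - x) < - \<alpha>) \<and>
                               (\<exists>\<^sub>F y in at x. (f y - f x) / (y - x) > \<alpha>)}" (is "negligible ?E")
  unfolding negligible_outer_le
proof (intro allI impI)
  fix e :: real assume "e > 0"
  let ?var = "\<lambda>q. \<Sum>k\<in>q. \<bar>incr f k\<bar>"
  define M where "M = (SUP q\<in>{q. q division_of {a..b}}. ?var q)"
  have ne: "{q. q division_of {a..b}} \<noteq> {}"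
    using division_of_self[of a b] \<open>a < b\<close> by auto
  have bdd: "bdd_above (?var ` {q. q division_of {a..b}})" using BV by (auto intro!: bdd_aboveI2)
  \<comment> \<open>This choice yields intervals of total length at most \<open>e / 5\<close>, hence, with the factor 5, a cover of measure at most \<open>e\<close>.\<close>
  define e' where "e' = 2 * \<alpha> * (e / 5)"
  have "e' > 0" using \<open>e > 0\<close> \<open>\<alpha> > 0\<close> by (simp add: e'_def)
  then obtain D where D: "D division_of {a..b}" "?var D > M - e'"
    using less_cSUP_iff[OF ne bdd, of "M - e'"] unfolding M_def by auto
  have M: "?var q \<le> M" if "q division_of {a..b}" for q
    unfolding M_def by (rule cSUP_upper) (use that bdd in auto)
  note DD = division_ofD[OF D(1)]
  define good where "good = (\<lambda>K s t. if f (Inf K) \<le> f (Sup K) then f t - f s \<le> - \<alpha> * (t - s)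
                                   else f t - f s \<ge> \<alpha> * (t - s))"
  \<comment> \<open>Intervals inside the open cells belong to one cell only; the finitely many cell ends are a null set.\<close>
  define J where "J = {(s,t). s < t \<and> (\<exists>K\<in>D. {s..t} \<subseteq> interior K \<and> good K s t)}"
  define ends where "ends = (\<Union>K\<in>D. {Inf K, Sup K})"
  have cell: "\<exists>c d. K = {c..d} \<and> c \<le> d \<and> Inf K = c \<and> Sup K = d" if K: "K \<in> D" for K
  proof -
    obtain u v where "K = cbox u v" using DD(4)[OF K] by blast
    with DD(3)[OF K] show ?thesis by auto
  qed
  have cov: "?E - ends \<subseteq> (\<Union>(s,t)\<in>J. {s..t})"
  proof
    fix x assume x: "x \<in> ?E - ends"
    then have "x \<in> \<Union>D" using DD(6) by auto
    then obtain K where K: "K \<in> D" "x \<in> K" by blast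
    obtain c d where cd: "K = {c..d}" "Inf K = c" "Sup K = d" using cell[OF K(1)] by blast
    have xi: "c < x" "x < d" using K x cd unfolding ends_def by fastforce+
    then have ev: "\<forall>\<^sub>F y in at x. y \<in> {c<..<d} \<and> y \<noteq> x"
      using eventually_at_in_open[of "{c<..<d}" x] by (auto elim: eventually_mono)
    have "\<exists>\<^sub>F y in at x. (if f c \<le> f d then (f y - f x) / (y - x) < - \<alpha> else (f y - f x) / (y - x) > \<alpha>)"
      using x by (cases "f c \<le> f d") auto
    from frequently_ex[OF frequently_eventually_frequently[OF this ev]]
    obtain y where y: "if f c \<le> f d then (f y - f x) / (y - x) < - \<alpha> else (f y - f x) / (y - x) > \<alpha>"
      "c < y" "y < d" "y \<noteq> x" by auto
    have "good K (min x y) (max x y)"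
      using y(1,4) unfolding good_def cd(2,3)
      by (cases "x < y") (auto simp: field_simps min_def max_def split: if_splits)
    then have "(min x y, max x y) \<in> J"
      using y xi K(1) cd unfolding J_def by (auto simp: min_def max_def intro!: bexI[of _ K])
    moreover have "x \<in> {min x y..max x y}" by auto
    ultimately show "x \<in> (\<Union>(s,t)\<in>J. {s..t})" by blast
  qed
  have bnd: "(\<Sum>(s,t)\<in>F. t - s) \<le> e / 5" if F: "finite F" "F \<subseteq> J"
      and dis: "pairwise (\<lambda>i j. disjnt {fst i..snd i} {fst j..snd j}) F" for F
  proof -
    define FK where "FK = (\<lambda>K. {(s,t)\<in>F. {s..t} \<subseteq> interior K \<and> good K s t})"
    have fin: "finite (FK K)" for K using F(1) unfolding FK_def by (rule rev_finite_subset) auto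
    have lt: "s < t" if "(s,t) \<in> F" for s t using F(2) that unfolding J_def by auto
    have ex: "\<exists>q. q division_of K \<and> ?var q \<ge> \<bar>incr f K\<bar> + 2 * \<alpha> * (\<Sum>(s,t)\<in>FK K. t - s)" if K: "K \<in> D" for K
    proof -
      obtain c d where cd: "K = {c..d}" "c \<le> d" "Inf K = c" "Sup K = d" using cell[OF K] by blast
      have FKF: "FK K \<subseteq> F" unfolding FK_def by auto
      obtain q where "q division_of {c..d}" "?var q \<ge> \<bar>f d - f c\<bar> + 2 * \<alpha> * (\<Sum>(s,t)\<in>FK K. t - s)"
      proof (rule cell_gain[of "FK K" c d f \<alpha>])
        show "finite (FK K)" using FKF F(1) finite_subset by blast
        show "pairwise (\<lambda>i j. disjnt {fst i..snd i} {fst j..snd j}) (FK K)"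
          using dis FKF pairwise_subset by blast
        fix s t assume st: "(s,t) \<in> FK K"
        then have "s < t" using lt FKF by blast
        then have "s \<in> {s..t}" "t \<in> {s..t}" by auto
        then have "s \<in> K" "t \<in> K" using st interior_subset unfolding FK_def by blast+
        then show "c \<le> s \<and> s < t \<and> t \<le> d" using \<open>s < t\<close> cd by auto
        show "if f c \<le> f d then f t - f s \<le> - \<alpha> * (t - s) else \<alpha> * (t - s) \<le> f t - f s"
          using st unfolding FK_def good_def cd(3,4) by auto
      qed (use cd in auto)
      then show ?thesis using cd unfolding incr_def by auto
    qed
    then obtain Q where Q: "\<And>K. K \<in> D \<Longrightarrow> Q K division_of K"
      "\<And>K. K \<in> D \<Longrightarrow> ?var (Q K) \<ge> \<bar>incr f K\<bar> + 2 * \<alpha> * (\<Sum>(s,t)\<in>FK K. t - s)" by metis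
    have "(\<Union>K\<in>D. Q K) division_of {a..b}" "?var (\<Union>K\<in>D. Q K) = (\<Sum>K\<in>D. ?var (Q K))"
      using division_of_Union_divisions[OF D(1) Q(1), where g = "\<lambda>k. \<bar>incr f k\<bar>"] by (auto simp: incr_def)
    then have "(\<Sum>K\<in>D. ?var (Q K)) \<le> M" using M by metis
    moreover have "(\<Sum>K\<in>D. ?var (Q K)) \<ge> ?var D + 2 * \<alpha> * (\<Sum>K\<in>D. \<Sum>(s,t)\<in>FK K. t - s)"
      unfolding sum_distrib_left[symmetric] sum.distrib[symmetric]
      by (subst sum_distrib_left, subst sum.distrib[symmetric], rule sum_mono, rule Q(2))
    moreover have "(\<Sum>K\<in>D. \<Sum>(s,t)\<in>FK K. t - s) \<ge> (\<Sum>(s,t)\<in>F. t - s)"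
    proof -
      have "F \<subseteq> (\<Union>K\<in>D. FK K)"
      proof
        fix i assume "i \<in> F"
        with F(2) show "i \<in> (\<Union>K\<in>D. FK K)" unfolding J_def FK_def by (cases i) blast
      qed
      then have "(\<Sum>(s,t)\<in>F. t - s) = (\<Sum>(s,t)\<in>(\<Union>K\<in>D. FK K). t - s)"
        by (intro arg_cong[where f="sum _"]) (auto simp: FK_def)
      also have "(\<Union>K\<in>D. FK K) = snd ` Sigma D FK" by force
      also have "(\<Sum>(s,t)\<in>snd ` Sigma D FK. t - s) \<le> (\<Sum>z\<in>Sigma D FK. case snd z of (s,t) \<Rightarrow> t - s)"
        unfolding o_def[symmetric]
      proof (rule sum_image_le)
        fix i assume "i \<in> Sigma D FK"
        then show "0 \<le> (case snd i of (s,t) \<Rightarrow> t - s)"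
          using lt[of "fst (snd i)" "snd (snd i)"] unfolding FK_def by auto
      qed (use DD(1) fin in auto)
      also have "\<dots> = (\<Sum>K\<in>D. \<Sum>(s,t)\<in>FK K. t - s)"
        using sum.Sigma[of D FK "\<lambda>_ i. case i of (s,t) \<Rightarrow> t - s"] DD(1) fin by (simp add: case_prod_beta)
      finally show ?thesis .
    qed
    ultimately have "2 * \<alpha> * (\<Sum>(s,t)\<in>F. t - s) \<le> e'"
      using D(2) mult_left_mono[of "\<Sum>(s,t)\<in>F. t - s" "\<Sum>K\<in>D. \<Sum>(s,t)\<in>FK K. t - s" "2 * \<alpha>"] \<open>\<alpha> > 0\<close> by linarith
    then show ?thesis using \<open>\<alpha> > 0\<close> unfolding e'_def by simp
  qed
  have Jlen: "s < t \<and> t - s \<le> b - a" if "(s,t) \<in> J" for s t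
  proof -
    from that obtain K where "K \<in> D" "{s..t} \<subseteq> interior K" "s < t" unfolding J_def by auto
    then have "{s..t} \<subseteq> {a..b}" using DD(2) interior_subset by blast
    then show ?thesis using \<open>s < t\<close> by auto
  qed
  obtain U where U: "?E - ends \<subseteq> U" "U \<in> lmeasurable" "measure lebesgue U \<le> 5 * (e/5)"
    by (rule Vitali_intervals[OF Jlen cov bnd])
  have "finite ends" using DD(1) unfolding ends_def by auto
  then have n: "negligible ends" by (rule negligible_finite)
  have "measure lebesgue (U \<union> ends) \<le> e"
    using U measure_Un_le[of U lebesgue ends] n negligible_imp_measure0[OF n]
    by (auto simp: fmeasurableD negligible_imp_sets)
  moreover have "U \<union> ends \<in> lmeasurable"
    using U(2) n by (simp add: fmeasurable.Un negligible_imp_measurable)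
  ultimately show "\<exists>T. ?E \<subseteq> T \<and> T \<in> lmeasurable \<and> measure lebesgue T \<le> e"
    using U(1) by blast
qed

lemma division_cellE:
  assumes "q division_of {c..d::real}" "K \<in> q"
  obtains u v where "K = {u..v}" "c \<le> u" "u \<le> v" "v \<le> d" "Inf K = u" "Sup K = v"
proof -
  note D = division_ofD[OF assms(1)]
  obtain u v where uv: "K = cbox u v" using D(4)[OF assms(2)] by blast
  then have "u \<le> v" using D(3)[OF assms(2)] by auto
  moreover have "{u..v} \<subseteq> {c..d}" using D(2)[OF assms(2)] uv by simp
  ultimately show thesis using that[of u v] uv by auto
qed

text \<open>
  Disjoint intervals with slope at least \<open>N\<close> have total length at most \<open>T / N\<close>.
\<close>

lemma negligible_unbounded_slopes:
  fixes f :: "real \<Rightarrow> real"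
  assumes BV: "\<And>q. q division_of {a..b} \<Longrightarrow> (\<Sum>k\<in>q. \<bar>incr f k\<bar>) \<le> T" and "a < b"
  shows "negligible {x\<in>{a<..<b}. \<forall>N::nat. \<exists>\<^sub>F y in at x. \<bar>(f y - f x) / (y - x)\<bar> > real N}" (is "negligible ?E")
  unfolding negligible_outer_le
proof (intro allI impI)
  fix e :: real assume "e > 0"
  obtain N :: nat where N: "real N > 5 * \<bar>T\<bar> / e" using reals_Archimedean2 by blast
  have "0 \<le> 5 * \<bar>T\<bar> / e" using \<open>e > 0\<close> by simp
  with N have N0: "real N > 0" by linarith
  define J where "J = {(s,t). s < t \<and> a \<le> s \<and> t \<le> b \<and> real N * (t - s) \<le> \<bar>f t - f s\<bar>}"
  have cov: "?E \<subseteq> (\<Union>(s,t)\<in>J. {s..t})"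
  proof
    fix x assume x: "x \<in> ?E"
    then have xi: "a < x" "x < b" and fr: "\<exists>\<^sub>F y in at x. \<bar>(f y - f x) / (y - x)\<bar> > real N" by simp_all
    have ev: "\<forall>\<^sub>F y in at x. y \<in> {a<..<b} \<and> y \<noteq> x"
      using eventually_at_in_open[of "{a<..<b}" x] xi by (auto elim: eventually_mono)
    from frequently_ex[OF frequently_eventually_frequently[OF fr ev]]
    obtain y where y: "\<bar>(f y - f x) / (y - x)\<bar> > real N" "a < y" "y < b" "y \<noteq> x" by auto
    then have "real N * \<bar>y - x\<bar> < \<bar>f y - f x\<bar>"
      by (metis abs_divide pos_less_divide_eq right_minus_eq zero_less_abs_iff)
    then have "(min x y, max x y) \<in> J"
      using y(2-) xi unfolding J_def by (cases "x < y") (auto simp: min_def max_def abs_minus_commute)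
    moreover have "x \<in> {min x y..max x y}" by auto
    ultimately show "x \<in> (\<Union>(s,t)\<in>J. {s..t})" by blast
  qed
  have bnd: "(\<Sum>(s,t)\<in>F. t - s) \<le> e / 5" if F: "finite F" "F \<subseteq> J"
      and dis: "pairwise (\<lambda>i j. disjnt {fst i..snd i} {fst j..snd j}) F" for F
  proof -
    let ?p = "(\<lambda>(s,t). {s..t}) ` F"
    have lt: "s < t" if "(s,t) \<in> F" for s t using F(2) that unfolding J_def by auto
    have pd: "?p division_of \<Union>?p"
      using division_of_disjoint_intervals[OF F(1) lt dis] by auto
    have "\<Union>?p \<subseteq> cbox a b"
    proof (rule Union_least)
      fix X assume "X \<in> ?p"
      then obtain s t where "(s,t) \<in> J" "X = {s..t}" using F(2) by auto
      then show "X \<subseteq> cbox a b" unfolding J_def by auto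
    qed
    then obtain q where q: "?p \<subseteq> q" "q division_of cbox a b"
      using partial_division_extend_interval[OF pd] by metis
    have "real N * (\<Sum>(s,t)\<in>F. t - s) = (\<Sum>(s,t)\<in>F. real N * (t - s))"
      by (simp add: sum_distrib_left case_prod_beta)
    also have "\<dots> \<le> (\<Sum>(s,t)\<in>F. \<bar>f t - f s\<bar>)" using F(2) unfolding J_def by (intro sum_mono) auto
    also have "\<dots> = (\<Sum>k\<in>?p. \<bar>incr f k\<bar>)"
      unfolding incr_def by (rule sum_intervals[symmetric]) (use lt in blast)
    also have "\<dots> \<le> (\<Sum>k\<in>q. \<bar>incr f k\<bar>)"
      using q division_of_finite[OF q(2)] by (intro sum_mono2) auto
    also have "\<dots> \<le> \<bar>T\<bar>" using BV[of q] q(2) by simp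
    also have "\<dots> \<le> real N * (e / 5)" using N \<open>e > 0\<close> by (simp add: field_simps)
    finally show ?thesis using N0 by simp
  qed
  have Jlen: "s < t \<and> t - s \<le> b - a" if "(s,t) \<in> J" for s t
    using that unfolding J_def by auto
  obtain U where U: "?E \<subseteq> U" "U \<in> lmeasurable" "measure lebesgue U \<le> 5 * (e/5)"
    by (rule Vitali_intervals[OF Jlen cov bnd])
  show "\<exists>T. ?E \<subseteq> T \<and> T \<in> lmeasurable \<and> measure lebesgue T \<le> e"
    by (intro exI[of _ U] conjI U(1,2)) (use U(3) in linarith)
qed

text \<open>
  Rational thresholds make the exceptional set of the next theorem a countable union.
\<close>

lemma slope_oscillation_dichotomy:
  fixes g :: "real \<Rightarrow> real"
  assumes "F \<noteq> bot" "\<nexists>l. (g \<longlongrightarrow> l) F" "\<forall>\<^sub>F y in F. \<bar>g y\<bar> \<le> N"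
  shows "\<exists>p\<in>\<rat>. \<exists>q\<in>\<rat>. p < q \<and> (\<exists>\<^sub>F y in F. g y < p) \<and> (\<exists>\<^sub>F y in F. g y > q)"
proof -
  let ?l = "Liminf F (\<lambda>y. ereal (g y))" and ?u = "Limsup F (\<lambda>y. ereal (g y))"
  have le: "?l \<le> ?u" by (rule Liminf_le_Limsup[OF assms(1)])
  have lb: "ereal (- N) \<le> ?l"
    by (rule Liminf_bounded) (use assms(3) in \<open>auto elim: eventually_mono\<close>)
  have ub: "?u \<le> ereal N"
    by (rule Limsup_bounded) (use assms(3) in \<open>auto elim: eventually_mono\<close>)
  have "?l \<noteq> ?u"
  proof
    assume eq: "?l = ?u"
    have "\<bar>?l\<bar> \<noteq> \<infinity>" using lb ub unfolding eq by auto
    then obtain r where r: "?l = ereal r" by (cases ?l) auto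
    have "((\<lambda>y. ereal (g y)) \<longlongrightarrow> ereal r) F"
      using Liminf_eq_Limsup[OF assms(1)] r eq by metis
    with assms(2) show False by simp
  qed
  with le have "?l < ?u" by simp
  then obtain m1 m2 where "?l < ereal m1" "ereal m1 < ereal m2" "ereal m2 < ?u"
    using ereal_dense2 by (metis ereal_dense2)
  then have m: "?l < ereal m1" "m1 < m2" "ereal m2 < ?u" by auto
  obtain p where p: "p \<in> \<rat>" "m1 < p" "p < m2" using Rats_dense_in_real[OF m(2)] by blast
  obtain q where q: "q \<in> \<rat>" "p < q" "q < m2" using Rats_dense_in_real[OF p(3)] by blast
  have lp: "?l < ereal p" using m(1) p(2) by (meson ereal_less(2) less_ereal.simps(1) less_trans)
  have uq: "ereal q < ?u" using m(3) q(3) by (meson less_ereal.simps(1) less_trans)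
  have "\<exists>\<^sub>F y in F. g y < p"
  proof (rule ccontr)
    assume "\<not> ?thesis"
    then have "\<forall>\<^sub>F y in F. ereal p \<le> ereal (g y)" by (simp add: not_frequently not_less)
    from Liminf_bounded[OF this] lp show False by simp
  qed
  moreover have "\<exists>\<^sub>F y in F. g y > q"
  proof (rule ccontr)
    assume "\<not> ?thesis"
    then have "\<forall>\<^sub>F y in F. ereal (g y) \<le> ereal q" by (simp add: not_frequently not_less)
    from Limsup_bounded[OF this] uq show False by simp
  qed
  ultimately show ?thesis using p q by blast
qed

text \<open>
  Slopes oscillating between \<open>p\<close> and \<open>q\<close> become slopes oscillating symmetrically about zero once a linear
  function of slope \<open>(p + q) / 2\<close> is subtracted.
\<close>

theorem bounded_variation_differentiable_ae:
  fixes f :: "real \<Rightarrow> real"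
  assumes BV: "\<And>q. q division_of {a..b} \<Longrightarrow> (\<Sum>k\<in>q. \<bar>incr f k\<bar>) \<le> T" and "a < b"
  shows "negligible {x\<in>{a<..<b}. \<not> f differentiable (at x)}"
proof -
  define E where "E = (\<lambda>(p,q). {x\<in>{a<..<b}. (\<exists>\<^sub>F y in at x. (f y - f x) / (y - x) < p) \<and>
                               (\<exists>\<^sub>F y in at x. (f y - f x) / (y - x) > q)})"
  define E0 where "E0 = {x\<in>{a<..<b}. \<forall>N::nat. \<exists>\<^sub>F y in at x. \<bar>(f y - f x) / (y - x)\<bar> > real N}"
  let ?R = "{(p,q). p \<in> \<rat> \<and> q \<in> \<rat> \<and> p < (q::real)}"
  have neg: "negligible (E (p,q))" if "p < q" for p q
  proof -
    define g where "g = (\<lambda>x. f x - (p+q)/2 * x)"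
    have slope: "(g y - g x) / (y - x) = (f y - f x) / (y - x) - (p+q)/2" if "y \<noteq> x" for x y
      using that by (simp add: g_def field_simps)
    have ev: "\<forall>\<^sub>F y in at x. y \<noteq> x" for x :: real by (simp add: eventually_at_filter)
    have "negligible {x\<in>{a<..<b}. (\<exists>\<^sub>F y in at x. (g y - g x) / (y - x) < - ((q-p)/2)) \<and>
                               (\<exists>\<^sub>F y in at x. (g y - g x) / (y - x) > (q-p)/2)}"
    proof (rule negligible_oscillating_slopes[where T = "T + \<bar>(p+q)/2\<bar> * (b - a)"])
      fix Q assume Q: "Q division_of {a..b}"
      have "(\<Sum>k\<in>Q. \<bar>incr g k\<bar>) \<le> (\<Sum>k\<in>Q. \<bar>incr f k\<bar> + \<bar>(p+q)/2\<bar> * incr (\<lambda>x. x) k)"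
      proof (rule sum_mono)
        fix k assume "k \<in> Q"
        then obtain u v where "u \<le> v" "Inf k = u" "Sup k = v" by (rule division_cellE[OF Q])
        then have "incr g k = (f v - f u) - (p+q)/2 * (v - u)" "\<bar>(p+q)/2 * (v - u)\<bar> = \<bar>(p+q)/2\<bar> * (v - u)"
          by (simp_all only: incr_def g_def abs_mult) (simp_all add: field_simps)
        moreover have "incr f k = f v - f u" "incr (\<lambda>x. x) k = v - u"
          using \<open>Inf k = u\<close> \<open>Sup k = v\<close> by (simp_all add: incr_def)
        ultimately show "\<bar>incr g k\<bar> \<le> \<bar>incr f k\<bar> + \<bar>(p+q)/2\<bar> * incr (\<lambda>x. x) k"
          using abs_triangle_ineq4[of "f v - f u" "(p+q)/2 * (v - u)"] by simp
      qed
      also have "\<dots> \<le> T + \<bar>(p+q)/2\<bar> * (b - a)"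
        using BV[OF Q] sum_incr_division[OF Q, of "\<lambda>x. x"] \<open>a < b\<close>
        by (simp only: sum.distrib sum_distrib_left[symmetric])
      finally show "(\<Sum>k\<in>Q. \<bar>incr g k\<bar>) \<le> T + \<bar>(p+q)/2\<bar> * (b - a)" .
    qed (use that \<open>a < b\<close> in auto)
    moreover have "E (p,q) \<subseteq> {x\<in>{a<..<b}. (\<exists>\<^sub>F y in at x. (g y - g x) / (y - x) < - ((q-p)/2)) \<and>
                               (\<exists>\<^sub>F y in at x. (g y - g x) / (y - x) > (q-p)/2)}"
    proof -
      have "(\<exists>\<^sub>F y in at x. (g y - g x) / (y - x) < - ((q-p)/2))" if "\<exists>\<^sub>F y in at x. (f y - f x) / (y - x) < p" for x
        using frequently_eventually_frequently[OF that ev]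
        by (rule frequently_elim1) (elim conjE, subst slope, assumption, argo)
      moreover have "(\<exists>\<^sub>F y in at x. (g y - g x) / (y - x) > (q-p)/2)" if "\<exists>\<^sub>F y in at x. (f y - f x) / (y - x) > q" for x
        using frequently_eventually_frequently[OF that ev]
        by (rule frequently_elim1) (elim conjE, subst slope, assumption, argo)
      ultimately show ?thesis unfolding E_def by blast
    qed
    ultimately show ?thesis using negligible_subset by blast
  qed
  have "negligible (\<Union>(E ` ?R))"
  proof (rule negligible_countable_Union)
    have "?R \<subseteq> \<rat> \<times> \<rat>" by auto
    then show "countable (E ` ?R)"
      by (intro countable_image) (rule countable_subset, assumption, intro countable_SIGMA countable_rat)
  qed (use neg in auto)
  moreover have "negligible E0" unfolding E0_def by (rule negligible_unbounded_slopes[OF BV \<open>a < b\<close>])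
  moreover have "{x\<in>{a<..<b}. \<not> f differentiable (at x)} \<subseteq> \<Union>(E ` ?R) \<union> E0"
  proof
    fix x assume x: "x \<in> {x\<in>{a<..<b}. \<not> f differentiable (at x)}"
    have nl: "\<nexists>l. ((\<lambda>y. (f y - f x) / (y - x)) \<longlongrightarrow> l) (at x)"
      using x unfolding real_differentiable_def has_field_derivative_iff by auto
    show "x \<in> \<Union>(E ` ?R) \<union> E0"
    proof (cases "x \<in> E0")
      case False
      then obtain N :: nat where "\<forall>\<^sub>F y in at x. \<bar>(f y - f x) / (y - x)\<bar> \<le> real N"
        using x unfolding E0_def by (auto simp: not_frequently not_less)
      from slope_oscillation_dichotomy[OF _ nl this] x show ?thesis
        unfolding E_def by (auto simp: trivial_limit_at)
    qed auto
  qed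
  ultimately show ?thesis using negligible_subset negligible_Un by blast
qed

section \<open>Absolutely continuous curves\<close>

definition ac_modulus :: "real \<Rightarrow> real \<Rightarrow> (real \<Rightarrow> 'a::metric_space) \<Rightarrow> real \<Rightarrow> real \<Rightarrow> bool" where
  "ac_modulus a b \<gamma> e \<delta> \<longleftrightarrow> (\<forall>(N::nat) l r.
        (\<forall>k<N. a \<le> l k \<and> l k \<le> r k \<and> r k \<le> b) \<and>
        disjoint_family_on (\<lambda>k. {l k<..<r k}) {..<N} \<and>
        (\<Sum>k<N. r k - l k) < \<delta> \<longrightarrow>
        (\<Sum>k<N. dist (\<gamma> (l k)) (\<gamma> (r k))) < e)"

lemma ac_modulusD:
  assumes "ac_modulus a b \<gamma> e \<delta>"
    and "(\<forall>k<(N::nat). a \<le> l k \<and> l k \<le> r k \<and> r k \<le> b) \<and>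
      disjoint_family_on (\<lambda>k. {l k<..<r k}) {..<N} \<and> (\<Sum>k<N. r k - l k) < \<delta>"
  shows "(\<Sum>k<N. dist (\<gamma> (l k)) (\<gamma> (r k))) < e"
  by (rule assms(1)[unfolded ac_modulus_def, THEN spec, THEN spec, THEN spec, THEN mp, OF assms(2)])

lemma abs_continuous_on_Icc_iff_modulus:
  "abs_continuous_on_Icc a b \<gamma> \<longleftrightarrow> (\<forall>e>0. \<exists>\<delta>>0. ac_modulus a b \<gamma> e \<delta>)"
  unfolding abs_continuous_on_Icc_def ac_modulus_def by (rule refl)

lemma abs_continuous_on_IccE:
  assumes "abs_continuous_on_Icc a b \<gamma>" "e > 0"
  obtains \<delta> where "\<delta> > 0" "ac_modulus a b \<gamma> e \<delta>"
  using assms unfolding abs_continuous_on_Icc_iff_modulus by blast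

lemma abs_continuous_on_IccI:
  assumes "\<And>e. e > 0 \<Longrightarrow> \<exists>\<delta>>0. ac_modulus a b \<gamma> e \<delta>"
  shows "abs_continuous_on_Icc a b \<gamma>"
  unfolding abs_continuous_on_Icc_iff_modulus using assms by blast

text \<open>
  Absolute continuity for finite sets of intervals, the shape in which divisions of an interval provide them.
\<close>

lemma abs_continuous_on_IccD_sets:
  assumes "abs_continuous_on_Icc a b \<gamma>" "e > 0"
  obtains \<delta> where "\<delta> > 0"
    "\<And>F. finite F \<Longrightarrow> (\<And>K. K \<in> F \<Longrightarrow> \<exists>l r. K = {l..r} \<and> a \<le> l \<and> l \<le> r \<and> r \<le> b) \<Longrightarrow>
      (\<And>K K'. K \<in> F \<Longrightarrow> K' \<in> F \<Longrightarrow> K \<noteq> K' \<Longrightarrow> interior K \<inter> interior K' = {}) \<Longrightarrow>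
      (\<Sum>K\<in>F. Sup K - Inf K) < \<delta> \<Longrightarrow> (\<Sum>K\<in>F. dist (\<gamma> (Inf K)) (\<gamma> (Sup K))) < e"
proof -
  obtain \<delta> where \<delta>: "\<delta> > 0" "ac_modulus a b \<gamma> e \<delta>"
    by (rule abs_continuous_on_IccE[OF assms])
  show ?thesis
  proof (rule that[OF \<delta>(1)])
    fix F :: "real set set"
    assume F: "finite F" "\<And>K. K \<in> F \<Longrightarrow> \<exists>l r. K = {l..r} \<and> a \<le> l \<and> l \<le> r \<and> r \<le> b"
      "\<And>K K'. K \<in> F \<Longrightarrow> K' \<in> F \<Longrightarrow> K \<noteq> K' \<Longrightarrow> interior K \<inter> interior K' = {}"
      "(\<Sum>K\<in>F. Sup K - Inf K) < \<delta>"
    obtain h where h: "bij_betw h {..<card F} F"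
      using ex_bij_betw_nat_finite[OF F(1)] by (auto simp: lessThan_atLeast0)
    have hF: "h k \<in> F" if "k < card F" for k using h that by (auto simp: bij_betw_def)
    have rep: "h k = {Inf (h k)..Sup (h k)}" "a \<le> Inf (h k)" "Inf (h k) \<le> Sup (h k)" "Sup (h k) \<le> b" if k: "k < card F" for k
    proof -
      obtain l r where lr: "h k = {l..r}" "a \<le> l" "l \<le> r" "r \<le> b" using F(2)[OF hF[OF k]] by blast
      have "Inf (h k) = l" "Sup (h k) = r" unfolding lr(1) using lr(3) by auto
      with lr show "h k = {Inf (h k)..Sup (h k)}" "a \<le> Inf (h k)" "Inf (h k) \<le> Sup (h k)" "Sup (h k) \<le> b" by simp_all
    qed
    have "(\<Sum>k<card F. dist (\<gamma> (Inf (h k))) (\<gamma> (Sup (h k)))) < e"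
    proof (rule ac_modulusD[OF \<delta>(2)], intro conjI)
      show "disjoint_family_on (\<lambda>k. {Inf (h k)<..<Sup (h k)}) {..<card F}"
        unfolding disjoint_family_on_def
      proof (intro ballI impI)
        fix i j assume ij: "i \<in> {..<card F}" "j \<in> {..<card F}" "i \<noteq> j"
        then have "h i \<noteq> h j" using h by (auto simp: bij_betw_def inj_on_def)
        then have "interior (h i) \<inter> interior (h j) = {}" using F(3) hF ij by auto
        then show "{Inf (h i)<..<Sup (h i)} \<inter> {Inf (h j)<..<Sup (h j)} = {}"
          using rep(1)[of i] rep(1)[of j] ij by (metis interior_atLeastAtMost_real lessThan_iff)
      qed
      show "(\<Sum>k<card F. Sup (h k) - Inf (h k)) < \<delta>"
        using F(4) sum.reindex_bij_betw[OF h, of "\<lambda>K. Sup K - Inf K"] by simp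
    qed (use rep in auto)
    then show "(\<Sum>K\<in>F. dist (\<gamma> (Inf K)) (\<gamma> (Sup K))) < e"
      using sum.reindex_bij_betw[OF h, of "\<lambda>K. dist (\<gamma> (Inf K)) (\<gamma> (Sup K))"] by simp
  qed
qed

lemma abs_continuous_dist_mono:
  assumes "abs_continuous_on_Icc a b \<gamma>"
    and "\<And>s t. a \<le> s \<Longrightarrow> s \<le> t \<Longrightarrow> t \<le> b \<Longrightarrow> dist (\<gamma>' s) (\<gamma>' t) \<le> dist (\<gamma> s) (\<gamma> t)"
  shows "abs_continuous_on_Icc a b \<gamma>'"
proof (rule abs_continuous_on_IccI)
  fix e :: real assume "e > 0"
  obtain \<delta> where \<delta>: "\<delta> > 0" "ac_modulus a b \<gamma> e \<delta>"
    by (rule abs_continuous_on_IccE[OF assms(1) \<open>e > 0\<close>])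
  show "\<exists>\<delta>>0. ac_modulus a b \<gamma>' e \<delta>"
    unfolding ac_modulus_def
  proof (intro exI[of _ \<delta>] conjI \<delta>(1) allI impI)
    fix N :: nat and l r
    assume lr: "(\<forall>k<N. a \<le> l k \<and> l k \<le> r k \<and> r k \<le> b) \<and>
      disjoint_family_on (\<lambda>k. {l k<..<r k}) {..<N} \<and> (\<Sum>k<N. r k - l k) < \<delta>"
    have "(\<Sum>k<N. dist (\<gamma>' (l k)) (\<gamma>' (r k))) \<le> (\<Sum>k<N. dist (\<gamma> (l k)) (\<gamma> (r k)))"
      by (intro sum_mono assms(2)) (use lr in auto)
    also have "\<dots> < e" by (rule ac_modulusD[OF \<delta>(2)]) (rule lr)
    finally show "(\<Sum>k<N. dist (\<gamma>' (l k)) (\<gamma>' (r k))) < e" .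
  qed
qed

lemma abs_continuous_component:
  fixes \<gamma> :: "real \<Rightarrow> real^'n"
  assumes "abs_continuous_on_Icc a b \<gamma>"
  shows "abs_continuous_on_Icc a b (\<lambda>t. \<gamma> t $ i)"
  by (rule abs_continuous_dist_mono[OF assms]) (rule dist_vec_nth_le)

lemma abs_continuous_add:
  fixes \<gamma> \<gamma>' :: "real \<Rightarrow> 'a::real_normed_vector"
  assumes "abs_continuous_on_Icc a b \<gamma>" "abs_continuous_on_Icc a b \<gamma>'"
  shows "abs_continuous_on_Icc a b (\<lambda>t. \<gamma> t + \<gamma>' t)"
proof (rule abs_continuous_on_IccI)
  fix e :: real assume "e > 0"
  then have e2: "e / 2 > 0" by simp
  obtain \<delta> where \<delta>: "\<delta> > 0" "ac_modulus a b \<gamma> (e / 2) \<delta>"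
    by (rule abs_continuous_on_IccE[OF assms(1) e2])
  obtain \<delta>' where \<delta>': "\<delta>' > 0" "ac_modulus a b \<gamma>' (e / 2) \<delta>'"
    by (rule abs_continuous_on_IccE[OF assms(2) e2])
  show "\<exists>\<delta>>0. ac_modulus a b (\<lambda>t. \<gamma> t + \<gamma>' t) e \<delta>"
    unfolding ac_modulus_def
  proof (intro exI[of _ "min \<delta> \<delta>'"] conjI allI impI)
    fix N :: nat and l r
    assume lr: "(\<forall>k<N. a \<le> l k \<and> l k \<le> r k \<and> r k \<le> b) \<and>
      disjoint_family_on (\<lambda>k. {l k<..<r k}) {..<N} \<and> (\<Sum>k<N. r k - l k) < min \<delta> \<delta>'"
    have "(\<Sum>k<N. dist (\<gamma> (l k) + \<gamma>' (l k)) (\<gamma> (r k) + \<gamma>' (r k))) \<le>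
      (\<Sum>k<N. dist (\<gamma> (l k)) (\<gamma> (r k)) + dist (\<gamma>' (l k)) (\<gamma>' (r k)))"
      by (intro sum_mono dist_triangle_add)
    also have "\<dots> = (\<Sum>k<N. dist (\<gamma> (l k)) (\<gamma> (r k))) + (\<Sum>k<N. dist (\<gamma>' (l k)) (\<gamma>' (r k)))"
      by (rule sum.distrib)
    also have "\<dots> < e / 2 + e / 2"
      by (intro add_strict_mono ac_modulusD[OF \<delta>(2)]
          ac_modulusD[OF \<delta>'(2)]) (use lr in simp_all)
    finally show "(\<Sum>k<N. dist (\<gamma> (l k) + \<gamma>' (l k)) (\<gamma> (r k) + \<gamma>' (r k))) < e" by simp
  qed (use \<delta>(1) \<delta>'(1) in simp)
qed

lemma lipschitz_imp_abs_continuous: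
  assumes "C > 0" "\<And>s t. dist (\<gamma> s) (\<gamma> t) \<le> C * dist s t"
  shows "abs_continuous_on_Icc a b \<gamma>"
proof (rule abs_continuous_on_IccI)
  fix e :: real assume "e > 0"
  show "\<exists>\<delta>>0. ac_modulus a b \<gamma> e \<delta>"
    unfolding ac_modulus_def
  proof (intro exI[of _ "e / C"] conjI allI impI)
    fix N :: nat and l r
    assume lr: "(\<forall>k<N. a \<le> l k \<and> l k \<le> r k \<and> r k \<le> b) \<and>
      disjoint_family_on (\<lambda>k. {l k<..<r k}) {..<N} \<and> (\<Sum>k<N. r k - l k) < e / C"
    have "(\<Sum>k<N. dist (\<gamma> (l k)) (\<gamma> (r k))) \<le> (\<Sum>k<N. C * (r k - l k))"
    proof (rule sum_mono)
      fix k assume "k \<in> {..<N}"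
      with lr have "dist (l k) (r k) = r k - l k" by (simp add: dist_real_def)
      with assms(2)[of "l k" "r k"] show "dist (\<gamma> (l k)) (\<gamma> (r k)) \<le> C * (r k - l k)" by simp
    qed
    also have "\<dots> = C * (\<Sum>k<N. r k - l k)" by (simp add: sum_distrib_left)
    also have "\<dots> < e" using lr assms(1) by (simp add: pos_less_divide_eq mult.commute)
    finally show "(\<Sum>k<N. dist (\<gamma> (l k)) (\<gamma> (r k))) < e" .
  qed (use \<open>e > 0\<close> assms(1) in simp)
qed

lemma abs_continuous_stopped:
  assumes "abs_continuous_on_Icc 0 T \<gamma>" "0 \<le> T"
  shows "abs_continuous_on_Icc 0 T' (\<lambda>t. \<gamma> (min t T))"
proof (rule abs_continuous_on_IccI)
  fix e :: real assume "e > 0"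
  obtain \<delta> where \<delta>: "\<delta> > 0" "ac_modulus 0 T \<gamma> e \<delta>"
    by (rule abs_continuous_on_IccE[OF assms(1) \<open>e > 0\<close>])
  show "\<exists>\<delta>>0. ac_modulus 0 T' (\<lambda>t. \<gamma> (min t T)) e \<delta>"
    unfolding ac_modulus_def
  proof (intro exI[of _ \<delta>] conjI \<delta>(1) allI impI)
    fix N :: nat and l r
    assume lr: "(\<forall>k<N. 0 \<le> l k \<and> l k \<le> r k \<and> r k \<le> T') \<and>
      disjoint_family_on (\<lambda>k. {l k<..<r k}) {..<N} \<and> (\<Sum>k<N. r k - l k) < \<delta>"
    let ?l = "\<lambda>k. min (l k) T" and ?r = "\<lambda>k. min (r k) T"
    have "{?l k<..<?r k} \<subseteq> {l k<..<r k}" for k by auto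
    then have "disjoint_family_on (\<lambda>k. {?l k<..<?r k}) {..<N}"
      using lr unfolding disjoint_family_on_def by blast
    moreover have "(\<Sum>k<N. ?r k - ?l k) \<le> (\<Sum>k<N. r k - l k)"
      using lr by (intro sum_mono) (auto simp: min_def)
    moreover have "\<forall>k<N. 0 \<le> ?l k \<and> ?l k \<le> ?r k \<and> ?r k \<le> T" using lr assms(2) by (auto simp: min_def)
    ultimately show "(\<Sum>k<N. dist (\<gamma> (?l k)) (\<gamma> (?r k))) < e"
      by (intro ac_modulusD[OF \<delta>(2)]) (use lr in auto)
  qed
qed

lemma abs_continuous_imp_continuous_on:
  assumes "abs_continuous_on_Icc a b \<gamma>"
  shows "continuous_on {a..b} \<gamma>"
  unfolding continuous_on_iff
proof (intro ballI allI impI)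
  fix x e :: real assume x: "x \<in> {a..b}" and "e > 0"
  obtain \<delta> where \<delta>: "\<delta> > 0" "ac_modulus a b \<gamma> e \<delta>"
    by (rule abs_continuous_on_IccE[OF assms \<open>e > 0\<close>])
  show "\<exists>d>0. \<forall>x'\<in>{a..b}. dist x' x < d \<longrightarrow> dist (\<gamma> x') (\<gamma> x) < e"
  proof (intro exI[of _ \<delta>] conjI \<delta>(1) ballI impI)
    fix x' assume x': "x' \<in> {a..b}" "dist x' x < \<delta>"
    have "(\<Sum>k<Suc 0. dist (\<gamma> (min x x')) (\<gamma> (max x x'))) < e"
      by (rule ac_modulusD[OF \<delta>(2)])
        (use x x' in \<open>auto simp: disjoint_family_on_def dist_real_def\<close>)
    then show "dist (\<gamma> x') (\<gamma> x) < e"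
      by (cases "x \<le> x'") (auto simp: dist_commute min_def max_def)
  qed
qed

text \<open>
  On an interval shorter than the \<open>\<delta>\<close> that belongs to \<open>\<epsilon> = 1\<close> all variation sums are at most 1; countably many
  such intervals with rational ends cover \<open>(a, b)\<close>.
\<close>

lemma abs_continuous_differentiable_ae_real:
  fixes f :: "real \<Rightarrow> real"
  assumes "abs_continuous_on_Icc a b f"
  shows "negligible {x\<in>{a<..<b}. \<not> f differentiable (at x)}"
proof -
  obtain \<delta> where \<delta>: "\<delta> > 0"
    "\<And>F. finite F \<Longrightarrow> (\<And>K. K \<in> F \<Longrightarrow> \<exists>l r. K = {l..r} \<and> a \<le> l \<and> l \<le> r \<and> r \<le> b) \<Longrightarrow>
      (\<And>K K'. K \<in> F \<Longrightarrow> K' \<in> F \<Longrightarrow> K \<noteq> K' \<Longrightarrow> interior K \<inter> interior K' = {}) \<Longrightarrow>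
      (\<Sum>K\<in>F. Sup K - Inf K) < \<delta> \<Longrightarrow> (\<Sum>K\<in>F. dist (f (Inf K)) (f (Sup K))) < 1"
    by (rule abs_continuous_on_IccD_sets[OF assms zero_less_one]) blast
  have loc: "negligible {x\<in>{c<..<d}. \<not> f differentiable (at x)}" if cd: "a \<le> c" "c < d" "d \<le> b" "d - c < \<delta>" for c d
  proof (rule bounded_variation_differentiable_ae)
    fix q assume q: "q division_of {c..d}"
    note D = division_ofD[OF q]
    have "(\<Sum>K\<in>q. dist (f (Inf K)) (f (Sup K))) < 1"
    proof (rule \<delta>(2)[OF D(1) _ D(5)])
      fix K assume K: "K \<in> q"
      obtain u v where uv: "K = {u..v}" "c \<le> u" "u \<le> v" "v \<le> d" using K by (rule division_cellE[OF q])
      show "\<exists>l r. K = {l..r} \<and> a \<le> l \<and> l \<le> r \<and> r \<le> b"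
        by (intro exI[of _ u] exI[of _ v]) (use uv cd in auto)
    next
      show "(\<Sum>K\<in>q. Sup K - Inf K) < \<delta>"
        using sum_incr_division[OF q, of "\<lambda>x. x"] cd by (simp add: incr_def)
    qed auto
    then show "(\<Sum>K\<in>q. \<bar>incr f K\<bar>) \<le> 1" by (simp add: incr_def dist_real_def abs_minus_commute)
  qed (use cd in auto)
  let ?R = "{(c,d). c \<in> \<rat> \<and> d \<in> \<rat> \<and> a \<le> c \<and> c < d \<and> d \<le> b \<and> d - c < \<delta>}"
  have "negligible (\<Union>((\<lambda>(c,d). {x\<in>{c<..<d}. \<not> f differentiable (at x)}) ` ?R))"
  proof (rule negligible_countable_Union)
    have "?R \<subseteq> \<rat> \<times> \<rat>" by auto
    then show "countable ((\<lambda>(c,d). {x\<in>{c<..<d}. \<not> f differentiable (at x)}) ` ?R)"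
      by (intro countable_image) (rule countable_subset, assumption, intro countable_SIGMA countable_rat)
  qed (use loc in auto)
  moreover have "{x\<in>{a<..<b}. \<not> f differentiable (at x)} \<subseteq> \<Union>((\<lambda>(c,d). {x\<in>{c<..<d}. \<not> f differentiable (at x)}) ` ?R)"
  proof
    fix x assume x: "x \<in> {x\<in>{a<..<b}. \<not> f differentiable (at x)}"
    then have "max a (x - \<delta>/2) < x" "x < min b (x + \<delta>/2)" using \<delta>(1) by auto
    then obtain c d where "c \<in> \<rat>" "max a (x - \<delta>/2) < c" "c < x" "d \<in> \<rat>" "x < d" "d < min b (x + \<delta>/2)"
      using Rats_dense_in_real[of "max a (x - \<delta>/2)" x] Rats_dense_in_real[of x "min b (x + \<delta>/2)"] by blast
    then have "(c,d) \<in> ?R" "x \<in> {c<..<d}" by auto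
    with x show "x \<in> \<Union>((\<lambda>(c,d). {x\<in>{c<..<d}. \<not> f differentiable (at x)}) ` ?R)" by blast
  qed
  ultimately show ?thesis using negligible_subset by blast
qed

theorem abs_continuous_differentiable_ae:
  fixes \<gamma> :: "real \<Rightarrow> real^'n"
  assumes "abs_continuous_on_Icc a b \<gamma>"
  shows "negligible {x\<in>{a<..<b}. \<not> \<gamma> differentiable (at x)}"
proof -
  have "negligible (\<Union>i. {x\<in>{a<..<b}. \<not> (\<lambda>t. \<gamma> t $ i) differentiable (at x)})"
  proof (rule negligible_countable_Union)
    fix X assume "X \<in> range (\<lambda>i. {x\<in>{a<..<b}. \<not> (\<lambda>t. \<gamma> t $ i) differentiable (at x)})"
    then show "negligible X"
      using abs_continuous_differentiable_ae_real[OF abs_continuous_component[OF assms]] by blast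
  qed (simp add: countable_finite)
  moreover have "{x\<in>{a<..<b}. \<not> \<gamma> differentiable (at x)} \<subseteq> (\<Union>i. {x\<in>{a<..<b}. \<not> (\<lambda>t. \<gamma> t $ i) differentiable (at x)})"
  proof -
    have "\<gamma> differentiable (at x)" if "\<forall>i. (\<lambda>t. \<gamma> t $ i) differentiable (at x)" for x
      using that by (subst differentiable_componentwise_within)
        (auto simp: Basis_vec_def inner_axis)
    then show ?thesis by blast
  qed
  ultimately show ?thesis using negligible_subset by blast
qed

section \<open>Eikonal subsolutions and the action\<close>

text \<open>
  The local Lipschitz constant of \<open>w\<close> at \<open>y\<close> is at most \<open>sqrt (V y)\<close>. This replaces the viscosity inequality
  \<open>|Dw|\<^sup>2 \<le> V\<close> and is easier to use: it passes to minima, to compositions with contractions and along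
  curves without any differentiability of \<open>w\<close>.
\<close>

definition eikonal_sub :: "(real^'n \<Rightarrow> real) \<Rightarrow> (real^'n \<Rightarrow> real) \<Rightarrow> bool" where
  "eikonal_sub V w \<longleftrightarrow> (\<forall>y. \<forall>e>0. \<exists>\<delta>>0. \<forall>a\<in>ball y \<delta>. \<forall>b\<in>ball y \<delta>.
     \<bar>w a - w b\<bar> \<le> (sqrt (V y) + e) * norm (a - b))"

lemma eikonal_subE:
  assumes "eikonal_sub V w" "e > 0"
  obtains \<delta> where "\<delta> > 0"
    "\<And>a b. dist y a < \<delta> \<Longrightarrow> dist y b < \<delta> \<Longrightarrow> \<bar>w a - w b\<bar> \<le> (sqrt (V y) + e) * norm (a - b)"
  using assms unfolding eikonal_sub_def by (metis mem_ball)

lemma eikonal_sub_continuous: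
  fixes w :: "real^'n \<Rightarrow> real"
  assumes "eikonal_sub V w" "\<And>y. V y \<ge> 0"
  shows "continuous_on UNIV w"
  unfolding continuous_on_iff
proof (intro ballI allI impI)
  fix x :: "real^'n" and e :: real assume e: "e > 0"
  obtain d where d: "d > 0"
    "\<And>a b. dist x a < d \<Longrightarrow> dist x b < d \<Longrightarrow> \<bar>w a - w b\<bar> \<le> (sqrt (V x) + 1) * norm (a - b)"
    using eikonal_subE[OF assms(1) zero_less_one, of x] by blast
  have L: "sqrt (V x) + 1 > 0" using assms(2) by (simp add: add_nonneg_pos)
  show "\<exists>d>0. \<forall>x'\<in>UNIV. dist x' x < d \<longrightarrow> dist (w x') (w x) < e"
  proof (intro exI[of _ "min d (e / (sqrt (V x) + 1))"] conjI ballI impI)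
    fix x' assume x': "dist x' x < min d (e / (sqrt (V x) + 1))"
    have "\<bar>w x' - w x\<bar> \<le> (sqrt (V x) + 1) * norm (x' - x)"
      by (rule d(2)) (use x' d(1) in \<open>auto simp: dist_commute\<close>)
    also have "\<dots> < e" using x' L by (simp add: dist_norm pos_less_divide_eq mult.commute)
    finally show "dist (w x') (w x) < e" by (simp add: dist_real_def)
  qed (use d(1) e L in simp)
qed

lemma eikonal_sub_contraction:
  assumes "eikonal_sub V w" and \<tau>: "\<And>s t. \<bar>\<tau> s - \<tau> t\<bar> \<le> \<bar>s - t\<bar>"
  shows "eikonal_sub V (\<lambda>x. \<tau> (w x))"
  unfolding eikonal_sub_def
proof (intro allI impI)
  fix y and e :: real assume "e > 0"
  then obtain d where d: "d > 0"
    "\<And>a b. dist y a < d \<Longrightarrow> dist y b < d \<Longrightarrow> \<bar>w a - w b\<bar> \<le> (sqrt (V y) + e) * norm (a - b)"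
    using eikonal_subE[OF assms(1), of e y] by blast
  show "\<exists>\<delta>>0. \<forall>a\<in>ball y \<delta>. \<forall>b\<in>ball y \<delta>. \<bar>\<tau> (w a) - \<tau> (w b)\<bar> \<le> (sqrt (V y) + e) * norm (a - b)"
    by (intro exI[of _ d] conjI d(1) ballI order_trans[OF \<tau>] d(2)) auto
qed

lemma eikonal_sub_min:
  assumes "eikonal_sub V w" "eikonal_sub V w'"
  shows "eikonal_sub V (\<lambda>x. min (w x) (w' x))"
  unfolding eikonal_sub_def
proof (intro allI impI)
  fix y and e :: real assume e: "e > 0"
  obtain d where d: "d > 0"
    "\<And>a b. dist y a < d \<Longrightarrow> dist y b < d \<Longrightarrow> \<bar>w a - w b\<bar> \<le> (sqrt (V y) + e) * norm (a - b)"
    using eikonal_subE[OF assms(1) e, of y] by blast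
  obtain d' where d': "d' > 0"
    "\<And>a b. dist y a < d' \<Longrightarrow> dist y b < d' \<Longrightarrow> \<bar>w' a - w' b\<bar> \<le> (sqrt (V y) + e) * norm (a - b)"
    using eikonal_subE[OF assms(2) e, of y] by blast
  show "\<exists>\<delta>>0. \<forall>a\<in>ball y \<delta>. \<forall>b\<in>ball y \<delta>. \<bar>min (w a) (w' a) - min (w b) (w' b)\<bar> \<le> (sqrt (V y) + e) * norm (a - b)"
  proof (intro exI[of _ "min d d'"] conjI ballI)
    fix a b assume "a \<in> ball y (min d d')" "b \<in> ball y (min d d')"
    then have "\<bar>w a - w b\<bar> \<le> (sqrt (V y) + e) * norm (a - b)" "\<bar>w' a - w' b\<bar> \<le> (sqrt (V y) + e) * norm (a - b)"
      by (auto intro!: d(2) d'(2))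
    then show "\<bar>min (w a) (w' a) - min (w b) (w' b)\<bar> \<le> (sqrt (V y) + e) * norm (a - b)" by linarith
  qed (use d(1) d'(1) in simp)
qed

lemma eikonal_sub_Min:
  assumes "finite I" "I \<noteq> {}" "\<And>i. i \<in> I \<Longrightarrow> eikonal_sub V (w i)"
  shows "eikonal_sub V (\<lambda>x. MIN i\<in>I. w i x)"
  using assms
proof (induction rule: finite_ne_induct)
  case (insert i I)
  then have "eikonal_sub V (\<lambda>x. min (w i x) (MIN i\<in>I. w i x))" by (intro eikonal_sub_min) auto
  then show ?case using insert.hyps by simp
qed simp

text \<open>
  At the maximum \<open>y\<close> of \<open>t w - s |x - \<cdot>|\<^sup>2\<close> the penalty changes at rate \<open>2 s |x - y|\<close> in the direction of
  \<open>x\<close>, and \<open>t w\<close> changes at rate at most \<open>t sqrt (V y)\<close>.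
\<close>

lemma eikonal_sub_penalised_max:
  fixes w :: "real^'n \<Rightarrow> real"
  assumes w: "eikonal_sub V w" and t: "t \<ge> 0" and s: "s > 0"
    and max: "\<And>y'. t * w y' - s * (norm (x - y'))\<^sup>2 \<le> t * w y - s * (norm (x - y))\<^sup>2"
    and V: "V y \<ge> 0"
  shows "2 * s * norm (x - y) \<le> t * sqrt (V y)"
proof (cases "x = y")
  case False
  define P where "P = norm (x - y)"
  have P: "P > 0" using False by (simp add: P_def)
  have "2 * s * P \<le> t * sqrt (V y)"
  proof (rule field_le_epsilon)
    fix e0 :: real assume e0: "e0 > 0"
    define e where "e = e0 / (t + 1)"
    have e: "e > 0" "(t + 1) * e = e0" using e0 t by (auto simp: e_def)
    obtain d where d: "d > 0"
      "\<And>a b. dist y a < d \<Longrightarrow> dist y b < d \<Longrightarrow> \<bar>w a - w b\<bar> \<le> (sqrt (V y) + e) * norm (a - b)"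
      using eikonal_subE[OF w e(1), of y] by blast
    define \<rho> where "\<rho> = min (1/2) (min (d / (2 * P)) (e / (s * P)))"
    have "\<rho> > 0" using d(1) P e(1) s by (simp add: \<rho>_def)
    moreover have "\<rho> \<le> 1/2" unfolding \<rho>_def by (rule min.cobounded1)
    ultimately have \<rho>: "\<rho> > 0" "\<rho> \<le> 1/2" by simp_all
    have \<rho>d: "\<rho> * P < d"
    proof -
      have "\<rho> \<le> d / (2 * P)" by (simp add: \<rho>_def)
      then have "\<rho> * (2 * P) \<le> d" using P pos_le_divide_eq[of "2 * P" \<rho> d] by simp
      moreover have "\<rho> * P > 0" using \<rho>(1) P by simp
      ultimately show ?thesis by linarith
    qed
    have \<rho>e: "s * P * \<rho> \<le> e"
    proof -
      have "\<rho> \<le> e / (s * P)" by (simp add: \<rho>_def)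
      then show ?thesis using P s pos_le_divide_eq[of "s * P" \<rho> e] by (simp add: mult.commute)
    qed
    \<comment> \<open>A competitor on the segment from \<open>y\<close> to \<open>x\<close>.\<close>
    define y' where "y' = y + \<rho> *\<^sub>R (x - y)"
    have n1: "norm (y - y') = \<rho> * P" using \<rho>(1) by (simp add: y'_def P_def)
    have "x - y' = (1 - \<rho>) *\<^sub>R (x - y)" by (simp add: y'_def algebra_simps)
    then have n2: "norm (x - y') = (1 - \<rho>) * P" using \<rho> by (simp add: P_def)
    have "t * (w y - w y') \<ge> s * P\<^sup>2 - s * ((1 - \<rho>) * P)\<^sup>2"
      using max[of y'] unfolding n2 P_def[symmetric] by (simp add: right_diff_distrib)
    moreover have "s * P\<^sup>2 - s * ((1 - \<rho>) * P)\<^sup>2 = (s * P * (2 - \<rho>)) * (\<rho> * P)"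
      by (simp add: power2_eq_square algebra_simps)
    moreover have "t * (w y - w y') \<le> t * ((sqrt (V y) + e) * (\<rho> * P))"
    proof (rule mult_left_mono[OF _ t])
      have "w y - w y' \<le> \<bar>w y - w y'\<bar>" by simp
      also have "\<dots> \<le> (sqrt (V y) + e) * norm (y - y')"
        by (rule d(2)) (use d(1) \<rho>d n1 in \<open>auto simp: dist_norm\<close>)
      finally show "w y - w y' \<le> (sqrt (V y) + e) * (\<rho> * P)" by (simp only: n1)
    qed
    ultimately have "(s * P * (2 - \<rho>)) * (\<rho> * P) \<le> (t * (sqrt (V y) + e)) * (\<rho> * P)" by (simp add: mult.assoc)
    then have "s * P * (2 - \<rho>) \<le> t * (sqrt (V y) + e)"
      by (rule mult_right_le_imp_le) (use \<rho>(1) P in simp)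
    then have "2 * s * P \<le> t * sqrt (V y) + (t * e + s * P * \<rho>)"
      by (simp add: algebra_simps)
    also have "\<dots> \<le> t * sqrt (V y) + e0" using \<rho>e e(2) by (simp add: distrib_right)
    finally show "2 * s * P \<le> t * sqrt (V y) + e0" .
  qed
  then show ?thesis by (simp add: P_def)
qed (use t V in simp)

lemma has_vector_derivative_sequence:
  assumes "(\<gamma> has_vector_derivative \<gamma>') (at t)"
  shows "(\<lambda>n. (real (Suc n)) *\<^sub>R (\<gamma> (t + inverse (real (Suc n))) - \<gamma> t)) \<longlonglongrightarrow> \<gamma>'"
proof -
  have "(\<lambda>h. norm (\<gamma> (t + h) - \<gamma> t - h *\<^sub>R \<gamma>') / norm h) \<midarrow>0\<rightarrow> 0"
    using assms unfolding has_vector_derivative_def has_derivative_at by blast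
  moreover have "filterlim (\<lambda>n. inverse (real (Suc n))) (at 0) sequentially"
    unfolding filterlim_at using LIMSEQ_inverse_real_of_nat by auto
  ultimately have "(\<lambda>n. norm (\<gamma> (t + inverse (real (Suc n))) - \<gamma> t - inverse (real (Suc n)) *\<^sub>R \<gamma>')
      / norm (inverse (real (Suc n)))) \<longlonglongrightarrow> 0"
    by (rule filterlim_compose)
  moreover have "norm (\<gamma> (t + inverse (real (Suc n))) - \<gamma> t - inverse (real (Suc n)) *\<^sub>R \<gamma>')
      / norm (inverse (real (Suc n))) =
      norm ((real (Suc n)) *\<^sub>R (\<gamma> (t + inverse (real (Suc n))) - \<gamma> t) - \<gamma>')" for n
  proof -
    define h where "h = inverse (real (Suc n))"
    have h: "h > 0" "real (Suc n) = inverse h" by (auto simp: h_def)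
    have "inverse h *\<^sub>R (\<gamma> (t + h) - \<gamma> t) - \<gamma>' = inverse h *\<^sub>R (\<gamma> (t + h) - \<gamma> t - h *\<^sub>R \<gamma>')"
      using h(1) by (simp add: scaleR_right_diff_distrib)
    then show ?thesis unfolding h_def[symmetric] h(2) using h(1) by (simp add: divide_inverse)
  qed
  ultimately have "(\<lambda>n. norm ((real (Suc n)) *\<^sub>R (\<gamma> (t + inverse (real (Suc n))) - \<gamma> t) - \<gamma>')) \<longlonglongrightarrow> 0"
    by simp
  then show ?thesis using LIM_zero_cancel tendsto_norm_zero_iff by blast
qed

text \<open>
  The derivative of a curve is a limit of difference quotients, hence agrees with a Borel function
  wherever it exists. Only this allows the integral that defines the action to be split and to be compared with
  a gauge integral.
\<close>

lemma borel_Lagrangian: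
  fixes \<gamma> :: "real \<Rightarrow> real^'n"
  assumes "continuous_on {0..T} \<gamma>" "0 \<le> T" and V: "continuous_on UNIV V" "\<And>y. V y \<ge> 0"
  obtains g :: "real \<Rightarrow> real" where "g \<in> borel_measurable borel" "\<And>t. g t \<ge> 0"
    "\<And>t. t \<in> {0<..<T} \<Longrightarrow> \<gamma> differentiable (at t) \<Longrightarrow>
        g t = (norm (vector_derivative \<gamma> (at t)))\<^sup>2 / 4 + V (\<gamma> t)"
proof -
  define \<gamma>' where "\<gamma>' = (\<lambda>t. \<gamma> (max 0 (min T t)))"
  have "continuous_on UNIV \<gamma>'"
    unfolding \<gamma>'_def
    by (rule continuous_on_compose2[OF assms(1)]) (use assms(2) in \<open>auto intro!: continuous_intros\<close>)
  then have [measurable]: "\<gamma>' \<in> borel_measurable borel" by (rule borel_measurable_continuous_onI)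
  have [measurable]: "V \<in> borel_measurable borel" using V(1) by (rule borel_measurable_continuous_onI)
  define D where "D = (\<lambda>n t. (real (Suc n)) *\<^sub>R (\<gamma>' (t + inverse (real (Suc n))) - \<gamma>' t))"
  have [measurable]: "D n \<in> borel_measurable borel" for n unfolding D_def by measurable
  define g where "g = (\<lambda>t. (norm (lim (\<lambda>n. D n t)))\<^sup>2 / 4 + V (\<gamma>' t))"
  show ?thesis
  proof
    show "g \<in> borel_measurable borel" unfolding g_def by measurable
    show "g t \<ge> 0" for t unfolding g_def using V(2) by simp
    fix t assume t: "t \<in> {0<..<T}" "\<gamma> differentiable (at t)"
    have "(\<gamma> has_vector_derivative vector_derivative \<gamma> (at t)) (at t)"
      using t(2) vector_derivative_works by blast
    then have "(\<gamma>' has_vector_derivative vector_derivative \<gamma> (at t)) (at t)"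
      by (rule has_vector_derivative_transform_within_open[of _ _ _ "{0<..<T}"]) (use t(1) in \<open>auto simp: \<gamma>'_def\<close>)
    from has_vector_derivative_sequence[OF this] have "lim (\<lambda>n. D n t) = vector_derivative \<gamma> (at t)"
      unfolding D_def by (rule limI)
    then show "g t = (norm (vector_derivative \<gamma> (at t)))\<^sup>2 / 4 + V (\<gamma> t)"
      using t(1) by (simp add: g_def \<gamma>'_def)
  qed
qed

lemma action_eq_borel:
  fixes \<gamma> :: "real \<Rightarrow> real^'n"
  assumes ac: "abs_continuous_on_Icc 0 T \<gamma>" and
    g: "\<And>t. t \<in> {0<..<T} \<Longrightarrow> \<gamma> differentiable (at t) \<Longrightarrow>
        g t = (norm (vector_derivative \<gamma> (at t)))\<^sup>2 / 4 + V (\<gamma> t)"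
  shows "action V T \<gamma> = (\<integral>\<^sup>+ t\<in>{0..T}. ennreal (g t) \<partial>lborel)"
  unfolding action_def
proof (rule nn_integral_cong_AE)
  let ?N = "{t\<in>{0<..<T}. \<not> \<gamma> differentiable (at t)} \<union> {0,T}"
  have "negligible ?N" using abs_continuous_differentiable_ae[OF ac] by simp
  then have "AE t in lebesgue. t \<notin> ?N" by (intro AE_not_in) (simp add: negligible_iff_null_sets)
  then have "AE t in lborel. t \<notin> ?N" unfolding AE_completion_iff .
  then show "AE t in lborel. ennreal ((norm (vector_derivative \<gamma> (at t)))\<^sup>2 / 4 + V (\<gamma> t)) * indicator {0..T} t =
      ennreal (g t) * indicator {0..T} t"
    by (rule AE_mp) (rule AE_I2, auto simp: g indicator_def)
qed

text \<open>
  The elementary inequality \<open>sqrt V |\<gamma>'| \<le> |\<gamma>'|\<^sup>2 / 4 + V\<close>, together with the straddle estimate for the difference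
  quotient over an interval containing \<open>t\<close>.
\<close>

lemma straddle_at_differentiable_point:
  fixes \<gamma> :: "real \<Rightarrow> real^'n"
  assumes w: "eikonal_sub V w" and V: "\<And>y. V y \<ge> 0"
    and d: "\<gamma> differentiable (at t)" and "e > 0"
  shows "\<exists>\<delta>>0. \<forall>s s'. s \<le> t \<and> t \<le> s' \<and> dist t s < \<delta> \<and> dist t s' < \<delta> \<longrightarrow>
     w (\<gamma> s') - w (\<gamma> s) \<le> ((norm (vector_derivative \<gamma> (at t)))\<^sup>2 / 4 + V (\<gamma> t) + e) * (s' - s)"
proof -
  define p where "p = norm (vector_derivative \<gamma> (at t))"
  define r where "r = sqrt (V (\<gamma> t))"
  have rp: "r \<ge> 0" "p \<ge> 0" using V by (auto simp: r_def p_def)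
  \<comment> \<open>Then \<open>(r + e1) (p + e1) \<le> r p + e\<close>.\<close>
  define e1 where "e1 = min 1 (e / (r + p + 1))"
  have e1: "e1 > 0" "e1 \<le> 1" "e1 * (r + p + 1) \<le> e"
  proof -
    have "e1 \<le> e / (r + p + 1)" by (simp add: e1_def)
    then show "e1 * (r + p + 1) \<le> e" using rp by (simp add: pos_le_divide_eq)
  qed (use rp \<open>e > 0\<close> in \<open>auto simp: e1_def\<close>)
  have vd: "(\<gamma> has_vector_derivative vector_derivative \<gamma> (at t)) (at t)"
    using d vector_derivative_works by blast
  obtain d0 where d0: "d0 > 0"
    "\<And>a b. dist (\<gamma> t) a < d0 \<Longrightarrow> dist (\<gamma> t) b < d0 \<Longrightarrow> \<bar>w a - w b\<bar> \<le> (r + e1) * norm (a - b)"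
    unfolding r_def using eikonal_subE[OF w e1(1)] by metis
  have "continuous (at t) \<gamma>" using d differentiable_imp_continuous_within by blast
  then obtain d1 where d1: "d1 > 0" "\<And>s. dist t s < d1 \<Longrightarrow> dist (\<gamma> t) (\<gamma> s) < d0"
    using d0(1) unfolding continuous_at_eps_delta by (metis dist_commute)
  obtain d2 where d2: "d2 > 0" "\<And>s. norm (s - t) < d2 \<Longrightarrow>
      norm (\<gamma> s - \<gamma> t - (s - t) *\<^sub>R vector_derivative \<gamma> (at t)) \<le> e1 * norm (s - t)"
    using vd e1(1) unfolding has_vector_derivative_def has_derivative_at_alt by blast
  show ?thesis
  proof (intro exI[of _ "min d1 d2"] conjI allI impI)
    fix s s' assume s: "s \<le> t \<and> t \<le> s' \<and> dist t s < min d1 d2 \<and> dist t s' < min d1 d2"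
    have "norm (\<gamma> s' - \<gamma> s) = norm ((s' - s) *\<^sub>R vector_derivative \<gamma> (at t) +
        (\<gamma> s' - \<gamma> t - (s' - t) *\<^sub>R vector_derivative \<gamma> (at t)) - (\<gamma> s - \<gamma> t - (s - t) *\<^sub>R vector_derivative \<gamma> (at t)))"
      by (simp add: algebra_simps)
    also have "\<dots> \<le> norm ((s' - s) *\<^sub>R vector_derivative \<gamma> (at t)) +
        norm (\<gamma> s' - \<gamma> t - (s' - t) *\<^sub>R vector_derivative \<gamma> (at t)) + norm (\<gamma> s - \<gamma> t - (s - t) *\<^sub>R vector_derivative \<gamma> (at t))"
      by (meson add_mono norm_triangle_ineq norm_triangle_ineq4 order_refl order_trans)
    also have "\<dots> \<le> (s' - s) * p + e1 * (s' - t) + e1 * (t - s)"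
      using d2(2)[of s] d2(2)[of s'] s by (auto simp: p_def dist_real_def)
    also have "\<dots> = (p + e1) * (s' - s)" by (simp add: algebra_simps)
    finally have n: "norm (\<gamma> s' - \<gamma> s) \<le> (p + e1) * (s' - s)" .
    have "w (\<gamma> s') - w (\<gamma> s) \<le> (r + e1) * norm (\<gamma> s' - \<gamma> s)"
      using d0(2)[OF d1(2) d1(2), of s' s] s by auto
    also have "\<dots> \<le> (r + e1) * ((p + e1) * (s' - s))"
      using n rp e1 by (intro mult_left_mono) auto
    also have "\<dots> = ((r + e1) * (p + e1)) * (s' - s)" by simp
    also have "\<dots> \<le> (p\<^sup>2 / 4 + V (\<gamma> t) + e) * (s' - s)"
    proof (rule mult_right_mono)
      have "0 \<le> (p/2 - r)\<^sup>2" by simp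
      then have "r * p \<le> p\<^sup>2 / 4 + r\<^sup>2" by (simp add: power2_eq_square algebra_simps)
      moreover have "r\<^sup>2 = V (\<gamma> t)" using V by (simp add: r_def)
      moreover have "e1 * e1 \<le> e1 * 1" using e1 by (intro mult_left_mono) auto
      ultimately show "(r + e1) * (p + e1) \<le> p\<^sup>2 / 4 + V (\<gamma> t) + e"
        using e1(3) by (simp add: algebra_simps)
    qed (use s in auto)
    finally show "w (\<gamma> s') - w (\<gamma> s) \<le> ((norm (vector_derivative \<gamma> (at t)))\<^sup>2 / 4 + V (\<gamma> t) + e) * (s' - s)"
      by (simp add: p_def)
  qed (use d1 d2 in auto)
qed

text \<open>
  A gauge argument. Tags at which the curve is differentiable are controlled by the straddle estimate. The
  remaining tags lie in a null set \<open>N\<close>; the gauge keeps their intervals inside an open set of small measure, so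
  that absolute continuity makes their contribution small.
\<close>

lemma eikonal_sub_curve_integral:
  fixes \<gamma> :: "real \<Rightarrow> real^'n"
  assumes ac: "abs_continuous_on_Icc 0 T \<gamma>" and T: "T > 0"
    and w: "eikonal_sub V w" and V: "\<And>y. 0 \<le> V y" "\<And>y. V y \<le> M"
    and G: "(G has_integral I) {0..T}" "\<And>t. G t \<ge> 0" and N: "negligible N"
    and GN: "\<And>t. t \<in> {0..T} - N \<Longrightarrow> \<gamma> differentiable (at t) \<and>
        G t = (norm (vector_derivative \<gamma> (at t)))\<^sup>2 / 4 + V (\<gamma> t)"
    and "e > 0"
  shows "w (\<gamma> T) - w (\<gamma> 0) \<le> I + e * (2 + T)"
proof -
  have cont: "continuous_on {0..T} \<gamma>" by (rule abs_continuous_imp_continuous_on[OF ac])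
  define L where "L = sqrt M + 1"
  have M0: "M \<ge> 0" using V order_trans by blast
  have L: "L > 0" using M0 by (simp add: L_def add_nonneg_pos)
  obtain \<delta> where \<delta>: "\<delta> > 0"
    "\<And>F. finite F \<Longrightarrow> (\<And>K. K \<in> F \<Longrightarrow> \<exists>l r. K = {l..r} \<and> 0 \<le> l \<and> l \<le> r \<and> r \<le> T) \<Longrightarrow>
      (\<And>K K'. K \<in> F \<Longrightarrow> K' \<in> F \<Longrightarrow> K \<noteq> K' \<Longrightarrow> interior K \<inter> interior K' = {}) \<Longrightarrow>
      (\<Sum>K\<in>F. Sup K - Inf K) < \<delta> \<Longrightarrow> (\<Sum>K\<in>F. dist (\<gamma> (Inf K)) (\<gamma> (Sup K))) < e / L"
    by (rule abs_continuous_on_IccD_sets[OF ac, of "e / L"]) (use \<open>e > 0\<close> L in auto)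
  obtain U where U: "open U" "N \<subseteq> U" "U \<in> lmeasurable" "measure lebesgue U < \<delta>"
  proof -
    obtain U where U: "open U" "N \<subseteq> U" "U - N \<in> lmeasurable" "emeasure lebesgue (U - N) < ennreal \<delta>"
      using sets_lebesgue_outer_open[OF negligible_imp_sets[OF N] \<delta>(1)] by metis
    have eq: "U = (U - N) \<union> N" using U(2) by blast
    have Nm: "N \<in> lmeasurable" "measure lebesgue N = 0"
      using N negligible_imp_measurable negligible_imp_measure0 by blast+
    have "emeasure lebesgue (U - N) = ennreal (measure lebesgue (U - N))"
      using U(3) by (intro emeasure_eq_measure2)
    with U(4) have m: "measure lebesgue (U - N) < \<delta>"
      by (simp add: ennreal_less_iff)
    have "U \<in> lmeasurable" using U(3) Nm(1) eq fmeasurable.Un by metis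
    moreover have "measure lebesgue U \<le> measure lebesgue (U - N) + measure lebesgue N"
      by (subst eq, rule measure_Un_le) (use U(3) Nm in \<open>auto simp: fmeasurableD\<close>)
    ultimately show thesis using that[OF U(1,2)] m Nm(2) by simp
  qed
  obtain d1 where d1: "gauge d1" "\<And>p. p tagged_division_of {0..T} \<Longrightarrow> d1 fine p \<Longrightarrow>
      norm ((\<Sum>(x,k)\<in>p. measure lborel k *\<^sub>R G x) - I) < e"
    using G(1) \<open>e > 0\<close> unfolding has_integral_real by metis
  \<comment> \<open>The radius \<open>r\<close> is admissible at the tag \<open>t\<close>.\<close>
  define adm where "adm = (\<lambda>t r. t \<in> {0..T} \<longrightarrow>
     (t \<notin> N \<longrightarrow> (\<forall>s s'. s \<le> t \<and> t \<le> s' \<and> dist t s < r \<and> dist t s' < r \<longrightarrow>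
          w (\<gamma> s') - w (\<gamma> s) \<le> (G t + e) * (s' - s))) \<and>
     (t \<in> N \<longrightarrow> ball t r \<subseteq> U \<and> (\<forall>s\<in>{0..T}. \<forall>s'\<in>{0..T}. dist t s < r \<and> dist t s' < r \<longrightarrow>
          w (\<gamma> s') - w (\<gamma> s) \<le> L * dist (\<gamma> s) (\<gamma> s'))))"
  have "\<exists>r>0. adm t r" for t
  proof (cases "t \<in> {0..T}")
    case t: True
    show ?thesis
    proof (cases "t \<in> N")
      case False
      have d: "\<gamma> differentiable (at t)" and Gt: "G t = (norm (vector_derivative \<gamma> (at t)))\<^sup>2 / 4 + V (\<gamma> t)"
        using GN[of t] t False by auto
      obtain r0 where "r0 > 0" "\<forall>s s'. s \<le> t \<and> t \<le> s' \<and> dist t s < r0 \<and> dist t s' < r0 \<longrightarrow>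
          w (\<gamma> s') - w (\<gamma> s) \<le> (G t + e) * (s' - s)"
        using straddle_at_differentiable_point[OF w V(1) d \<open>e > 0\<close>, folded Gt] by (elim exE conjE)
      with False show ?thesis unfolding adm_def by (intro exI[of _ r0]) simp
    next
      case True
      then obtain r1 where r1: "r1 > 0" "ball t r1 \<subseteq> U" using U(1,2) open_contains_ball by blast
      obtain d0 where d0: "d0 > 0"
        "\<And>a b. dist (\<gamma> t) a < d0 \<Longrightarrow> dist (\<gamma> t) b < d0 \<Longrightarrow> \<bar>w a - w b\<bar> \<le> (sqrt (V (\<gamma> t)) + 1) * norm (a - b)"
        using eikonal_subE[OF w zero_less_one] by metis
      obtain r2 where r2: "r2 > 0" "\<And>s. s \<in> {0..T} \<Longrightarrow> dist s t < r2 \<Longrightarrow> dist (\<gamma> s) (\<gamma> t) < d0"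
        using cont t d0(1) unfolding continuous_on_iff by metis
      have "w (\<gamma> s') - w (\<gamma> s) \<le> L * dist (\<gamma> s) (\<gamma> s')"
        if "s \<in> {0..T}" "s' \<in> {0..T}" "dist t s < r2" "dist t s' < r2" for s s'
      proof -
        have "w (\<gamma> s') - w (\<gamma> s) \<le> (sqrt (V (\<gamma> t)) + 1) * norm (\<gamma> s' - \<gamma> s)"
          using d0(2)[of "\<gamma> s'" "\<gamma> s"] r2(2)[of s] r2(2)[of s'] that by (auto simp: dist_commute)
        also have "\<dots> \<le> L * norm (\<gamma> s' - \<gamma> s)" unfolding L_def using V(2) by (intro mult_right_mono) auto
        finally show ?thesis by (simp add: dist_norm norm_minus_commute)
      qed
      moreover have "ball t (min r1 r2) \<subseteq> U" using r1(2) by auto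
      ultimately show ?thesis using True r1(1) r2(1) unfolding adm_def
        by (intro exI[of _ "min r1 r2"] conjI impI ballI) simp_all
    qed
  qed (auto simp: adm_def intro: exI[of _ 1])
  then obtain r where r1: "\<And>t. r t > 0" and adm: "\<And>t. adm t (r t)" by metis
  have r2: "w (\<gamma> s') - w (\<gamma> s) \<le> (G t + e) * (s' - s)"
    if "t \<in> {0..T}" "t \<notin> N" "s \<le> t" "t \<le> s'" "dist t s < r t" "dist t s' < r t" for t s s'
    using adm[of t] that unfolding adm_def by blast
  have r3: "ball t (r t) \<subseteq> U" if "t \<in> {0..T}" "t \<in> N" for t
    using adm[of t] that unfolding adm_def by blast
  have r4: "w (\<gamma> s') - w (\<gamma> s) \<le> L * dist (\<gamma> s) (\<gamma> s')"
    if "t \<in> {0..T}" "t \<in> N" "s \<in> {0..T}" "s' \<in> {0..T}" "dist t s < r t" "dist t s' < r t" for t s s'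
    using adm[of t] that unfolding adm_def by blast
  have "gauge (\<lambda>t. d1 t \<inter> ball t (r t))"
    using d1(1) r1 by (auto simp: gauge_def)
  then obtain p where p: "p tagged_division_of {0..T}" "(\<lambda>t. d1 t \<inter> ball t (r t)) fine p"
    using fine_division_exists_real by blast
  have fin: "finite p" using p(1) by (rule tagged_division_of_finite)
  have fine1: "d1 fine p" using p(2) by (auto simp: fine_def)
  have cell: "\<exists>u v. k = {u..v} \<and> u \<le> v \<and> 0 \<le> u \<and> v \<le> T \<and> Inf k = u \<and> Sup k = v \<and> u \<le> x \<and> x \<le> v
      \<and> dist x u < r x \<and> dist x v < r x \<and> k \<subseteq> ball x (r x) \<and> measure lborel k = v - u" if xk: "(x,k) \<in> p" for x k
  proof -
    obtain u v where k: "k = {u..v}" using tagged_division_ofD(4)[OF p(1) xk] by auto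
    have x: "x \<in> k" by (rule tagged_division_ofD(2)[OF p(1) xk])
    have sub: "k \<subseteq> {0..T}" by (rule tagged_division_ofD(3)[OF p(1) xk])
    have b: "k \<subseteq> ball x (r x)" using p(2) xk by (auto simp: fine_def)
    have uv: "u \<le> x" "x \<le> v" using x k by auto
    then have uk: "u \<in> k" "v \<in> k" using k by auto
    have "0 \<le> u" "v \<le> T" using sub uk by auto
    moreover have "dist x u < r x" "dist x v < r x" using b uk by auto
    moreover have "Inf k = u" "Sup k = v" "measure lborel k = v - u" using k uv by auto
    moreover have "u \<le> v" using uv by simp
    ultimately show ?thesis using k uv b by blast
  qed
  define pN where "pN = {(x,k)\<in>p. x \<in> N}"
  let ?\<Delta> = "\<lambda>k. w (\<gamma> (Sup k)) - w (\<gamma> (Inf k))"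
  have "w (\<gamma> T) - w (\<gamma> 0) = (\<Sum>(x,k)\<in>p. ?\<Delta> k)"
    using additive_tagged_division_1[OF _ p(1), of "\<lambda>t. w (\<gamma> t)"] T by simp
  also have "\<dots> = (\<Sum>(x,k)\<in>p - pN. ?\<Delta> k) + (\<Sum>(x,k)\<in>pN. ?\<Delta> k)"
    by (rule sum.subset_diff) (use fin in \<open>auto simp: pN_def\<close>)
  also have "(\<Sum>(x,k)\<in>p - pN. ?\<Delta> k) \<le> (\<Sum>(x,k)\<in>p - pN. (G x + e) * measure lborel k)"
  proof (rule sum_mono)
    fix z assume z: "z \<in> p - pN"
    obtain x k where xk: "z = (x,k)" by (cases z)
    with z have xk': "(x,k) \<in> p" "x \<notin> N" by (auto simp: pN_def)
    obtain u v where uv: "k = {u..v}" "u \<le> v" "0 \<le> u" "v \<le> T" "Inf k = u" "Sup k = v" "u \<le> x" "x \<le> v"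
      "dist x u < r x" "dist x v < r x" "measure lborel k = v - u" using cell[OF xk'(1)] by blast
    show "(case z of (x,k) \<Rightarrow> ?\<Delta> k) \<le> (case z of (x,k) \<Rightarrow> (G x + e) * measure lborel k)"
      using r2[of x u v] uv(2-) xk'(2) by (simp add: xk)
  qed
  also have "\<dots> \<le> (\<Sum>(x,k)\<in>p. (G x + e) * measure lborel k)"
    using fin G(2) \<open>e > 0\<close> by (intro sum_mono2) auto
  also have "\<dots> = (\<Sum>(x,k)\<in>p. measure lborel k *\<^sub>R G x) + e * (\<Sum>(x,k)\<in>p. measure lborel k)"
    by (simp add: sum_distrib_left sum.distrib[symmetric] case_prod_beta algebra_simps)
  also have "(\<Sum>(x,k)\<in>p. measure lborel k) = T"
    using additive_content_tagged_division[of p 0 T] p(1) T by simp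
  also have "(\<Sum>(x,k)\<in>p. measure lborel k *\<^sub>R G x) \<le> I + e"
    using d1(2)[OF p(1) fine1] by simp
  also have "(\<Sum>(x,k)\<in>pN. ?\<Delta> k) \<le> e"
  proof -
    have pt: "pN tagged_partial_division_of {0..T}"
      using p(1) tagged_partial_division_subset[of p "{0..T}" pN] unfolding tagged_division_of_def pN_def by auto
    have td: "pN tagged_division_of \<Union>(snd ` pN)" by (rule tagged_partial_division_of_Union_self[OF pt])
    have dv: "(snd ` pN) division_of \<Union>(snd ` pN)" by (rule partial_division_of_tagged_division[OF pt])
    have "(\<Sum>(x,k)\<in>pN. ?\<Delta> k) \<le> (\<Sum>(x,k)\<in>pN. L * dist (\<gamma> (Inf k)) (\<gamma> (Sup k)))"
    proof (rule sum_mono)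
      fix z assume z: "z \<in> pN"
      obtain x k where xk: "z = (x,k)" by (cases z)
      with z have xk': "(x,k) \<in> p" "x \<in> N" by (auto simp: pN_def)
      obtain u v where uv: "k = {u..v}" "u \<le> v" "0 \<le> u" "v \<le> T" "Inf k = u" "Sup k = v" "u \<le> x" "x \<le> v"
        "dist x u < r x" "dist x v < r x" "measure lborel k = v - u" using cell[OF xk'(1)] by blast
      show "(case z of (x,k) \<Rightarrow> ?\<Delta> k) \<le> (case z of (x,k) \<Rightarrow> L * dist (\<gamma> (Inf k)) (\<gamma> (Sup k)))"
        using r4[of x u v] uv(2-) xk'(2) by (simp add: xk)
    qed
    \<comment> \<open>The passage from tagged intervals to intervals requires a summand that vanishes on empty intervals, for
      which the infimum and supremum are unspecified.\<close>
    also have "\<dots> = (\<Sum>(x,k)\<in>pN. if k = {} then 0 else L * dist (\<gamma> (Inf k)) (\<gamma> (Sup k)))"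
      using tagged_division_ofD(2)[OF td] by (intro sum.cong) fastforce+
    also have "\<dots> = (\<Sum>k\<in>snd ` pN. if k = {} then 0 else L * dist (\<gamma> (Inf k)) (\<gamma> (Sup k)))"
    proof (rule sum.over_tagged_division_lemma[OF td])
      fix u v :: real assume "box u v = {}"
      then have "v \<le> u" by simp
      then show "(if cbox u v = {} then 0 else L * dist (\<gamma> (Inf (cbox u v))) (\<gamma> (Sup (cbox u v)))) = 0"
        by (cases "u = v") auto
    qed
    also have "\<dots> = (\<Sum>k\<in>snd ` pN. L * dist (\<gamma> (Inf k)) (\<gamma> (Sup k)))"
      using tagged_division_ofD(2)[OF td] by (intro sum.cong) fastforce+
    also have "\<dots> = L * (\<Sum>k\<in>snd ` pN. dist (\<gamma> (Inf k)) (\<gamma> (Sup k)))" by (simp add: sum_distrib_left)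
    also have "(\<Sum>k\<in>snd ` pN. dist (\<gamma> (Inf k)) (\<gamma> (Sup k))) < e / L"
    proof (rule \<delta>(2))
      show "finite (snd ` pN)" by (rule division_ofD(1)[OF dv])
      show "interior K \<inter> interior K' = {}" if "K \<in> snd ` pN" "K' \<in> snd ` pN" "K \<noteq> K'" for K K'
        by (rule division_ofD(5)[OF dv that])
      show "\<exists>l r. K = {l..r} \<and> 0 \<le> l \<and> l \<le> r \<and> r \<le> T" if KpN: "K \<in> snd ` pN" for K
      proof -
        obtain x where "(x,K) \<in> p" using KpN by (auto simp: pN_def)
        from cell[OF this] show ?thesis by blast
      qed
      have "(\<Sum>K\<in>snd ` pN. Sup K - Inf K) = (\<Sum>K\<in>snd ` pN. measure lebesgue K)"
      proof (rule sum.cong)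
        fix K assume "K \<in> snd ` pN"
        then obtain x where "(x,K) \<in> p" by (auto simp: pN_def)
        then obtain u v where "K = {u..v}" "u \<le> v" using cell by blast
        then show "Sup K - Inf K = measure lebesgue K" by simp
      qed simp
      also have "\<dots> = measure lebesgue (\<Union>(snd ` pN))" by (rule content_division[OF dv])
      also have "\<dots> \<le> measure lebesgue U"
      proof (rule measure_mono_fmeasurable)
        show "\<Union>(snd ` pN) \<subseteq> U"
        proof (rule Union_least)
          fix K assume "K \<in> snd ` pN"
          then obtain x where x: "(x,K) \<in> p" "x \<in> N" by (auto simp: pN_def)
          from cell[OF x(1)] have "K \<subseteq> ball x (r x)" "x \<in> {0..T}" by auto
          with r3[OF this(2) x(2)] show "K \<subseteq> U" by blast
        qed
        show "\<Union>(snd ` pN) \<in> sets lebesgue"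
          using lmeasurable_division[OF dv] by (rule fmeasurableD)
      qed (rule U(3))
      finally show "(\<Sum>K\<in>snd ` pN. Sup K - Inf K) < \<delta>" using U(4) by linarith
    qed
    finally show ?thesis using L by simp
  qed
  finally show ?thesis by (simp add: algebra_simps)
qed

theorem eikonal_sub_action:
  fixes \<gamma> :: "real \<Rightarrow> real^'n"
  assumes ac: "abs_continuous_on_Icc 0 T \<gamma>" and T: "T > 0"
    and w: "eikonal_sub V w" and V: "continuous_on UNIV V" "\<And>y. 0 \<le> V y" "\<And>y. V y \<le> M"
  shows "ennreal (w (\<gamma> T) - w (\<gamma> 0)) \<le> action V T \<gamma>"
proof (cases "action V T \<gamma> = \<infinity>")
  case False
  have cont: "continuous_on {0..T} \<gamma>" by (rule abs_continuous_imp_continuous_on[OF ac])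
  obtain g where g: "g \<in> borel_measurable borel" "\<And>t. g t \<ge> 0"
    "\<And>t. t \<in> {0<..<T} \<Longrightarrow> \<gamma> differentiable (at t) \<Longrightarrow>
        g t = (norm (vector_derivative \<gamma> (at t)))\<^sup>2 / 4 + V (\<gamma> t)"
    using borel_Lagrangian[OF cont _ V(1,2)] T by (metis less_imp_le)
  define h where "h = (\<lambda>t. g t * indicator {0..T} t)"
  have hm: "h \<in> borel_measurable lborel" unfolding h_def using g(1) by simp
  have h0: "h t \<ge> 0" for t unfolding h_def using g(2) by simp
  have "action V T \<gamma> = (\<integral>\<^sup>+ t\<in>{0..T}. ennreal (g t) \<partial>lborel)" by (rule action_eq_borel[OF ac g(3)])
  also have "\<dots> = (\<integral>\<^sup>+ t. ennreal (h t) \<partial>lborel)"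
    unfolding h_def by (intro nn_integral_cong) (auto simp: indicator_def)
  finally have act: "action V T \<gamma> = (\<integral>\<^sup>+ t. ennreal (h t) \<partial>lborel)" .
  have int: "integrable lborel h"
    by (rule integrableI_nonneg[OF hm]) (use h0 False act in \<open>auto simp: less_top\<close>)
  define I where "I = integral\<^sup>L lborel h"
  have "action V T \<gamma> = ennreal I"
    unfolding act I_def using int h0 by (intro nn_integral_eq_integral) auto
  have "(h has_integral I) UNIV" unfolding I_def by (rule has_integral_integral_lborel[OF int])
  moreover have "h = (\<lambda>t. if t \<in> {0..T} then g t else 0)" by (auto simp: h_def indicator_def)
  ultimately have "(g has_integral I) {0..T}" using has_integral_restrict_UNIV[of "{0..T}" g I] by metis
  define N where "N = {t\<in>{0<..<T}. \<not> \<gamma> differentiable (at t)} \<union> {0,T}"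
  have N: "negligible N" unfolding N_def using abs_continuous_differentiable_ae[OF ac] by simp
  have GN: "\<gamma> differentiable (at t) \<and> g t = (norm (vector_derivative \<gamma> (at t)))\<^sup>2 / 4 + V (\<gamma> t)"
    if "t \<in> {0..T} - N" for t
    using that g(3)[of t] unfolding N_def by auto
  have "w (\<gamma> T) - w (\<gamma> 0) \<le> I"
  proof (rule field_le_epsilon)
    fix e :: real assume "e > 0"
    then have "e / (2 + T) > 0" using T by simp
    from eikonal_sub_curve_integral[OF ac T w V(2,3) \<open>(g has_integral I) {0..T}\<close> g(2) N GN this]
    show "w (\<gamma> T) - w (\<gamma> 0) \<le> I + e" using T by simp
  qed
  then show ?thesis unfolding \<open>action V T \<gamma> = ennreal I\<close> by (rule ennreal_leI)
qed simp

section \<open>Periodic functions and extremal points\<close>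

lemma torus_eq_refl [simp]: "torus_eq x x"
  by (simp add: torus_eq_def)

lemma torus_eq_sym: "torus_eq x y \<Longrightarrow> torus_eq y x"
  unfolding torus_eq_def by (metis Ints_minus minus_diff_eq vector_uminus_component)

lemma torus_eq_trans: "torus_eq x y \<Longrightarrow> torus_eq y z \<Longrightarrow> torus_eq x z"
  unfolding torus_eq_def
proof
  fix i assume "\<forall>i. (x - y) $ i \<in> \<int>" "\<forall>i. (y - z) $ i \<in> \<int>"
  then have "(x - y) $ i + (y - z) $ i \<in> \<int>" by (intro Ints_add) auto
  then show "(x - z) $ i \<in> \<int>" by simp
qed

lemma torus_eq_add: "torus_eq x y \<Longrightarrow> torus_eq (x + h) (y + h)"
  by (simp add: torus_eq_def)

text \<open>
  Used to move a whole configuration by the lattice vector \<open>x - y\<close>.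
\<close>

lemma torus_eq_shift: "torus_eq x y \<Longrightarrow> torus_eq (z + (x - y)) z"
  by (simp add: torus_eq_def)

lemma torus_funD: "torus_fun f \<Longrightarrow> torus_eq x y \<Longrightarrow> f x = f y"
  by (auto simp: torus_fun_def)

lemma torus_representative:
  obtains y :: "real^'n" where "y \<in> cbox 0 (vec 1)" "torus_eq y x"
proof
  let ?y = "\<chi> i. frac (x $ i)"
  show "?y \<in> cbox 0 (vec 1)"
    by (auto simp: mem_box_cart frac_ge_0 less_imp_le[OF frac_lt_1])
  show "torus_eq ?y x"
    by (auto simp: torus_eq_def frac_def)
qed

lemma torus_fun_bounded:
  fixes f :: "real^'n \<Rightarrow> real"
  assumes "torus_fun f" "continuous_on UNIV f"
  obtains M where "\<And>x. \<bar>f x\<bar> \<le> M"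
proof -
  have "compact (f ` cbox 0 (vec 1))"
    by (intro compact_continuous_image continuous_on_subset[OF assms(2)]) auto
  then obtain M where M: "\<And>y. y \<in> cbox 0 (vec 1) \<Longrightarrow> \<bar>f y\<bar> \<le> M"
    using compact_imp_bounded bounded_iff by (metis imageI real_norm_def)
  show thesis
  proof
    fix x :: "real^'n"
    obtain y where "y \<in> cbox 0 (vec 1)" "torus_eq y x" by (rule torus_representative)
    with M torus_funD[OF assms(1)] show "\<bar>f x\<bar> \<le> M" by metis
  qed
qed

lemma torus_fun_attains_inf:
  fixes f :: "real^'n \<Rightarrow> real"
  assumes "torus_fun f" "continuous_on UNIV f"
  obtains z where "\<And>y. f z \<le> f y"
proof -
  have cont: "continuous_on (cbox 0 (vec 1)) f"
    by (rule continuous_on_subset[OF assms(2)]) simp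
  obtain y0 :: "real^'n" where "y0 \<in> cbox 0 (vec 1)" by (rule torus_representative)
  then have ne: "cbox 0 (vec 1 :: real^'n) \<noteq> {}" by blast
  obtain z where z: "\<forall>y\<in>cbox 0 (vec 1). f z \<le> f y"
    using continuous_attains_inf[OF compact_cbox ne cont] by blast
  show thesis
  proof (rule that)
    fix y
    obtain y' :: "real^'n" where y': "y' \<in> cbox 0 (vec 1)" "torus_eq y' y" by (rule torus_representative)
    have "f z \<le> f y'" using z y'(1) by blast
    then show "f z \<le> f y" using torus_funD[OF assms(1) y'(2)] by simp
  qed
qed

lemma torus_fun_uniformly_continuous:
  fixes f :: "real^'n \<Rightarrow> real"
  assumes "torus_fun f" "continuous_on UNIV f" "e > 0"
  obtains d where "d > 0" "\<And>x y. norm (x - y) < d \<Longrightarrow> \<bar>f x - f y\<bar> < e"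
proof -
  let ?K = "cball (0::real^'n) (norm (vec 1 :: real^'n) + 1)"
  have "uniformly_continuous_on ?K f"
    by (intro compact_uniformly_continuous continuous_on_subset[OF assms(2)]) auto
  then obtain d where d: "d > 0" "\<And>x y. x \<in> ?K \<Longrightarrow> y \<in> ?K \<Longrightarrow> dist y x < d \<Longrightarrow> dist (f y) (f x) < e"
    unfolding uniformly_continuous_on_def using \<open>e > 0\<close> by metis
  show thesis
  proof
    show "min d 1 > 0" using d(1) by simp
    fix x y :: "real^'n" assume xy: "norm (x - y) < min d 1"
    obtain z where z: "z \<in> cbox 0 (vec 1)" "torus_eq z x" by (rule torus_representative)
    define w where "w = y + (z - x)"
    have "torus_eq w y" unfolding w_def by (rule torus_eq_shift[OF z(2)])
    have "norm z \<le> norm (vec 1 :: real^'n)"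
      using z(1) by (intro norm_le_componentwise_cart) (auto simp: mem_box_cart)
    moreover have "norm (z - w) = norm (x - y)" by (simp add: w_def)
    moreover have "norm w \<le> norm z + norm (z - w)" by (metis norm_minus_commute norm_triangle_sub)
    ultimately have "z \<in> ?K" "w \<in> ?K" "dist z w < d" using xy by (auto simp: dist_norm)
    from d(2)[OF this(2,1,3)] show "\<bar>f x - f y\<bar> < e"
      using torus_funD[OF assms(1) z(2)] torus_funD[OF assms(1) \<open>torus_eq w y\<close>] by (simp add: dist_real_def)
  qed
qed

lemma coercive_attains_max:
  fixes v \<phi> :: "real^'n \<Rightarrow> real"
  assumes v: "continuous_on UNIV v" "\<And>x. \<bar>v x\<bar> \<le> M" and \<phi>: "continuous_on UNIV \<phi>"
    and c: "c > 0" "\<And>x. \<phi> x \<ge> \<phi> z + c * (norm (x - z))\<^sup>2"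
  obtains x where "\<And>y. v y - \<phi> y \<le> v x - \<phi> x"
proof -
  define R where "R = sqrt (2 * M / c)"
  have M: "M \<ge> 0" using v(2) abs_ge_zero order_trans by blast
  have cont: "continuous_on (cball z R) (\<lambda>x. v x - \<phi> x)"
    by (intro continuous_on_diff continuous_on_subset[OF v(1)] continuous_on_subset[OF \<phi>]) auto
  have "z \<in> cball z R" using M c by (simp add: R_def)
  then have "cball z R \<noteq> {}" by blast
  from continuous_attains_sup[OF compact_cball this cont]
  obtain x where x: "\<And>y. y \<in> cball z R \<Longrightarrow> v y - \<phi> y \<le> v x - \<phi> x" by blast
  show thesis
  proof
    fix y
    show "v y - \<phi> y \<le> v x - \<phi> x"
    proof (cases "y \<in> cball z R")
      case False
      then have "R < norm (y - z)" by (simp add: dist_norm norm_minus_commute)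
      then have "2 * M / c \<le> (norm (y - z))\<^sup>2"
        unfolding R_def by (simp add: real_less_lsqrt less_imp_le sqrt_le_D)
      then have "2 * M \<le> c * (norm (y - z))\<^sup>2" using c(1) by (simp add: pos_divide_le_eq mult.commute)
      then have "v y - \<phi> y \<le> v z - \<phi> z" using c(2)[of y] v(2)[of y] v(2)[of z] by linarith
      also have "\<dots> \<le> v x - \<phi> x" using x \<open>z \<in> cball z R\<close> by blast
      finally show ?thesis .
    qed (rule x)
  qed
qed

text \<open>
  With \<open>z = y - x\<close> the doubled functional is periodic in \<open>x\<close> alone, and \<open>s |z|\<^sup>2\<close> outweighs \<open>g\<close> for large \<open>z\<close>.
\<close>

lemma doubling_min_exists:
  assumes f: "torus_fun f" "continuous_on UNIV f" and g: "torus_fun g" "continuous_on UNIV g" and s: "s > 0"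
  obtains x0 z0 :: "real^'n" where
    "\<And>x z. f x0 - g (x0 + z0) + s * (norm z0)\<^sup>2 \<le> f x - g (x + z) + s * (norm z)\<^sup>2"
proof -
  obtain B where B: "\<And>x. \<bar>g x\<bar> \<le> B" by (rule torus_fun_bounded[OF g]) blast
  have B0: "B \<ge> 0" using B[of 0] by linarith
  define R where "R = sqrt (2 * B / s)"
  let ?Q = "cbox (0::real^'n) (vec 1) \<times> cball (0::real^'n) R"
  let ?\<Psi> = "\<lambda>(x, z). f x - g (x + z) + s * (norm z)\<^sup>2"
  have cont: "continuous_on ?Q ?\<Psi>"
  proof -
    have "continuous_on ?Q (\<lambda>w. f (fst w))"
      by (rule continuous_on_compose2[OF f(2) continuous_on_fst[OF continuous_on_id] subset_UNIV])
    moreover have "continuous_on ?Q (\<lambda>w. g (fst w + snd w))"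
      by (rule continuous_on_compose2[OF g(2) _ subset_UNIV])
        (rule continuous_on_add[OF continuous_on_fst[OF continuous_on_id] continuous_on_snd[OF continuous_on_id]])
    moreover have "continuous_on ?Q (\<lambda>w. s * (norm (snd w))\<^sup>2)"
      by (rule continuous_on_mult[OF continuous_on_const
            continuous_on_power[OF continuous_on_norm[OF continuous_on_snd[OF continuous_on_id]]]])
    ultimately show ?thesis
      unfolding case_prod_beta by (rule continuous_on_add[OF continuous_on_diff])
  qed
  obtain y0 :: "real^'n" where y0: "y0 \<in> cbox 0 (vec 1)" by (rule torus_representative)
  have "R \<ge> 0" using B0 s by (simp add: R_def)
  then have "(y0, 0) \<in> ?Q" using y0 by simp
  then have ne: "?Q \<noteq> {}" by blast
  obtain w where w: "w \<in> ?Q" "\<forall>w'\<in>?Q. ?\<Psi> w \<le> ?\<Psi> w'"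
    using continuous_attains_inf[OF compact_Times[OF compact_cbox compact_cball] ne cont] by (elim bexE)
  obtain x0 z0 where wxz: "w = (x0, z0)" by (cases w)
  show thesis
  proof (rule that[of x0 z0])
    fix x z :: "real^'n"
    obtain y :: "real^'n" where y: "y \<in> cbox 0 (vec 1)" "torus_eq y x" by (rule torus_representative)
    have fy: "f y = f x" by (rule torus_funD[OF f(1) y(2)])
    have gy: "g (y + z) = g (x + z)" for z by (rule torus_funD[OF g(1) torus_eq_add[OF y(2)]])
    show "f x0 - g (x0 + z0) + s * (norm z0)\<^sup>2 \<le> f x - g (x + z) + s * (norm z)\<^sup>2"
    proof (cases "z \<in> cball 0 R")
      case True
      then have "(y, z) \<in> ?Q" using y(1) by simp
      from bspec[OF w(2) this] show ?thesis by (simp add: wxz fy gy)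
    next
      case False
      then have "R < norm z" by simp
      then have "R\<^sup>2 \<le> (norm z)\<^sup>2" using \<open>R \<ge> 0\<close> by (intro power_mono) auto
      moreover have "R\<^sup>2 = 2 * B / s" using B0 s by (simp add: R_def)
      ultimately have "2 * B \<le> s * (norm z)\<^sup>2" using s by (simp add: pos_divide_le_eq mult.commute)
      have "(y, 0) \<in> ?Q" using y(1) \<open>R \<ge> 0\<close> by simp
      from bspec[OF w(2) this] have "f x0 - g (x0 + z0) + s * (norm z0)\<^sup>2 \<le> f x - g x"
        using gy[of 0] by (simp add: wxz fy)
      then show ?thesis using \<open>2 * B \<le> s * (norm z)\<^sup>2\<close> B[of x] B[of "x + z"] by linarith
    qed
  qed
qed

text \<open>
  The composition, over \<open>c \<in> C\<close>, of the maps that shrink the distance to a point by \<open>h\<close>. Later maps are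
  centred at the image of \<open>c\<close> under the earlier ones; since these are contractions, the interval of radius \<open>h\<close>
  around \<open>c\<close> is collapsed all the same.
\<close>

lemma soft_threshold:
  fixes C :: "real set"
  assumes "finite C" "h > 0"
  shows "\<exists>\<tau>. (\<forall>s t. \<bar>\<tau> s - \<tau> t\<bar> \<le> \<bar>s - t\<bar>) \<and> (\<forall>s. \<bar>\<tau> s - s\<bar> \<le> real (card C) * h) \<and>
     (\<forall>c\<in>C. \<forall>s. \<bar>s - c\<bar> \<le> h \<longrightarrow> \<tau> s = \<tau> c)"
  using assms(1)
proof induction
  case empty
  show ?case by (intro exI[of _ "\<lambda>s. s"]) auto
next
  case (insert c C)
  then obtain \<tau> where \<tau>: "\<forall>s t. \<bar>\<tau> s - \<tau> t\<bar> \<le> \<bar>s - t\<bar>" "\<forall>s. \<bar>\<tau> s - s\<bar> \<le> real (card C) * h"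
    "\<forall>c\<in>C. \<forall>s. \<bar>s - c\<bar> \<le> h \<longrightarrow> \<tau> s = \<tau> c" by blast
  define \<rho> where "\<rho> = (\<lambda>w. w - max (- h) (min h w))"
  have \<rho>1: "\<bar>\<rho> w - \<rho> w'\<bar> \<le> \<bar>w - w'\<bar>" for w w'
    using assms(2) by (auto simp: \<rho>_def max_def min_def)
  have \<rho>2: "\<bar>\<rho> w - w\<bar> \<le> h" for w using assms(2) by (auto simp: \<rho>_def max_def min_def)
  have \<rho>3: "\<rho> w = 0" if "\<bar>w\<bar> \<le> h" for w using that by (auto simp: \<rho>_def max_def min_def)
  define \<tau>' where "\<tau>' = (\<lambda>s. \<rho> (\<tau> s - \<tau> c) + \<tau> c)"
  show ?case
  proof (intro exI[of _ \<tau>'] conjI allI ballI impI)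
    fix s t
    have "\<bar>\<tau>' s - \<tau>' t\<bar> \<le> \<bar>\<tau> s - \<tau> t\<bar>" using \<rho>1[of "\<tau> s - \<tau> c" "\<tau> t - \<tau> c"] by (simp add: \<tau>'_def)
    then show "\<bar>\<tau>' s - \<tau>' t\<bar> \<le> \<bar>s - t\<bar>" using \<tau>(1) order_trans by blast
  next
    fix s
    have "\<bar>\<tau>' s - \<tau> s\<bar> \<le> h" using \<rho>2[of "\<tau> s - \<tau> c"] by (simp add: \<tau>'_def)
    moreover have "\<bar>\<tau> s - s\<bar> \<le> real (card C) * h" using \<tau>(2) by blast
    ultimately have "\<bar>\<tau>' s - s\<bar> \<le> real (card C) * h + h" by linarith
    then show "\<bar>\<tau>' s - s\<bar> \<le> real (card (insert c C)) * h"
      using insert.hyps by (simp add: distrib_right)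
  next
    fix c' s assume c': "c' \<in> insert c C" "\<bar>s - c'\<bar> \<le> h"
    show "\<tau>' s = \<tau>' c'"
    proof (cases "c' = c")
      case True
      have "\<bar>\<tau> s - \<tau> c\<bar> \<le> \<bar>s - c\<bar>" using \<tau>(1) by blast
      then have "\<bar>\<tau> s - \<tau> c\<bar> \<le> h" using c'(2) True by simp
      then show ?thesis using True \<rho>3 assms(2) by (simp add: \<tau>'_def)
    next
      case False
      then have "\<tau> s = \<tau> c'" using \<tau>(3) c' by blast
      then show ?thesis by (simp add: \<tau>'_def)
    qed
  qed
qed

section \<open>The Mane potential\<close>

definition extend_straight :: "real \<Rightarrow> real^'n \<Rightarrow> (real \<Rightarrow> real^'n) \<Rightarrow> real \<Rightarrow> real^'n" where
  "extend_straight T w \<gamma> t = \<gamma> (min t T) + (max t T - T) *\<^sub>R w"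

lemma abs_continuous_extend_straight:
  assumes "abs_continuous_on_Icc 0 T \<gamma>" "0 \<le> T"
  shows "abs_continuous_on_Icc 0 T' (extend_straight T w \<gamma>)"
  unfolding extend_straight_def[abs_def]
proof (intro abs_continuous_add abs_continuous_stopped[OF assms] lipschitz_imp_abs_continuous)
  show "norm w + 1 > 0" by (simp add: add_nonneg_pos)
  fix s t :: real
  have "dist ((max s T - T) *\<^sub>R w) ((max t T - T) *\<^sub>R w) = \<bar>max s T - max t T\<bar> * norm w"
    by (simp add: dist_norm flip: scaleR_left_diff_distrib)
  also have "\<dots> \<le> dist s t * (norm w + 1)"
    by (intro mult_mono) (auto simp: dist_real_def max_def)
  finally show "dist ((max s T - T) *\<^sub>R w) ((max t T - T) *\<^sub>R w) \<le> (norm w + 1) * dist s t"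
    by (simp add: mult.commute)
qed

text \<open>
  The two pieces are compared outside the null set of times at which \<open>\<gamma>\<close> is not differentiable and outside
  the endpoints.
\<close>

lemma action_extend_straight:
  fixes \<gamma> :: "real \<Rightarrow> real^'n"
  assumes ac: "abs_continuous_on_Icc 0 T \<gamma>" and T: "T > 0" and \<tau>: "\<tau> > 0"
    and V: "continuous_on UNIV V" "\<And>y. V y \<ge> 0"
    and C: "\<And>t. T \<le> t \<Longrightarrow> t \<le> T + \<tau> \<Longrightarrow> (norm w)\<^sup>2 / 4 + V (\<gamma> T + (t - T) *\<^sub>R w) \<le> C"
  shows "action V (T + \<tau>) (extend_straight T w \<gamma>) \<le> action V T \<gamma> + ennreal (C * \<tau>)"
proof -
  let ?\<gamma> = "extend_straight T w \<gamma>"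
  have cont: "continuous_on {0..T} \<gamma>" by (rule abs_continuous_imp_continuous_on[OF ac])
  obtain g where g: "g \<in> borel_measurable borel" "\<And>t. g t \<ge> 0"
    "\<And>t. t \<in> {0<..<T} \<Longrightarrow> \<gamma> differentiable (at t) \<Longrightarrow>
        g t = (norm (vector_derivative \<gamma> (at t)))\<^sup>2 / 4 + V (\<gamma> t)"
    by (rule borel_Lagrangian[OF cont less_imp_le[OF T] V]) blast
  have "0 \<le> (norm w)\<^sup>2 / 4 + V (\<gamma> T + (T - T) *\<^sub>R w)" using V(2) by simp
  also have "\<dots> \<le> C" by (rule C) (use \<tau> in auto)
  finally have C0: "C \<ge> 0" .
  let ?N = "{t\<in>{0<..<T}. \<not> \<gamma> differentiable (at t)} \<union> {0,T,T+\<tau>}"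
  have "negligible ?N" using abs_continuous_differentiable_ae[OF ac] by simp
  then have "AE t in lebesgue. t \<notin> ?N" by (intro AE_not_in) (simp add: negligible_iff_null_sets)
  then have AE: "AE t in lborel. t \<notin> ?N" unfolding AE_completion_iff .
  have "action V (T + \<tau>) ?\<gamma> \<le> (\<integral>\<^sup>+ t. ennreal (g t) * indicator {0..T} t + ennreal C * indicator {T..T+\<tau>} t \<partial>lborel)"
    unfolding action_def
  proof (rule nn_integral_mono_AE, rule AE_mp[OF AE], rule AE_I2, rule impI)
    fix t assume t: "t \<notin> ?N"
    show "ennreal ((norm (vector_derivative ?\<gamma> (at t)))\<^sup>2 / 4 + V (?\<gamma> t)) * indicator {0..T + \<tau>} t
        \<le> ennreal (g t) * indicator {0..T} t + ennreal C * indicator {T..T+\<tau>} t"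
    proof (cases "t \<in> {0..T+\<tau>}")
      case True
      show ?thesis
      proof (cases "t < T")
        case lt: True
        with t True have t': "t \<in> {0<..<T}" "\<gamma> differentiable (at t)" by auto
        have "(\<gamma> has_vector_derivative vector_derivative \<gamma> (at t)) (at t)"
          using t'(2) vector_derivative_works by blast
        then have "(?\<gamma> has_vector_derivative vector_derivative \<gamma> (at t)) (at t)"
          by (rule has_vector_derivative_transform_within_open[of _ _ _ "{0<..<T}"])
            (use t' in \<open>auto simp: extend_straight_def\<close>)
        then have "vector_derivative ?\<gamma> (at t) = vector_derivative \<gamma> (at t)" by (rule vector_derivative_at)
        moreover have "?\<gamma> t = \<gamma> t" using lt by (simp add: extend_straight_def)
        ultimately show ?thesis using g(3)[OF t'] True t' by (simp add: indicator_def)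
      next
        case False
        with t True have t': "t \<in> {T<..<T+\<tau>}" by auto
        have "((\<lambda>t. \<gamma> T + (t - T) *\<^sub>R w) has_vector_derivative w) (at t)"
          by (auto intro!: derivative_eq_intros)
        then have "(?\<gamma> has_vector_derivative w) (at t)"
          by (rule has_vector_derivative_transform_within_open[of _ _ _ "{T<..<T+\<tau>}"])
            (use t' in \<open>auto simp: extend_straight_def\<close>)
        then have "vector_derivative ?\<gamma> (at t) = w" by (rule vector_derivative_at)
        moreover have "?\<gamma> t = \<gamma> T + (t - T) *\<^sub>R w" using t' by (simp add: extend_straight_def)
        ultimately show ?thesis using C[of t] t' by (auto simp: indicator_def intro: ennreal_leI)
      qed
    qed simp
  qed
  also have "\<dots> = (\<integral>\<^sup>+ t. ennreal (g t) * indicator {0..T} t \<partial>lborel) + (\<integral>\<^sup>+ t. ennreal C * indicator {T..T+\<tau>} t \<partial>lborel)"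
    using g(1) by (intro nn_integral_add) auto
  also have "(\<integral>\<^sup>+ t. ennreal (g t) * indicator {0..T} t \<partial>lborel) = action V T \<gamma>"
    by (rule action_eq_borel[OF ac g(3), symmetric])
  also have "(\<integral>\<^sup>+ t. ennreal C * indicator {T..T+\<tau>} t \<partial>lborel) = ennreal (C * \<tau>)"
    using \<tau> C0 by (simp add: nn_integral_cmult ennreal_mult)
  finally show ?thesis .
qed

text \<open>
  The infimum before conversion to a real number, for which estimates need no finiteness.
\<close>

definition mane_inf :: "(real^'n \<Rightarrow> real) \<Rightarrow> real^'n \<Rightarrow> real^'n \<Rightarrow> ennreal" where
  "mane_inf V y x = (INF T\<in>{0<..}. INF \<gamma>\<in>torus_curves T y x. action V T \<gamma>)"

lemma mane_inf_le: "T > 0 \<Longrightarrow> \<gamma> \<in> torus_curves T y x \<Longrightarrow> mane_inf V y x \<le> action V T \<gamma>"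
  unfolding mane_inf_def by (rule INF_lower2[of T]) (auto intro: INF_lower)

lemma mane_inf_greatest:
  assumes "\<And>T \<gamma>. T > 0 \<Longrightarrow> \<gamma> \<in> torus_curves T y x \<Longrightarrow> c \<le> action V T \<gamma>"
  shows "c \<le> mane_inf V y x"
  unfolding mane_inf_def by (intro INF_greatest) (use assms in auto)

lemma mane_inf_self:
  assumes "\<And>y. V y \<ge> 0"
  shows "mane_inf V y y \<le> ennreal (V y)"
proof -
  have "abs_continuous_on_Icc 0 1 (\<lambda>t. y)" by (rule lipschitz_imp_abs_continuous[OF zero_less_one]) simp
  then have "(\<lambda>t. y) \<in> torus_curves 1 y y" by (simp add: torus_curves_def)
  then have "mane_inf V y y \<le> action V 1 (\<lambda>t. y)" by (intro mane_inf_le) auto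
  also have "\<dots> = ennreal (V y)" by (simp add: action_def nn_integral_cmult)
  finally show ?thesis .
qed

text \<open>
  The segment is run through at speed \<open>2 s\<close>, which balances \<open>|\<gamma>'|\<^sup>2 / 4\<close> against the bound \<open>s\<^sup>2\<close> for \<open>V\<close>.
\<close>

lemma mane_inf_step:
  fixes V :: "real^'n \<Rightarrow> real"
  assumes V: "torus_fun V" "continuous_on UNIV V" "\<And>y. V y \<ge> 0"
    and s: "s > 0" "\<And>z. z \<in> closed_segment a b \<Longrightarrow> V z \<le> s\<^sup>2"
  shows "mane_inf V y b \<le> mane_inf V y a + ennreal (s * norm (b - a))"
proof (cases "a = b")
  case False
  define \<tau> where "\<tau> = norm (b - a) / (2 * s)"
  define w where "w = (1 / \<tau>) *\<^sub>R (b - a)"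
  have \<tau>: "\<tau> > 0" using False s by (simp add: \<tau>_def)
  have nw: "norm w = 2 * s" using False s by (simp add: w_def \<tau>_def)
  have "mane_inf V y b - ennreal (s * norm (b - a)) \<le> mane_inf V y a"
  proof (rule mane_inf_greatest)
    fix T \<gamma> assume T: "(T::real) > 0" and \<gamma>: "\<gamma> \<in> torus_curves T y a"
    then have ac: "abs_continuous_on_Icc 0 T \<gamma>" and e0: "torus_eq (\<gamma> 0) y" and eT: "torus_eq (\<gamma> T) a"
      by (auto simp: torus_curves_def)
    let ?\<gamma> = "extend_straight T w \<gamma>"
    have bound: "(norm w)\<^sup>2 / 4 + V (\<gamma> T + (t - T) *\<^sub>R w) \<le> 2 * s\<^sup>2" if t: "T \<le> t" "t \<le> T + \<tau>" for t
    proof -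
      define u where "u = (t - T) / \<tau>"
      have u: "0 \<le> u" "u \<le> 1" using t \<tau> by (auto simp: u_def)
      have "(t - T) *\<^sub>R w = u *\<^sub>R (b - a)" by (simp add: w_def u_def)
      then have "torus_eq (\<gamma> T + (t - T) *\<^sub>R w) (a + u *\<^sub>R (b - a))" using torus_eq_add[OF eT] by simp
      then have "V (\<gamma> T + (t - T) *\<^sub>R w) = V (a + u *\<^sub>R (b - a))" by (rule torus_funD[OF V(1)])
      also have "\<dots> \<le> s\<^sup>2"
      proof (rule s(2))
        show "a + u *\<^sub>R (b - a) \<in> closed_segment a b"
          unfolding in_segment using u by (intro exI[of _ u]) (simp add: algebra_simps)
      qed
      finally show ?thesis using nw by (simp add: power_mult_distrib)
    qed
    have "?\<gamma> \<in> torus_curves (T + \<tau>) y b"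
    proof -
      have "?\<gamma> 0 = \<gamma> 0" using T by (simp add: extend_straight_def)
      moreover have "?\<gamma> (T + \<tau>) = \<gamma> T + (b - a)" using \<tau> by (simp add: extend_straight_def w_def)
      moreover have "torus_eq (\<gamma> T + (b - a)) (a + (b - a))" by (rule torus_eq_add[OF eT])
      ultimately show ?thesis
        using e0 abs_continuous_extend_straight[OF ac less_imp_le[OF T]] by (simp add: torus_curves_def)
    qed
    then have "mane_inf V y b \<le> action V (T + \<tau>) ?\<gamma>" using T \<tau> by (intro mane_inf_le) auto
    also have "\<dots> \<le> action V T \<gamma> + ennreal (2 * s\<^sup>2 * \<tau>)"
      by (rule action_extend_straight[OF ac T \<tau> V(2,3) bound])
    also have "2 * s\<^sup>2 * \<tau> = s * norm (b - a)" using s(1) by (simp add: \<tau>_def power2_eq_square)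
    finally show "mane_inf V y b - ennreal (s * norm (b - a)) \<le> action V T \<gamma>"
      by (simp add: ennreal_minus_le_iff add.commute)
  qed
  then show ?thesis by (simp add: ennreal_minus_le_iff add.commute)
qed simp

lemma mane_inf_finite:
  fixes V :: "real^'n \<Rightarrow> real"
  assumes V: "torus_fun V" "continuous_on UNIV V" "\<And>y. V y \<ge> 0"
  shows "mane_inf V y x < \<infinity>"
proof -
  obtain M where M: "\<And>x. \<bar>V x\<bar> \<le> M" by (rule torus_fun_bounded[OF V(1,2)]) blast
  have M0: "M \<ge> 0" using M[of 0] by linarith
  have Ms: "V z \<le> (M + 1)\<^sup>2" for z
  proof -
    have "M \<le> (M + 1)\<^sup>2" using M0 by (simp add: power2_eq_square algebra_simps)
    then show ?thesis using M[of z] by linarith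
  qed
  have "mane_inf V y x \<le> mane_inf V y y + ennreal ((M + 1) * norm (x - y))"
    by (rule mane_inf_step[OF V]) (use M0 Ms in auto)
  also have "\<dots> \<le> ennreal (V y) + ennreal ((M + 1) * norm (x - y))"
    by (intro add_right_mono mane_inf_self V(3))
  also have "\<dots> < \<infinity>" by simp
  finally show ?thesis .
qed

lemma mane_step:
  fixes V :: "real^'n \<Rightarrow> real"
  assumes V: "torus_fun V" "continuous_on UNIV V" "\<And>y. V y \<ge> 0"
    and s: "s > 0" "\<And>z. z \<in> closed_segment a b \<Longrightarrow> V z \<le> s\<^sup>2"
  shows "mane V y b \<le> mane V y a + s * norm (b - a)"
proof -
  have m: "ennreal (mane V y x) = mane_inf V y x" for x
    unfolding mane_def mane_inf_def[symmetric] using mane_inf_finite[OF V, of y x] by simp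
  have m0: "mane V y x \<ge> 0" for x unfolding mane_def by simp
  have "ennreal (mane V y b) \<le> ennreal (mane V y a) + ennreal (s * norm (b - a))"
    unfolding m by (rule mane_inf_step[OF assms])
  also have "\<dots> = ennreal (mane V y a + s * norm (b - a))"
    using m0 s(1) by (intro ennreal_plus[symmetric]) auto
  finally show ?thesis by (subst (asm) ennreal_le_iff) (use m0 s(1) in auto)
qed

lemma mane_self_zero:
  assumes "\<And>y. V y \<ge> 0" "V y = 0"
  shows "mane V y y = 0"
  using mane_inf_self[of V y, OF assms(1)] assms(2) by (simp add: mane_def mane_inf_def)

lemma torus_fun_mane:
  fixes y :: "real^'n"
  shows "torus_fun (mane V y)"
proof -
  have "torus_curves T y a = torus_curves T y b" if "torus_eq a b" for T and a b :: "real^'n"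
    unfolding torus_curves_def using that torus_eq_trans torus_eq_sym by blast
  then show ?thesis unfolding torus_fun_def mane_def by simp
qed

text \<open>
  Near \<open>z\<close> the potential is at most \<open>(sqrt (V z) + e)\<^sup>2\<close>, also on the segments between nearby points, and a step
  from \<open>a\<close> to \<open>b\<close> can be reversed.
\<close>

lemma eikonal_sub_mane:
  fixes V :: "real^'n \<Rightarrow> real"
  assumes V: "torus_fun V" "continuous_on UNIV V" "\<And>y. V y \<ge> 0"
  shows "eikonal_sub V (mane V y)"
  unfolding eikonal_sub_def
proof (intro allI impI)
  fix z :: "real^'n" and e :: real assume e: "e > 0"
  define s where "s = sqrt (V z) + e"
  have s: "s > 0" using e V(3)[of z] by (simp add: s_def add_nonneg_pos)
  have "V z = (sqrt (V z))\<^sup>2" using V(3) by simp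
  also have "\<dots> < s\<^sup>2" unfolding s_def using e V(3)[of z] by (intro power_strict_mono) auto
  finally have "s\<^sup>2 - V z > 0" by simp
  then obtain d where d: "d > 0" "\<And>x. dist x z < d \<Longrightarrow> dist (V x) (V z) < s\<^sup>2 - V z"
    using V(2) unfolding continuous_on_iff by blast
  have Vd: "V x \<le> s\<^sup>2" if "x \<in> ball z d" for x
    using d(2)[of x] that by (auto simp: dist_commute dist_real_def)
  show "\<exists>\<delta>>0. \<forall>a\<in>ball z \<delta>. \<forall>b\<in>ball z \<delta>. \<bar>mane V y a - mane V y b\<bar> \<le> (sqrt (V z) + e) * norm (a - b)"
  proof (intro exI[of _ d] conjI d(1) ballI)
    fix a b assume ab: "a \<in> ball z d" "b \<in> ball z d"
    have seg: "closed_segment a b \<subseteq> ball z d" using ab by (simp add: closed_segment_subset)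
    have "mane V y b \<le> mane V y a + s * norm (b - a)"
      by (rule mane_step[OF V s]) (use seg Vd in blast)
    moreover have "mane V y a \<le> mane V y b + s * norm (a - b)"
      by (rule mane_step[OF V s]) (use seg Vd closed_segment_commute in blast)
    ultimately show "\<bar>mane V y a - mane V y b\<bar> \<le> (sqrt (V z) + e) * norm (a - b)"
      unfolding s_def[symmetric] by (simp add: norm_minus_commute abs_le_iff)
  qed
qed

section \<open>Functions of a quadratic form as test functions\<close>

definition quad :: "real^'n^'n \<Rightarrow> real^'n \<Rightarrow> real^'n \<Rightarrow> real" where
  "quad B z x = (x - z) \<bullet> (B *v (x - z)) / 2"

lemma symmetric_inner:
  assumes "transpose B = (B :: real^'n^'n)"
  shows "(B *v a) \<bullet> b = a \<bullet> (B *v b)"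
  using assms by (metis dot_lmul_matrix inner_commute transpose_matrix_vector)

lemma has_derivative_quad:
  assumes "transpose B = B"
  shows "(quad B z has_derivative (\<lambda>h. (B *v (x - z)) \<bullet> h)) (at x)"
proof -
  have "((\<lambda>x. (x - z) \<bullet> (B *v (x - z)) / 2) has_derivative
      (\<lambda>h. ((x - z) \<bullet> (B *v h) + h \<bullet> (B *v (x - z))) / 2)) (at x)"
    by (auto intro!: derivative_eq_intros
        bounded_linear.has_derivative[OF matrix_vector_mul_bounded_linear])
  moreover have "((x - z) \<bullet> (B *v h) + h \<bullet> (B *v (x - z))) / 2 = (B *v (x - z)) \<bullet> h" for h
    using symmetric_inner[OF assms, of "x - z" h] by (simp add: inner_commute)
  ultimately show ?thesis unfolding quad_def[abs_def] by simp
qed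

lemma partial_eq:
  assumes "(\<phi> has_derivative D) (at x)"
  shows "partial i \<phi> x = D (axis i 1)"
  using frechet_derivative_at[OF assms] by (simp add: partial_def)

text \<open>
  All test functions below have this form: polynomials of the quadratic form at a well, smoothed cones
  and the penalty \<open>- s |x - y|\<^sup>2\<close>.
\<close>

lemma function_of_quad:
  fixes B :: "real^'n^'n"
  assumes B: "transpose B = B"
    and f: "\<And>x. (f has_real_derivative f1 (quad B z x)) (at (quad B z x))"
    and f1: "\<And>x. (f1 has_real_derivative f2 (quad B z x)) (at (quad B z x))"
    and f2: "continuous_on UNIV (\<lambda>x. f2 (quad B z x))"
  shows "C2 (\<lambda>x. f (quad B z x))"
    "grad (\<lambda>x. f (quad B z x)) x = f1 (quad B z x) *\<^sub>R (B *v (x - z))"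
    "laplacian (\<lambda>x. f (quad B z x)) x = f2 (quad B z x) * (norm (B *v (x - z)))\<^sup>2 + f1 (quad B z x) * trace B"
proof -
  let ?g = "\<lambda>x. B *v (x - z)" and ?\<phi> = "\<lambda>x. f (quad B z x)"
  have d1: "(?\<phi> has_derivative (\<lambda>h. f1 (quad B z x) * (?g x \<bullet> h))) (at x)" for x
    using has_derivative_compose[OF has_derivative_quad[OF B, of z x] f[of x, unfolded has_field_derivative_def]]
    by simp
  have p1: "partial i ?\<phi> = (\<lambda>x. f1 (quad B z x) * ?g x $ i)" for i
    using partial_eq[OF d1] by (auto simp: inner_axis)
  have d2: "((\<lambda>x. f1 (quad B z x) * ?g x $ i) has_derivative
     (\<lambda>h. f1 (quad B z x) * (B *v h) $ i + f2 (quad B z x) * (?g x \<bullet> h) * ?g x $ i)) (at x)" for i x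
  proof -
    have a: "((\<lambda>x. f1 (quad B z x)) has_derivative (\<lambda>h. f2 (quad B z x) * (?g x \<bullet> h))) (at x)"
      using has_derivative_compose[OF has_derivative_quad[OF B, of z x] f1[of x, unfolded has_field_derivative_def]]
      by simp
    have b: "((\<lambda>x. ?g x $ i) has_derivative (\<lambda>h. (B *v h) $ i)) (at x)"
      by (auto intro!: derivative_eq_intros bounded_linear.has_derivative[OF bounded_linear_vec_nth]
          bounded_linear.has_derivative[OF matrix_vector_mul_bounded_linear])
    show ?thesis using has_derivative_mult[OF a b] by simp
  qed
  have p2: "partial j (partial i ?\<phi>) = (\<lambda>x. f1 (quad B z x) * B $ i $ j + f2 (quad B z x) * ?g x $ j * ?g x $ i)" for i j
    unfolding p1 using partial_eq[OF d2]
    by (auto simp: inner_axis matrix_vector_mult_basis column_def)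
  have cq: "continuous_on UNIV (quad B z)"
    by (intro continuous_at_imp_continuous_on ballI has_derivative_continuous[OF has_derivative_quad[OF B]])
  have cf1: "continuous_on UNIV (\<lambda>x. f1 (quad B z x))"
    unfolding continuous_on_eq_continuous_at[OF open_UNIV]
  proof
    fix x
    have "isCont f1 (quad B z x)" by (rule DERIV_isCont[OF f1])
    moreover have "isCont (quad B z) x" using cq by (simp add: continuous_on_eq_continuous_at)
    ultimately show "isCont (\<lambda>x. f1 (quad B z x)) x" by (rule isCont_o2[rotated])
  qed
  show "C2 ?\<phi>"
    unfolding C2_def
  proof (intro conjI allI)
    show "?\<phi> differentiable (at x)" for x by (rule differentiableI[OF d1])
    show "partial i ?\<phi> differentiable (at x)" for i x unfolding p1 by (rule differentiableI[OF d2])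
    show "continuous_on UNIV (partial j (partial i ?\<phi>))" for i j
      unfolding p2
      by (intro continuous_intros cf1 f2 bounded_linear.continuous_on[OF matrix_vector_mul_bounded_linear])
  qed
  show "grad ?\<phi> x = f1 (quad B z x) *\<^sub>R (B *v (x - z))"
    by (simp add: grad_def p1 vec_eq_iff)
  show "laplacian ?\<phi> x = f2 (quad B z x) * (norm (?g x))\<^sup>2 + f1 (quad B z x) * trace B"
  proof -
    have eq: "(\<Sum>i\<in>UNIV. a * h i + b * w i * w i) = b * (\<Sum>i\<in>UNIV. w i * w i) + a * (\<Sum>i\<in>UNIV. h i)"
      for a b :: real and h w :: "'n \<Rightarrow> real"
      by (simp add: sum.distrib sum_distrib_left mult.assoc)
    show ?thesis
      unfolding laplacian_def p2 trace_def power2_norm_eq_inner inner_vec_def inner_real_def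
      by (rule eq[of "f1 (quad B z x)" "\<lambda>i. B $ i $ i" "f2 (quad B z x)" "\<lambda>i. ?g x $ i"])
  qed
qed

lemma continuous_on_quad: "transpose B = B \<Longrightarrow> continuous_on UNIV (quad B z)"
  by (intro continuous_at_imp_continuous_on ballI has_derivative_continuous[OF has_derivative_quad])

lemma C2_continuous: "C2 \<phi> \<Longrightarrow> continuous_on UNIV \<phi>"
  unfolding C2_def by (intro continuous_at_imp_continuous_on ballI differentiable_imp_continuous_within) blast

lemma polynomial_test:
  fixes B :: "real^'n^'n"
  assumes "transpose B = B"
  shows "C2 (\<lambda>x. a + b * quad B z x + l * (quad B z x)\<^sup>2)"
    "grad (\<lambda>x. a + b * quad B z x + l * (quad B z x)\<^sup>2) x = (b + 2 * l * quad B z x) *\<^sub>R (B *v (x - z))"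
    "laplacian (\<lambda>x. a + b * quad B z x + l * (quad B z x)\<^sup>2) x =
       2 * l * (norm (B *v (x - z)))\<^sup>2 + (b + 2 * l * quad B z x) * trace B"
proof -
  have 1: "((\<lambda>s. a + b * s + l * s\<^sup>2) has_real_derivative (b + 2 * l * s)) (at s)" for s
    by (auto intro!: derivative_eq_intros)
  have 2: "((\<lambda>s. b + 2 * l * s) has_real_derivative (2 * l)) (at s)" for s
    by (auto intro!: derivative_eq_intros)
  note F = function_of_quad[OF assms, of "\<lambda>s. a + b * s + l * s\<^sup>2" "\<lambda>s. b + 2 * l * s" z "\<lambda>_. 2 * l", OF 1 2 continuous_on_const]
  show "C2 (\<lambda>x. a + b * quad B z x + l * (quad B z x)\<^sup>2)" by (rule F(1))
  show "grad (\<lambda>x. a + b * quad B z x + l * (quad B z x)\<^sup>2) x = (b + 2 * l * quad B z x) *\<^sub>R (B *v (x - z))"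
    by (rule F(2))
  show "laplacian (\<lambda>x. a + b * quad B z x + l * (quad B z x)\<^sup>2) x =
       2 * l * (norm (B *v (x - z)))\<^sup>2 + (b + 2 * l * quad B z x) * trace B"
    by (rule F(3))
qed

text \<open>
  Written in terms of \<open>\<sigma> = |x - y|\<^sup>2 / 2\<close>, the function is \<open>L sqrt (2\<sigma> + a\<^sup>2) + 2K\<sigma>\<close>. The second derivative
  of the first summand is negative, so that only the trace term contributes to the bound for the Laplacian.
\<close>

lemma smoothed_cone_test:
  fixes y :: "real^'n"
  assumes "a > 0" "L \<ge> 0" "K \<ge> 0"
  defines "\<phi> \<equiv> (\<lambda>x. L * sqrt ((norm (x - y))\<^sup>2 + a\<^sup>2) + K * (norm (x - y))\<^sup>2)"
  shows "C2 \<phi>"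
    "grad \<phi> x = (L / sqrt ((norm (x - y))\<^sup>2 + a\<^sup>2) + 2 * K) *\<^sub>R (x - y)"
    "laplacian \<phi> x \<le> real CARD('n) * (L / a + 2 * K)"
proof -
  let ?I = "mat 1 :: real^'n^'n"
  let ?s = "\<lambda>s. sqrt (2 * s + a\<^sup>2)"
  have tI: "transpose ?I = ?I" by simp
  have q: "2 * quad ?I y x = (norm (x - y))\<^sup>2" for x by (simp add: quad_def power2_norm_eq_inner)
  have pos: "2 * quad ?I y x + a\<^sup>2 > 0" for x
    unfolding q using assms(1) by (intro add_nonneg_pos) auto
  have d0: "(?s has_real_derivative 1 / ?s s) (at s)" if "2 * s + a\<^sup>2 > 0" for s
    using that by (auto intro!: derivative_eq_intros simp: field_simps)
  have d1: "((\<lambda>s. L * ?s s + 2 * K * s) has_real_derivative (L / ?s s + 2 * K)) (at s)" if "2 * s + a\<^sup>2 > 0" for s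
    using DERIV_add[OF DERIV_cmult[OF d0[OF that], of L] DERIV_cmult_Id[of "2 * K"]] by simp
  have d2: "((\<lambda>s. L / ?s s + 2 * K) has_real_derivative (- L / (?s s) ^ 3)) (at s)" if "2 * s + a\<^sup>2 > 0" for s
  proof -
    have nz: "?s s \<noteq> 0" using that by simp
    have alg: "L * - (inverse u * (1 / u) * inverse u) + 0 = - L / u ^ 3" if "u \<noteq> 0" for u :: real
      using that by (simp add: divide_inverse power3_eq_cube mult_ac)
    have "((\<lambda>s. L * inverse (?s s) + 2 * K) has_real_derivative
        (L * - (inverse (?s s) * (1 / ?s s) * inverse (?s s)) + 0)) (at s)"
      by (intro DERIV_add DERIV_cmult DERIV_inverse' d0[OF that] nz DERIV_const)
    then have "((\<lambda>s. L * inverse (?s s) + 2 * K) has_real_derivative - L / (?s s) ^ 3) (at s)"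
      by (rule DERIV_cong) (rule alg[OF nz])
    then show ?thesis by (simp only: divide_inverse)
  qed
  have c2: "continuous_on UNIV (\<lambda>x. - L / (?s (quad ?I y x)) ^ 3)"
    using pos by (intro continuous_intros continuous_on_quad[OF tI]) (simp add: less_imp_neq[symmetric])
  note F = function_of_quad[OF tI, of "\<lambda>s. L * ?s s + 2 * K * s" "\<lambda>s. L / ?s s + 2 * K" y "\<lambda>s. - L / (?s s) ^ 3",
      OF d1[OF pos] d2[OF pos] c2]
  have eq: "\<phi> = (\<lambda>x. L * ?s (quad ?I y x) + 2 * K * quad ?I y x)"
    unfolding \<phi>_def by (simp add: q[symmetric] mult.assoc mult.left_commute)
  show "C2 \<phi>" unfolding eq by (rule F(1))
  show "grad \<phi> x = (L / sqrt ((norm (x - y))\<^sup>2 + a\<^sup>2) + 2 * K) *\<^sub>R (x - y)"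
    unfolding eq F(2) by (simp add: q)
  have "laplacian \<phi> x = - L / (?s (quad ?I y x)) ^ 3 * (norm (?I *v (x - y)))\<^sup>2 + (L / ?s (quad ?I y x) + 2 * K) * trace ?I"
    unfolding eq by (rule F(3))
  also have "\<dots> \<le> 0 + (L / a + 2 * K) * real CARD('n)"
  proof (rule add_mono)
    have "0 \<le> L / (?s (quad ?I y x)) ^ 3 * (norm (?I *v (x - y)))\<^sup>2"
      using assms(2) pos[of x] by (intro mult_nonneg_nonneg divide_nonneg_nonneg) (auto simp: less_imp_le)
    then show "- L / (?s (quad ?I y x)) ^ 3 * (norm (?I *v (x - y)))\<^sup>2 \<le> 0" by simp
    have "a \<le> ?s (quad ?I y x)" unfolding q using assms(1) by (intro real_le_rsqrt) simp
    then have "L / ?s (quad ?I y x) \<le> L / a" using assms(1,2) pos[of x] by (intro divide_left_mono mult_pos_pos) auto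
    then show "(L / ?s (quad ?I y x) + 2 * K) * trace ?I \<le> (L / a + 2 * K) * real CARD('n)"
      by (simp add: trace_I mult_right_mono)
  qed
  finally show "laplacian \<phi> x \<le> real CARD('n) * (L / a + 2 * K)" by (simp add: mult.commute)
qed

section \<open>Square roots of positive definite matrices\<close>

lemma sym_pos_def_lower_bound:
  fixes A :: "real^'n^'n"
  assumes "sym_pos_def A"
  obtains c where "c > 0" "\<And>z. z \<bullet> (A *v z) \<ge> c * (norm z)\<^sup>2"
proof -
  have cont: "continuous_on (sphere 0 1) (\<lambda>z::real^'n. z \<bullet> (A *v z))"
    by (intro continuous_on_inner continuous_on_id bounded_linear.continuous_on[OF matrix_vector_mul_bounded_linear])
  have "axis undefined 1 \<in> (sphere 0 1 :: (real^'n) set)" by (simp add: norm_axis_1)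
  then have "(sphere 0 1 :: (real^'n) set) \<noteq> {}" by blast
  from continuous_attains_inf[OF compact_sphere this cont]
  obtain u :: "real^'n" where u: "u \<in> sphere 0 1" "\<And>z. z \<in> sphere 0 1 \<Longrightarrow> u \<bullet> (A *v u) \<le> z \<bullet> (A *v z)"
    by blast
  define c where "c = u \<bullet> (A *v u)"
  have "u \<noteq> 0" using u(1) by auto
  then have "c > 0" using assms by (simp add: sym_pos_def_def c_def)
  moreover have "z \<bullet> (A *v z) \<ge> c * (norm z)\<^sup>2" for z
  proof (cases "z = 0")
    case False
    let ?w = "(1 / norm z) *\<^sub>R z"
    have "?w \<in> sphere 0 1" using False by simp
    then have "c \<le> ?w \<bullet> (A *v ?w)" unfolding c_def by (rule u(2))
    also have "\<dots> = (z \<bullet> (A *v z)) / (norm z)\<^sup>2"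
      by (simp add: matrix_vector_mult_scaleR power2_eq_square)
    finally show ?thesis using False by (simp add: pos_le_divide_eq)
  qed simp
  ultimately show thesis by (rule that)
qed

lemma matrix_norm_bound:
  fixes A :: "real^'n^'n"
  obtains C where "C > 0" "\<And>z. norm (A *v z) \<le> C * norm z"
proof -
  obtain K where K: "K > 0" "\<And>z. norm (A *v z) \<le> norm z * K"
    using bounded_linear.pos_bounded[OF matrix_vector_mul_bounded_linear[of A]] by blast
  show thesis by (rule that[OF K(1)]) (use K(2) in \<open>simp add: mult.commute\<close>)
qed

lemma trace_conjugate_nonneg:
  fixes A D :: "real^'n^'n"
  assumes A: "sym_pos_def A" and D: "transpose D = D"
  shows "trace (D ** (A ** D)) \<ge> 0" "trace (D ** (A ** D)) = 0 \<Longrightarrow> D = 0"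
proof -
  have eq: "trace (D ** (A ** D)) = (\<Sum>i\<in>UNIV. (D *v axis i 1) \<bullet> (A *v (D *v axis i 1)))"
    unfolding trace_def
  proof (rule sum.cong)
    fix i :: 'n
    have "(D ** (A ** D)) $ i $ i = axis i 1 \<bullet> ((D ** (A ** D)) *v axis i 1)"
      by (simp add: inner_axis' matrix_vector_mult_basis column_def)
    also have "\<dots> = (D *v axis i 1) \<bullet> (A *v (D *v axis i 1))"
      by (simp add: symmetric_inner[OF D] flip: matrix_vector_mul_assoc)
    finally show "(D ** (A ** D)) $ i $ i = (D *v axis i 1) \<bullet> (A *v (D *v axis i 1))" .
  qed simp
  have nn: "z \<bullet> (A *v z) \<ge> 0" for z using A unfolding sym_pos_def_def by (cases "z = 0") (auto simp: less_imp_le)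
  show "trace (D ** (A ** D)) \<ge> 0" unfolding eq by (intro sum_nonneg nn)
  assume "trace (D ** (A ** D)) = 0"
  then have "(D *v axis i 1) \<bullet> (A *v (D *v axis i 1)) = 0" for i
    unfolding eq using nn by (simp add: sum_nonneg_eq_0_iff)
  then have "D *v axis i 1 = 0" for i using A unfolding sym_pos_def_def by (metis less_irrefl)
  then have "column i D = 0" for i by (simp add: matrix_vector_mult_basis)
  then show "D = 0" by (simp add: column_def vec_eq_iff)
qed

lemma trace_sym_pos_def_nonneg:
  fixes A :: "real^'n^'n"
  assumes "sym_pos_def A"
  shows "trace A \<ge> 0"
proof -
  have "transpose (mat 1 :: real^'n^'n) = mat 1" by simp
  from trace_conjugate_nonneg(1)[OF assms this] show ?thesis by simp
qed

text \<open>
  If \<open>D = A - B\<close>, then \<open>AD + DB = 0\<close>; multiplying by \<open>D\<close> and taking traces gives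
  \<open>tr(DAD) + tr(DBD) = 0\<close>, a sum of two nonnegative terms.
\<close>

lemma sym_pos_def_sqrt_unique:
  fixes A B :: "real^'n^'n"
  assumes A: "sym_pos_def A" and B: "sym_pos_def B" and eq: "A ** A = B ** B"
  shows "A = B"
proof -
  let ?D = "A - B"
  have tD: "transpose ?D = ?D" using A B by (simp add: sym_pos_def_def transpose_def vec_eq_iff)
  have z: "A ** ?D + ?D ** B = 0"
  proof (rule matrix_eq[THEN iffD2], intro allI)
    fix x
    have "A *v (A *v x) = B *v (B *v x)" using eq by (metis matrix_vector_mul_assoc)
    then show "(A ** ?D + ?D ** B) *v x = 0 *v x"
      by (simp add: matrix_vector_mult_add_rdistrib matrix_vector_mult_diff_distrib
          matrix_vector_mult_diff_rdistrib flip: matrix_vector_mul_assoc)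
  qed
  have "trace (?D ** (A ** ?D)) + trace (?D ** (B ** ?D)) = trace (?D ** (A ** ?D)) + trace (?D ** (?D ** B))"
    using trace_mul_sym[of "?D ** ?D" B] trace_mul_sym[of "B ** ?D" ?D] by (simp add: matrix_mul_assoc)
  also have "\<dots> = trace (?D ** (A ** ?D + ?D ** B))"
    by (simp only: matrix_add_ldistrib trace_add)
  also have "\<dots> = 0" unfolding z by (simp add: trace_def)
  finally have "trace (?D ** (A ** ?D)) = 0"
    using trace_conjugate_nonneg(1)[OF A tD] trace_conjugate_nonneg(1)[OF B tD] by linarith
  from trace_conjugate_nonneg(2)[OF A tD this] show ?thesis by simp
qed

text \<open>
  The equation says \<open>(I - Y)\<^sup>2 = I - X\<close>. The map \<open>Y \<mapsto> (X + Y\<^sup>2) / 2\<close> is a contraction of the ball of radius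
  \<open>1 - sqrt (1 - q)\<close> and preserves symmetry. The operator norm is essential, which is why linear maps are used here
  instead of matrices.
\<close>

lemma small_perturbation_sqrt:
  fixes X :: "(real^'n) \<Rightarrow>\<^sub>L (real^'n)"
  assumes "norm X \<le> q" "q < 1" and sym: "\<And>a b. blinfun_apply X a \<bullet> b = a \<bullet> blinfun_apply X b"
  obtains Y :: "(real^'n) \<Rightarrow>\<^sub>L (real^'n)" where "norm Y < 1" "\<And>a b. blinfun_apply Y a \<bullet> b = a \<bullet> blinfun_apply Y b" "2 *\<^sub>R Y = X + (Y o\<^sub>L Y)"
proof -
  have q0: "q \<ge> 0" using assms(1) norm_ge_zero order_trans by blast
  \<comment> \<open>The smaller root of \<open>q + \<rho>\<^sup>2 = 2\<rho>\<close>.\<close>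
  define \<rho> where "\<rho> = 1 - sqrt (1 - q)"
  have \<rho>: "0 \<le> \<rho>" "\<rho> < 1" "q + \<rho> * \<rho> = 2 * \<rho>"
  proof -
    have "(sqrt (1 - q))\<^sup>2 = 1 - q" using assms(2) by simp
    then show "q + \<rho> * \<rho> = 2 * \<rho>" unfolding \<rho>_def by (simp add: power2_eq_square algebra_simps)
  qed (use assms(2) q0 in \<open>auto simp: \<rho>_def\<close>)
  define S where "S = {Y :: (real^'n) \<Rightarrow>\<^sub>L (real^'n). norm Y \<le> \<rho> \<and> (\<forall>a b. blinfun_apply Y a \<bullet> b = a \<bullet> blinfun_apply Y b)}"
  define F where "F = (\<lambda>Y :: (real^'n) \<Rightarrow>\<^sub>L (real^'n). (1/2) *\<^sub>R (X + (Y o\<^sub>L Y)))"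
  have "closed S"
    unfolding S_def
    by (intro closed_Collect_conj closed_Collect_all closed_Collect_le closed_Collect_eq continuous_intros)
  then have "complete S" by (simp add: complete_eq_closed)
  moreover have "S \<noteq> {}" using \<rho>(1) by (auto simp: S_def intro!: exI[of _ 0])
  moreover have "F ` S \<subseteq> S"
  proof
    fix Z assume "Z \<in> F ` S"
    then obtain Y where Y: "norm Y \<le> \<rho>" "\<And>a b. blinfun_apply Y a \<bullet> b = a \<bullet> blinfun_apply Y b" and Z: "Z = F Y" unfolding S_def by auto
    have "norm (X + (Y o\<^sub>L Y)) \<le> q + \<rho> * \<rho>"
      by (intro norm_triangle_mono assms(1) order_trans[OF norm_blinfun_compose] mult_mono Y \<rho>) simp
    then have "norm Z \<le> \<rho>" unfolding Z F_def \<rho>(3) by simp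
    moreover have "blinfun_apply Z a \<bullet> b = a \<bullet> blinfun_apply Z b" for a b
      unfolding Z F_def using sym Y(2) by (simp add: blinfun.bilinear_simps inner_add_left inner_add_right)
    ultimately show "Z \<in> S" unfolding S_def by blast
  qed
  moreover have "\<forall>Y\<in>S. \<forall>Z\<in>S. dist (F Y) (F Z) \<le> \<rho> * dist Y Z"
  proof (intro ballI)
    fix Y Z assume YZ: "Y \<in> S" "Z \<in> S"
    have "F Y - F Z = (1/2) *\<^sub>R ((Y o\<^sub>L (Y - Z)) + ((Y - Z) o\<^sub>L Z))"
      by (rule blinfun_eqI) (simp add: F_def blinfun.bilinear_simps algebra_simps)
    then have "norm (F Y - F Z) = (1/2) * norm ((Y o\<^sub>L (Y - Z)) + ((Y - Z) o\<^sub>L Z))" by simp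
    also have "norm ((Y o\<^sub>L (Y - Z)) + ((Y - Z) o\<^sub>L Z)) \<le> \<rho> * norm (Y - Z) + norm (Y - Z) * \<rho>"
      using YZ unfolding S_def
      by (intro norm_triangle_mono order_trans[OF norm_blinfun_compose] mult_right_mono mult_left_mono) auto
    finally show "dist (F Y) (F Z) \<le> \<rho> * dist Y Z" by (simp add: dist_norm)
  qed
  ultimately have "\<exists>!Y\<in>S. F Y = Y" using \<rho>(1,2) by (intro Banach_fix[of _ \<rho>]) auto
  then obtain Y where Y: "Y \<in> S" "F Y = Y" by blast
  have "2 *\<^sub>R Y = 2 *\<^sub>R F Y" using Y(2) by simp
  also have "\<dots> = X + (Y o\<^sub>L Y)" by (simp add: F_def)
  finally show thesis using that[of Y] Y(1) \<rho>(2) unfolding S_def by auto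
qed

text \<open>
  For large \<open>c\<close> the map \<open>I - M / c\<close> has norm less than 1, and the square root of \<open>M\<close> is \<open>sqrt c\<close> times that of
  \<open>I - (I - M / c)\<close>.
\<close>

lemma sym_pos_def_sqrt_exists:
  fixes M :: "real^'n^'n"
  assumes M: "sym_pos_def M"
  shows "\<exists>A. sym_pos_def A \<and> A ** A = M"
proof -
  have tM: "transpose M = M" using M by (simp add: sym_pos_def_def)
  obtain m where m: "m > 0" "\<And>z. z \<bullet> (M *v z) \<ge> m * (norm z)\<^sup>2" by (rule sym_pos_def_lower_bound[OF M]) blast
  obtain C where C: "C > 0" "\<And>z. norm (M *v z) \<le> C * norm z" by (rule matrix_norm_bound) blast
  \<comment> \<open>With this scale \<open>|z - M z / c|\<^sup>2 \<le> (1 - m / c) |z|\<^sup>2\<close>, without any spectral theory.\<close>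
  define c where "c = C\<^sup>2 / m"
  have c: "c > 0" "C\<^sup>2 = c * m" using m C by (auto simp: c_def)
  define X :: "(real^'n) \<Rightarrow>\<^sub>L (real^'n)" where "X = Blinfun (\<lambda>z. z - (1/c) *\<^sub>R (M *v z))"
  have "bounded_linear (\<lambda>z. z - (1/c) *\<^sub>R (M *v z))"
    by (intro bounded_linear_sub bounded_linear_ident bounded_linear_const_scaleR matrix_vector_mul_bounded_linear)
  then have X: "blinfun_apply X z = z - (1/c) *\<^sub>R (M *v z)" for z
    unfolding X_def by (simp add: bounded_linear_Blinfun_apply)
  have sqX: "(norm (blinfun_apply X z))\<^sup>2 \<le> (1 - m / c) * (norm z)\<^sup>2" for z
  proof -
    have "(norm (M *v z))\<^sup>2 \<le> (C * norm z)\<^sup>2" by (rule power_mono[OF C(2)]) simp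
    then have nM: "(norm (M *v z))\<^sup>2 \<le> c * m * (norm z)\<^sup>2" by (simp add: power_mult_distrib c(2))
    have "(norm (blinfun_apply X z))\<^sup>2 = (norm z)\<^sup>2 - 2 / c * (z \<bullet> (M *v z)) + (norm (M *v z))\<^sup>2 / c\<^sup>2"
      unfolding X power2_norm_eq_inner
      by (simp add: inner_diff_left inner_diff_right inner_commute power2_eq_square)
    also have "\<dots> \<le> (norm z)\<^sup>2 - 2 / c * (m * (norm z)\<^sup>2) + (c * m * (norm z)\<^sup>2) / c\<^sup>2"
      using c(1) by (intro add_mono diff_mono mult_left_mono divide_right_mono m(2) nM) auto
    also have "\<dots> = (1 - m / c) * (norm z)\<^sup>2" using c(1) by (simp add: field_simps power2_eq_square)
    finally show ?thesis .
  qed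
  have mc: "0 \<le> 1 - m / c"
  proof -
    have "0 \<le> (1 - m / c) * (norm (axis undefined 1 :: real^'n))\<^sup>2"
      using sqX order_trans zero_le_power2 by blast
    then show ?thesis by (simp add: norm_axis_1)
  qed
  have nX: "norm X \<le> sqrt (1 - m / c)"
  proof (rule norm_blinfun_bound)
    show "norm (blinfun_apply X z) \<le> sqrt (1 - m / c) * norm z" for z
      using real_le_rsqrt[OF sqX[of z]] by (simp add: real_sqrt_mult)
  qed (use mc in simp)
  have q1: "sqrt (1 - m / c) < 1" using m(1) c(1) by simp
  have symX: "blinfun_apply X a \<bullet> b = a \<bullet> blinfun_apply X b" for a b
    unfolding X by (simp add: inner_diff_left inner_diff_right symmetric_inner[OF tM])
  obtain Y :: "(real^'n) \<Rightarrow>\<^sub>L (real^'n)" where Y: "norm Y < 1" "\<And>a b. blinfun_apply Y a \<bullet> b = a \<bullet> blinfun_apply Y b" "2 *\<^sub>R Y = X + (Y o\<^sub>L Y)"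
    by (rule small_perturbation_sqrt[OF nX q1 symX]) blast
  define g where "g = (\<lambda>z. sqrt c *\<^sub>R (z - blinfun_apply Y z))"
  have lin: "linear g"
    unfolding g_def by (intro bounded_linear.linear bounded_linear_const_scaleR bounded_linear_sub bounded_linear_ident blinfun.bounded_linear_right)
  let ?A = "matrix g"
  have A: "?A *v z = g z" for z by (rule matrix_works) (use lin in \<open>simp add: linear_matrix_vector_mul_eq\<close>)
  have gg: "g (g z) = M *v z" for z
  proof -
    have "g (g z) = c *\<^sub>R (z - 2 *\<^sub>R blinfun_apply Y z + blinfun_apply Y (blinfun_apply Y z))"
      using c(1) by (simp add: g_def blinfun.bilinear_simps algebra_simps scaleR_2)
    also have "2 *\<^sub>R blinfun_apply Y z = blinfun_apply X z + blinfun_apply Y (blinfun_apply Y z)"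
      using arg_cong[OF Y(3), of "\<lambda>W. blinfun_apply W z"] by (simp add: blinfun.bilinear_simps)
    also have "c *\<^sub>R (z - (blinfun_apply X z + blinfun_apply Y (blinfun_apply Y z)) + blinfun_apply Y (blinfun_apply Y z)) = M *v z" using c(1) by (simp add: X)
    finally show ?thesis .
  qed
  have "?A ** ?A = M"
    by (rule matrix_eq[THEN iffD2]) (simp add: A gg flip: matrix_vector_mul_assoc)
  moreover have "transpose ?A = ?A"
  proof (rule matrix_eq[THEN iffD2], intro allI)
    fix z
    have "(transpose ?A *v z) \<bullet> b = (?A *v z) \<bullet> b" for b
    proof -
      have "(transpose ?A *v z) \<bullet> b = z \<bullet> g b"
        by (metis A dot_lmul_matrix transpose_matrix_vector)
      also have "\<dots> = g z \<bullet> b" by (simp add: g_def inner_diff_left inner_diff_right Y(2))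
      finally show ?thesis by (simp add: A)
    qed
    then show "transpose ?A *v z = ?A *v z" using vector_eq_rdot by blast
  qed
  moreover have "z \<bullet> (?A *v z) > 0" if "z \<noteq> 0" for z
  proof -
    have "z \<bullet> blinfun_apply Y z \<le> norm z * norm (blinfun_apply Y z)" by (rule norm_cauchy_schwarz)
    also have "\<dots> \<le> norm z * (norm Y * norm z)" by (intro mult_left_mono norm_blinfun) simp
    also have "\<dots> < norm z * (1 * norm z)" using that Y(1) by simp
    also have "\<dots> = z \<bullet> z" by (simp add: power2_norm_eq_inner[symmetric] power2_eq_square)
    finally show ?thesis using c(1) unfolding A by (simp add: g_def inner_diff_right)
  qed
  ultimately show ?thesis unfolding sym_pos_def_def by blast
qed

lemma spd_sqrt:
  assumes "sym_pos_def M"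
  shows "sym_pos_def (spd_sqrt M)" "spd_sqrt M ** spd_sqrt M = M"
proof -
  have "\<exists>!A. sym_pos_def A \<and> A ** A = M"
    using sym_pos_def_sqrt_exists[OF assms] sym_pos_def_sqrt_unique by metis
  from theI'[OF this] show "sym_pos_def (spd_sqrt M)" "spd_sqrt M ** spd_sqrt M = M"
    unfolding spd_sqrt_def by auto
qed

section \<open>Expansion of the potential at a zero\<close>

lemma linear_functional_grad:
  fixes f :: "real^'n \<Rightarrow> real"
  assumes "f differentiable (at x)"
  shows "(f has_derivative (\<lambda>h. grad f x \<bullet> h)) (at x)"
proof -
  let ?D = "frechet_derivative f (at x)"
  have D: "(f has_derivative ?D) (at x)" using assms frechet_derivative_works by blast
  then have lin: "linear ?D" using has_derivative_linear by blast
  have "?D h = grad f x \<bullet> h" for h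
  proof -
    have "?D h = ?D (\<Sum>i\<in>UNIV. h $ i *\<^sub>R axis i 1)"
      using basis_expansion[of h] by (simp add: scalar_mult_eq_scaleR)
    also have "\<dots> = (\<Sum>i\<in>UNIV. h $ i * ?D (axis i 1))"
      by (simp add: linear_sum[OF lin] linear_scale[OF lin])
    also have "\<dots> = grad f x \<bullet> h" by (simp add: inner_vec_def grad_def partial_def mult.commute)
    finally show ?thesis .
  qed
  then have "?D = (\<lambda>h. grad f x \<bullet> h)" by blast
  with D show ?thesis by simp
qed

text \<open>
  The gradient of \<open>V - quad\<close> is \<open>o(|x - z|)\<close> by differentiability of the gradient of \<open>V\<close> at \<open>z\<close>; the mean value
  inequality on the ball of radius \<open>|x - z|\<close> integrates this.
\<close>

lemma second_order_expansion_at_zero_minimum: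
  fixes V :: "real^'n \<Rightarrow> real"
  assumes C2: "C2 V" and nn: "\<And>y. V y \<ge> 0" and z: "V z = 0"
    and sym: "transpose (hessian V z) = hessian V z" and "\<theta> > 0"
  obtains r where "r > 0" "\<And>x. norm (x - z) < r \<Longrightarrow> \<bar>V x - quad (hessian V z) z x\<bar> \<le> \<theta> * (norm (x - z))\<^sup>2"
proof -
  let ?H = "hessian V z"
  have dV: "(V has_derivative (\<lambda>h. grad V x \<bullet> h)) (at x)" for x
    using C2 unfolding C2_def by (intro linear_functional_grad) blast
  have g0: "grad V z = 0"
  proof -
    have "(\<lambda>h. grad V z \<bullet> h) = (\<lambda>v. 0)"
      by (rule differential_zero_maxmin[OF _ open_UNIV dV]) (use nn z in auto)
    then have "grad V z \<bullet> grad V z = 0" by metis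
    then show ?thesis by simp
  qed
  define e where "e = \<theta> / real CARD('n)"
  have e: "e > 0" using \<open>\<theta> > 0\<close> by (simp add: e_def)
  have "\<forall>\<^sub>F x in nhds z. \<bar>partial i V x - (?H *v (x - z)) $ i\<bar> \<le> e * norm (x - z)" for i
  proof -
    have "(partial i V has_derivative (\<lambda>h. grad (partial i V) z \<bullet> h)) (at z)"
      using C2 unfolding C2_def by (intro linear_functional_grad) blast
    moreover have "grad (partial i V) z \<bullet> h = (?H *v h) $ i" for h
      by (simp add: grad_def hessian_def matrix_vector_mult_def inner_vec_def)
    moreover have "partial i V z = 0" using g0 by (simp add: grad_def vec_eq_iff)
    ultimately obtain d where "d > 0"
      "\<And>x. norm (x - z) < d \<Longrightarrow> \<bar>partial i V x - (?H *v (x - z)) $ i\<bar> \<le> e * norm (x - z)"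
      using e unfolding has_derivative_at_alt by auto
    then show ?thesis unfolding eventually_nhds_metric dist_norm by blast
  qed
  then have "\<forall>\<^sub>F x in nhds z. \<forall>i. \<bar>partial i V x - (?H *v (x - z)) $ i\<bar> \<le> e * norm (x - z)"
    by (rule eventually_all_finite)
  then obtain r where r: "r > 0"
    "\<And>x i. norm (x - z) < r \<Longrightarrow> \<bar>partial i V x - (?H *v (x - z)) $ i\<bar> \<le> e * norm (x - z)"
    unfolding eventually_nhds_metric dist_norm by blast
  have gr: "norm (grad V x - ?H *v (x - z)) \<le> \<theta> * norm (x - z)" if "norm (x - z) < r" for x
  proof -
    have "norm (grad V x - ?H *v (x - z)) \<le> (\<Sum>i\<in>UNIV. \<bar>(grad V x - ?H *v (x - z)) $ i\<bar>)"
      by (rule norm_le_l1_cart)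
    also have "\<dots> \<le> (\<Sum>i\<in>(UNIV::'n set). e * norm (x - z))"
      using r(2)[OF that] by (intro sum_mono) (simp add: grad_def)
    also have "\<dots> = \<theta> * norm (x - z)" by (simp add: e_def)
    finally show ?thesis .
  qed
  show thesis
  proof (rule that[OF r(1)])
    fix x assume x: "norm (x - z) < r"
    let ?R = "\<lambda>x. V x - quad ?H z x"
    define B where "B = cball z (norm (x - z))"
    have B: "x \<in> B" "z \<in> B" by (auto simp: B_def dist_norm norm_minus_commute)
    have dR: "(?R has_derivative (\<lambda>h. (grad V y - ?H *v (y - z)) \<bullet> h)) (at y within B)" for y
    proof (rule has_derivative_at_withinI)
      show "(?R has_derivative (\<lambda>h. (grad V y - ?H *v (y - z)) \<bullet> h)) (at y)"
        using has_derivative_diff[OF dV[of y] has_derivative_quad[OF sym, of z y]]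
        by (simp only: inner_diff_left)
    qed
    have bd: "onorm (\<lambda>h. (grad V y - ?H *v (y - z)) \<bullet> h) \<le> \<theta> * norm (x - z)" if y: "y \<in> B" for y
    proof (rule onorm_bound)
      have ny: "norm (y - z) \<le> norm (x - z)" using y by (simp add: B_def dist_norm norm_minus_commute)
      have le: "norm (grad V y - ?H *v (y - z)) \<le> \<theta> * norm (x - z)"
        using gr[of y] mult_left_mono[OF ny, of \<theta>] ny x \<open>\<theta> > 0\<close> by linarith
      fix h
      have "norm ((grad V y - ?H *v (y - z)) \<bullet> h) \<le> norm (grad V y - ?H *v (y - z)) * norm h"
        using Cauchy_Schwarz_ineq2 by simp
      also have "\<dots> \<le> \<theta> * norm (x - z) * norm h" by (rule mult_right_mono[OF le]) simp
      finally show "norm ((grad V y - ?H *v (y - z)) \<bullet> h) \<le> \<theta> * norm (x - z) * norm h" .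
    qed (use \<open>\<theta> > 0\<close> in simp)
    have "norm (?R x - ?R z) \<le> \<theta> * norm (x - z) * norm (x - z)"
      by (rule differentiable_bound[OF _ dR bd B]) (simp add: B_def)
    then show "\<bar>?R x\<bar> \<le> \<theta> * (norm (x - z))\<^sup>2"
      by (simp add: z quad_def power2_eq_square mult.assoc)
  qed
qed

text \<open>
  \<open>V\<close> behaves like \<open>|A(x - z)|\<^sup>2\<close> near its zero \<open>z\<close>, with a coercivity constant \<open>c\<close> for \<open>A\<close>. The error is relative to
  \<open>|A(x - z)|\<^sup>2\<close>, the quantity in which all the barrier estimates are expressed.
\<close>

definition well_root :: "(real^'n \<Rightarrow> real) \<Rightarrow> real^'n \<Rightarrow> real^'n^'n \<Rightarrow> real \<Rightarrow> bool" where
  "well_root V z A c \<longleftrightarrow> sym_pos_def A \<and> c > 0 \<and> (\<forall>y. c * norm y \<le> norm (A *v y)) \<and>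
     (\<forall>y. c * (norm y)\<^sup>2 \<le> y \<bullet> (A *v y)) \<and>
     (\<forall>\<theta>. \<theta> > 0 \<longrightarrow> (\<exists>r>0. \<forall>x. norm (x - z) < r \<longrightarrow>
        \<bar>V x - (norm (A *v (x - z)))\<^sup>2\<bar> \<le> \<theta> * (norm (A *v (x - z)))\<^sup>2))"

lemma well_rootD:
  assumes "well_root V z A c"
  shows "sym_pos_def A" "c > 0" "c * norm y \<le> norm (A *v y)" "c * (norm y)\<^sup>2 \<le> y \<bullet> (A *v y)"
    "\<theta> > 0 \<Longrightarrow> \<exists>r>0. \<forall>x. norm (x - z) < r \<longrightarrow>
        \<bar>V x - (norm (A *v (x - z)))\<^sup>2\<bar> \<le> \<theta> * (norm (A *v (x - z)))\<^sup>2"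
  using assms unfolding well_root_def by simp_all

text \<open>
  Scaling the root by \<open>s = 1 + \<theta>\<close> produces a barrier from above, by \<open>s = 1 - \<theta>\<close> one from below. Bounding the
  quadratic by \<open>|A(x - z)|\<^sup>2\<close> lets the error terms of order \<open>\<epsilon>\<close> be absorbed by the gap \<open>|s\<^sup>2 - s| |A(x - z)|\<^sup>2\<close>.
\<close>

lemma scaled_root_quad:
  fixes A :: "real^'n^'n"
  assumes wr: "well_root V z A c" and s: "1/2 \<le> s" "s \<le> 2"
  shows "transpose (s *\<^sub>R A) = s *\<^sub>R A" "trace (s *\<^sub>R A) = s * trace A"
    "(norm ((s *\<^sub>R A) *v y))\<^sup>2 = s\<^sup>2 * (norm (A *v y))\<^sup>2"
    "c / 4 * (norm (x - z))\<^sup>2 \<le> quad (s *\<^sub>R A) z x" "0 \<le> quad (s *\<^sub>R A) z x"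
    "quad (s *\<^sub>R A) z x \<le> norm (x - z) * norm (A *v (x - z))"
    "quad (s *\<^sub>R A) z x \<le> (norm (A *v (x - z)))\<^sup>2 / c"
proof -
  note A = well_rootD(1-4)[OF wr]
  let ?w = "x - z"
  have Bv: "(s *\<^sub>R A) *v y = s *\<^sub>R (A *v y)" for y by (rule scaleR_matrix_vector_assoc[symmetric])
  show "transpose (s *\<^sub>R A) = s *\<^sub>R A"
    using A(1) by (simp add: sym_pos_def_def transpose_def vec_eq_iff)
  show "trace (s *\<^sub>R A) = s * trace A" by (simp add: trace_def sum_distrib_left)
  show "(norm ((s *\<^sub>R A) *v y))\<^sup>2 = s\<^sup>2 * (norm (A *v y))\<^sup>2"
    unfolding Bv norm_scaleR power_mult_distrib by simp
  have q: "quad (s *\<^sub>R A) z x = s * (?w \<bullet> (A *v ?w)) / 2" by (simp add: quad_def Bv)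
  have nn: "0 \<le> ?w \<bullet> (A *v ?w)" by (rule order_trans[OF _ A(4)]) (use A(2) in simp)
  have "1/2 * (c * (norm ?w)\<^sup>2) \<le> s * (?w \<bullet> (A *v ?w))"
    by (rule mult_mono) (use A(2,4) s in auto)
  then show low: "c / 4 * (norm ?w)\<^sup>2 \<le> quad (s *\<^sub>R A) z x" by (simp add: q)
  show "0 \<le> quad (s *\<^sub>R A) z x" by (rule order_trans[OF _ low]) (use A(2) in simp)
  have "s * (?w \<bullet> (A *v ?w)) \<le> 2 * (norm ?w * norm (A *v ?w))"
    by (rule mult_mono[OF _ norm_cauchy_schwarz]) (use s nn in auto)
  then show up: "quad (s *\<^sub>R A) z x \<le> norm ?w * norm (A *v ?w)" by (simp add: q)
  have "c * norm ?w * norm (A *v ?w) \<le> norm (A *v ?w) * norm (A *v ?w)"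
    by (rule mult_right_mono[OF A(3)]) simp
  then have "norm ?w * norm (A *v ?w) \<le> (norm (A *v ?w))\<^sup>2 / c"
    using A(2) by (simp add: pos_le_divide_eq power2_eq_square mult_ac)
  with up show "quad (s *\<^sub>R A) z x \<le> (norm (A *v ?w))\<^sup>2 / c" by linarith
qed

section \<open>The equation and the barrier at a well\<close>

locale potential_wells =
  fixes V :: "real^'n \<Rightarrow> real" and m :: nat and p :: "nat \<Rightarrow> real^'n"
    and \<eta> :: real and v :: "real \<Rightarrow> real^'n \<Rightarrow> real"
  assumes V_per: "torus_fun V" and V_C2: "C2 V" and V_nonneg: "\<And>y. V y \<ge> 0"
    and m_pos: "m \<ge> 1"
    and V_zero: "\<And>y. V y = 0 \<longleftrightarrow> (\<exists>i\<in>{1..m}. torus_eq y (p i))"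
    and V_hessian: "\<And>i. i \<in> {1..m} \<Longrightarrow> sym_pos_def (hessian V (p i))"
    and \<eta>_pos: "\<eta> > 0"
    and v_solution: "\<And>\<epsilon>. \<epsilon> > 0 \<Longrightarrow> viscosity_solution V \<eta> \<epsilon> (v \<epsilon>)"

begin

lemma V_continuous: "continuous_on UNIV V"
proof (rule continuous_at_imp_continuous_on, intro ballI)
  fix x
  have "V differentiable (at x)" using V_C2 unfolding C2_def by blast
  then show "isCont V x" by (rule differentiable_imp_continuous_within)
qed

lemma V_bounded: obtains M where "M > 0" "\<And>x. V x \<le> M"
proof -
  obtain M where M: "\<And>x. \<bar>V x\<bar> \<le> M" by (rule torus_fun_bounded[OF V_per V_continuous]) blast
  show thesis
  proof (rule that[of "\<bar>M\<bar> + 1"])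
    show "V x \<le> \<bar>M\<bar> + 1" for x using M[of x] by linarith
  qed simp
qed

lemma v_torus: "\<epsilon> > 0 \<Longrightarrow> torus_fun (v \<epsilon>)"
  and v_continuous: "\<epsilon> > 0 \<Longrightarrow> continuous_on UNIV (v \<epsilon>)"
  using v_solution unfolding viscosity_solution_def by blast+

lemma subsolution_test:
  assumes "\<epsilon> > 0" "C2 \<phi>" "\<And>y. v \<epsilon> y - \<phi> y \<le> v \<epsilon> x - \<phi> x"
  shows "\<epsilon> * \<eta> * v \<epsilon> x - \<epsilon> * laplacian \<phi> x + (norm (grad \<phi> x))\<^sup>2 \<le> V x"
proof -
  have "viscosity_subsolution V \<eta> \<epsilon> (v \<epsilon>)"
    using v_solution[OF assms(1)] unfolding viscosity_solution_def by blast
  then show ?thesis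
    unfolding viscosity_subsolution_def using assms(2,3) by (simp add: always_eventually)
qed

lemma supersolution_test:
  assumes "\<epsilon> > 0" "C2 \<phi>" "\<forall>\<^sub>F y in nhds x. v \<epsilon> y - \<phi> y \<ge> v \<epsilon> x - \<phi> x"
  shows "\<epsilon> * \<eta> * v \<epsilon> x - \<epsilon> * laplacian \<phi> x + (norm (grad \<phi> x))\<^sup>2 \<ge> V x"
proof -
  have "viscosity_supersolution V \<eta> \<epsilon> (v \<epsilon>)"
    using v_solution[OF assms(1)] unfolding viscosity_solution_def by blast
  moreover have "\<forall>\<^sub>F y in at x. v \<epsilon> y - \<phi> y \<ge> v \<epsilon> x - \<phi> x"
    using assms(3) unfolding eventually_at_filter by (rule eventually_mono) simp
  ultimately show ?thesis
    unfolding viscosity_supersolution_def using assms(2) by blast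
qed

lemma v_nonneg:
  assumes "\<epsilon> > 0"
  shows "v \<epsilon> x \<ge> 0"
proof -
  obtain z where min: "\<And>y. v \<epsilon> z \<le> v \<epsilon> y"
    by (rule torus_fun_attains_inf[OF v_torus[OF assms] v_continuous[OF assms]]) blast
  have t0: "transpose (0 :: real^'n^'n) = 0" by (simp add: transpose_def vec_eq_iff)
  note const = function_of_quad[OF t0, of "\<lambda>_. 0" "\<lambda>_. 0" z "\<lambda>_. 0", OF DERIV_const DERIV_const continuous_on_const]
  have "V z \<le> \<epsilon> * \<eta> * v \<epsilon> z - \<epsilon> * laplacian (\<lambda>x::real^'n. 0) z + (norm (grad (\<lambda>x::real^'n. 0) z))\<^sup>2"
    by (rule supersolution_test[OF assms const(1)]) (use min in \<open>simp add: always_eventually\<close>)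
  then have "V z \<le> \<epsilon> * \<eta> * v \<epsilon> z" unfolding const(2,3) by simp
  with V_nonneg[of z] have "0 \<le> (\<epsilon> * \<eta>) * v \<epsilon> z" by linarith
  moreover have "0 < \<epsilon> * \<eta>" using assms \<eta>_pos by simp
  ultimately have "0 \<le> v \<epsilon> z" by (simp only: zero_le_mult_iff) linarith
  with min[of x] show ?thesis by linarith
qed

lemma well_data:
  assumes i: "i \<in> {1..m}"
  obtains A c where "well_root V (p i) A c" "kappa V (p i) = trace A"
proof -
  let ?H = "hessian V (p i)"
  have H: "sym_pos_def ?H" by (rule V_hessian[OF i])
  have sm: "((1/2) *\<^sub>R ?H) *v z = (1/2) *\<^sub>R (?H *v z)" for z
    by (rule scaleR_matrix_vector_assoc[symmetric])
  have H2: "sym_pos_def ((1/2) *\<^sub>R ?H)"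
    unfolding sym_pos_def_def sm using H by (auto simp: sym_pos_def_def transpose_def vec_eq_iff)
  define A where "A = spd_sqrt ((1/2) *\<^sub>R ?H)"
  have A: "sym_pos_def A" "A ** A = (1/2) *\<^sub>R ?H" unfolding A_def by (rule spd_sqrt[OF H2])+
  have tA: "transpose A = A" using A(1) by (simp add: sym_pos_def_def)
  obtain c where c: "c > 0" "\<And>z. z \<bullet> (A *v z) \<ge> c * (norm z)\<^sup>2"
    by (rule sym_pos_def_lower_bound[OF A(1)]) blast
  have c': "c * norm z \<le> norm (A *v z)" for z
  proof (cases "z = 0")
    case False
    have "norm z * (c * norm z) = c * (norm z)\<^sup>2" by (simp add: power2_eq_square)
    also have "\<dots> \<le> norm z * norm (A *v z)" by (rule order_trans[OF c(2) norm_cauchy_schwarz])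
    finally show ?thesis using False by simp
  qed simp
  have q: "quad ?H (p i) x = (norm (A *v (x - p i)))\<^sup>2" for x
  proof -
    let ?z = "x - p i"
    have "quad ?H (p i) x = ?z \<bullet> (((1/2) *\<^sub>R ?H) *v ?z)" by (simp add: quad_def sm)
    also have "\<dots> = ?z \<bullet> (A *v (A *v ?z))" by (simp add: A(2)[symmetric] matrix_vector_mul_assoc)
    also have "\<dots> = (norm (A *v ?z))\<^sup>2" by (simp add: power2_norm_eq_inner symmetric_inner[OF tA])
    finally show ?thesis .
  qed
  have expansion: "\<exists>r>0. \<forall>x. norm (x - p i) < r \<longrightarrow>
      \<bar>V x - (norm (A *v (x - p i)))\<^sup>2\<bar> \<le> \<theta> * (norm (A *v (x - p i)))\<^sup>2" if "\<theta> > 0" for \<theta>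
  proof -
    have pos: "\<theta> * c\<^sup>2 > 0" using c(1) that by simp
    have "V (p i) = 0" using V_zero[of "p i"] i torus_eq_refl by blast
    moreover have "transpose ?H = ?H" using H by (simp add: sym_pos_def_def)
    ultimately obtain r where r: "r > 0"
      "\<And>x. norm (x - p i) < r \<Longrightarrow> \<bar>V x - quad ?H (p i) x\<bar> \<le> \<theta> * c\<^sup>2 * (norm (x - p i))\<^sup>2"
      using second_order_expansion_at_zero_minimum[OF V_C2 V_nonneg _ _ pos] by blast
    show ?thesis
    proof (intro exI[of _ r] conjI r(1) allI impI)
      fix x assume "norm (x - p i) < r"
      from r(2)[OF this] have "\<bar>V x - (norm (A *v (x - p i)))\<^sup>2\<bar> \<le> \<theta> * (c * norm (x - p i))\<^sup>2"
        by (simp add: q power_mult_distrib)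
      also have "\<dots> \<le> \<theta> * (norm (A *v (x - p i)))\<^sup>2"
        using c' c(1) that by (intro mult_left_mono power_mono) auto
      finally show "\<bar>V x - (norm (A *v (x - p i)))\<^sup>2\<bar> \<le> \<theta> * (norm (A *v (x - p i)))\<^sup>2" .
    qed
  qed
  show thesis
  proof (rule that)
    show "kappa V (p i) = trace A" by (simp add: kappa_def A_def)
    show "well_root V (p i) A c"
      unfolding well_root_def by (intro conjI A(1) c(1) allI c' c(2) impI expansion)
  qed
qed

text \<open>
  The barrier is \<open>\<kappa>/\<eta> + \<delta> + q + L q\<^sup>2\<close> with \<open>q\<close> the quadratic of \<open>(1 + \<theta>) A\<close>. Near the well the factor
  \<open>1 + \<theta>\<close> beats the error in the expansion of \<open>V\<close>; far away \<open>L q\<^sup>2\<close> makes the gradient exceed the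
  maximum of \<open>V\<close>. What remains of the inequality at a maximum of \<open>v\<close> minus the barrier is
  \<open>\<eta> v \<le> (1 + \<theta>) \<kappa>\<close>.
\<close>

lemma upper_barrier:
  assumes i: "i \<in> {1..m}" and "\<delta> > 0"
  obtains \<epsilon>0 \<psi> where "\<epsilon>0 > 0" "continuous_on UNIV \<psi>" "\<psi> (p i) = 0"
    "\<And>\<epsilon> y. 0 < \<epsilon> \<Longrightarrow> \<epsilon> < \<epsilon>0 \<Longrightarrow> v \<epsilon> y \<le> kappa V (p i) / \<eta> + \<delta> + \<psi> y"
proof -
  obtain A c where wr: "well_root V (p i) A c" and \<kappa>A: "kappa V (p i) = trace A" by (rule well_data[OF i])
  note c = well_rootD(2)[OF wr]
  define \<kappa> where "\<kappa> = kappa V (p i)"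
  have \<kappa>: "\<kappa> \<ge> 0" unfolding \<kappa>_def \<kappa>A by (rule trace_sym_pos_def_nonneg[OF well_rootD(1)[OF wr]])
  define \<theta> where "\<theta> = min 1 (\<eta> * \<delta> / (\<kappa> + 1))"
  have \<theta>: "0 < \<theta>" "\<theta> \<le> 1" "\<theta> * \<kappa> \<le> \<eta> * \<delta>"
  proof -
    show "0 < \<theta>" "\<theta> \<le> 1" using \<eta>_pos \<open>\<delta> > 0\<close> \<kappa> by (auto simp: \<theta>_def)
    have "\<theta> \<le> \<eta> * \<delta> / (\<kappa> + 1)" by (simp add: \<theta>_def)
    then have "\<theta> * (\<kappa> + 1) \<le> \<eta> * \<delta>" using \<kappa> by (simp add: pos_le_divide_eq)
    then show "\<theta> * \<kappa> \<le> \<eta> * \<delta>" using \<open>0 < \<theta>\<close> by (simp add: algebra_simps)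
  qed
  obtain M where M: "M > 0" "\<And>x. V x \<le> M" by (rule V_bounded) blast
  obtain r where r: "r > 0" "\<And>x. norm (x - p i) < r \<Longrightarrow>
     \<bar>V x - (norm (A *v (x - p i)))\<^sup>2\<bar> \<le> \<theta> * (norm (A *v (x - p i)))\<^sup>2"
    using well_rootD(5)[OF wr \<theta>(1)] by blast
  define B where "B = (1 + \<theta>) *\<^sub>R A"
  define q where "q = quad B (p i)"
  define a where "a = (\<lambda>x. (norm (A *v (x - p i)))\<^sup>2)"
  have s: "1/2 \<le> 1 + \<theta>" "1 + \<theta> \<le> 2" using \<theta> by simp_all
  note sq = scaled_root_quad[OF wr s, folded B_def]
  note tB = sq(1) and qlow = sq(4)[folded q_def] and q0 = sq(5)[folded q_def]
  have qup: "q x \<le> a x / c" for x unfolding q_def a_def by (rule sq(7))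
  have trB: "trace B = (1 + \<theta>) * \<kappa>" by (simp add: sq(2) \<kappa>_def \<kappa>A)
  have nB: "(norm (B *v (x - p i)))\<^sup>2 = (1 + \<theta>)\<^sup>2 * a x" for x unfolding a_def by (rule sq(3))
  have a0: "a x \<ge> 0" for x by (simp add: a_def)
  have alow: "a x \<ge> c\<^sup>2 * (norm (x - p i))\<^sup>2" for x
    unfolding a_def power_mult_distrib[symmetric] using c well_rootD(3)[OF wr] by (intro power_mono) auto
  \<comment> \<open>\<open>4 L q |B z|\<^sup>2 \<ge> M\<close> for \<open>|z| \<ge> r\<close>.\<close>
  define L where "L = M / (c ^ 3 * r ^ 4)"
  have L: "L > 0" using M(1) c r(1) by (simp add: L_def)
  have LM: "L * c ^ 3 * r ^ 4 = M" using c r(1) by (simp add: L_def)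
  define K where "K = 2 * L * trace B / c + 8 * L"
  have trB0: "trace B \<ge> 0" unfolding trB using \<kappa> \<theta>(1) by simp
  have K: "K > 0" using L trB0 c by (simp add: K_def add_nonneg_pos)
  define \<epsilon>0 where "\<epsilon>0 = \<theta> / K"
  have \<epsilon>0: "\<epsilon>0 > 0" using \<theta>(1) K by (simp add: \<epsilon>0_def)
  let ?C = "\<kappa> / \<eta> + \<delta>"
  define \<phi> where "\<phi> = (\<lambda>x. ?C + 1 * q x + L * (q x)\<^sup>2)"
  have C2: "C2 \<phi>" unfolding \<phi>_def q_def by (rule polynomial_test(1)[OF tB])
  have gr: "grad \<phi> x = (1 + 2 * L * q x) *\<^sub>R (B *v (x - p i))" for x
    unfolding \<phi>_def q_def by (rule polynomial_test(2)[OF tB])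
  have la: "laplacian \<phi> x = 2 * L * (norm (B *v (x - p i)))\<^sup>2 + (1 + 2 * L * q x) * trace B" for x
    unfolding \<phi>_def q_def by (rule polynomial_test(3)[OF tB])
  \<comment> \<open>Everything in the equation except \<open>\<epsilon> \<eta> v\<close> and the leading part \<open>\<epsilon> tr B\<close> of the Laplacian.\<close>
  have key: "\<epsilon> * (2 * L * ((1 + \<theta>)\<^sup>2 * a x) + 2 * L * q x * trace B) + V x \<le> (1 + 2 * L * q x)\<^sup>2 * ((1 + \<theta>)\<^sup>2 * a x)"
    if \<epsilon>: "0 < \<epsilon>" "\<epsilon> < \<epsilon>0" for \<epsilon> x
  proof -
    have th4: "(1 + \<theta>)\<^sup>2 \<le> 4" using power_mono[of "1 + \<theta>" 2 2] \<theta> by simp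
    have th1: "1 + 2 * \<theta> \<le> (1 + \<theta>)\<^sup>2" by (simp add: power2_eq_square algebra_simps)
    have "2 * L * ((1 + \<theta>)\<^sup>2 * a x) \<le> 2 * L * (4 * a x)"
      by (rule mult_left_mono[OF mult_right_mono[OF th4 a0]]) (use L in simp)
    moreover have "2 * L * q x * trace B \<le> 2 * L * (a x / c) * trace B"
      using qup L trB0 by (intro mult_right_mono mult_left_mono) auto
    moreover have "K * a x = 2 * L * (a x / c) * trace B + 2 * L * (4 * a x)"
      by (simp add: K_def distrib_right)
    ultimately have "2 * L * ((1 + \<theta>)\<^sup>2 * a x) + 2 * L * q x * trace B \<le> K * a x" by linarith
    then have "\<epsilon> * (2 * L * ((1 + \<theta>)\<^sup>2 * a x) + 2 * L * q x * trace B) \<le> \<epsilon> * (K * a x)"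
      using \<epsilon>(1) by simp
    also have "\<dots> \<le> \<epsilon>0 * (K * a x)"
      by (rule mult_right_mono[OF less_imp_le[OF \<epsilon>(2)]]) (use K a0[of x] in simp)
    also have "\<dots> = \<theta> * a x" using K by (simp add: \<epsilon>0_def)
    finally have e1: "\<epsilon> * (2 * L * ((1 + \<theta>)\<^sup>2 * a x) + 2 * L * q x * trace B) \<le> \<theta> * a x" .
    define S where "S = (1 + \<theta>)\<^sup>2 * a x"
    have S0: "S \<ge> 0" using a0 by (simp add: S_def)
    have "(1 + 2 * L * q x)\<^sup>2 = 1 + 4 * L * q x + 4 * (L * q x)\<^sup>2" by (simp add: power2_eq_square algebra_simps)
    then have "1 + 4 * L * q x \<le> (1 + 2 * L * q x)\<^sup>2" by simp
    then have "(1 + 4 * L * q x) * S \<le> (1 + 2 * L * q x)\<^sup>2 * S"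
      using S0 by (rule mult_right_mono)
    moreover have "(1 + 2 * \<theta>) * a x \<le> S" unfolding S_def using th1 a0 by (rule mult_right_mono)
    moreover have "V x \<le> (1 + \<theta>) * a x + 4 * L * q x * S"
    proof (cases "norm (x - p i) < r")
      case True
      have "0 \<le> 4 * L * q x * S" using L q0 S0 by simp
      moreover have "V x \<le> a x + \<theta> * a x" using r(2)[OF True] unfolding a_def by linarith
      then have "V x \<le> (1 + \<theta>) * a x" by (simp add: distrib_right)
      ultimately show ?thesis by linarith
    next
      case False
      then have rr: "r\<^sup>2 \<le> (norm (x - p i))\<^sup>2" using r(1) by (intro power_mono) auto
      have q1: "c / 4 * r\<^sup>2 \<le> q x"
        by (rule order_trans[OF mult_left_mono[OF rr] qlow]) (use c in simp)
      have a1: "c\<^sup>2 * r\<^sup>2 \<le> S"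
      proof -
        have "c\<^sup>2 * r\<^sup>2 \<le> a x" by (rule order_trans[OF mult_left_mono[OF rr] alow]) simp
        also have "\<dots> \<le> (1 + 2 * \<theta>) * a x" using a0[of x] \<theta>(1) by (simp add: distrib_right)
        also have "\<dots> \<le> S" unfolding S_def using th1 a0 by (rule mult_right_mono)
        finally show ?thesis .
      qed
      have "M = (4 * L * (c / 4 * r\<^sup>2)) * (c\<^sup>2 * r\<^sup>2)"
        unfolding LM[symmetric] by (simp add: power2_eq_square power3_eq_cube power4_eq_xxxx mult_ac)
      also have "\<dots> \<le> (4 * L * q x) * S"
        by (rule mult_mono[OF mult_left_mono[OF q1] a1]) (use L q0[of x] in simp_all)
      finally have "M \<le> 4 * L * q x * S" .
      moreover have "0 \<le> (1 + \<theta>) * a x" using a0 \<theta>(1) by simp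
      ultimately show ?thesis using M(2)[of x] by linarith
    qed
    moreover have "(1 + 4 * L * q x) * S = S + 4 * L * q x * S" by (simp add: distrib_right)
    moreover have "(1 + 2 * \<theta>) * a x = (1 + \<theta>) * a x + \<theta> * a x" by (simp add: algebra_simps)
    ultimately show ?thesis using e1 unfolding S_def by linarith
  qed
  show thesis
  proof (rule that[OF \<epsilon>0, of "\<lambda>y. q y + L * (q y)\<^sup>2"])
    show "continuous_on UNIV (\<lambda>y. q y + L * (q y)\<^sup>2)"
      unfolding q_def by (intro continuous_intros continuous_on_quad[OF tB])
    show "q (p i) + L * (q (p i))\<^sup>2 = 0" by (simp add: q_def quad_def)
    fix \<epsilon> y assume \<epsilon>: "0 < \<epsilon>" "\<epsilon> < \<epsilon>0"
    obtain Mv where Mv: "\<And>x. \<bar>v \<epsilon> x\<bar> \<le> Mv"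
      by (rule torus_fun_bounded[OF v_torus[OF \<epsilon>(1)] v_continuous[OF \<epsilon>(1)]]) blast
    have co: "\<phi> x \<ge> \<phi> (p i) + c / 4 * (norm (x - p i))\<^sup>2" for x
    proof -
      have "\<phi> (p i) = ?C" by (simp add: \<phi>_def q_def quad_def)
      moreover have "0 \<le> L * (q x)\<^sup>2" using L by simp
      ultimately show ?thesis using qlow[of x] unfolding \<phi>_def by simp
    qed
    have c2: "c / 4 > 0" using c by simp
    obtain x where x: "\<And>y. v \<epsilon> y - \<phi> y \<le> v \<epsilon> x - \<phi> x"
      by (rule coercive_attains_max[OF v_continuous[OF \<epsilon>(1)] Mv C2_continuous[OF C2] c2 co]) blast
    have "\<epsilon> * \<eta> * v \<epsilon> x - \<epsilon> * laplacian \<phi> x + (norm (grad \<phi> x))\<^sup>2 \<le> V x"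
      by (rule subsolution_test[OF \<epsilon>(1) C2 x])
    moreover have "(norm (grad \<phi> x))\<^sup>2 = (1 + 2 * L * q x)\<^sup>2 * ((1 + \<theta>)\<^sup>2 * a x)"
      unfolding gr norm_scaleR power_mult_distrib nB by simp
    moreover have "\<epsilon> * laplacian \<phi> x = \<epsilon> * (2 * L * ((1 + \<theta>)\<^sup>2 * a x) + 2 * L * q x * trace B) + \<epsilon> * trace B"
      unfolding la nB by (simp add: distrib_left distrib_right)
    ultimately have "\<epsilon> * \<eta> * v \<epsilon> x \<le> \<epsilon> * trace B" using key[OF \<epsilon>, of x] by linarith
    then have "\<eta> * v \<epsilon> x \<le> trace B" using \<epsilon>(1) by (simp add: mult.assoc)
    also have "\<dots> \<le> \<kappa> + \<eta> * \<delta>" using \<theta>(3) unfolding trB distrib_right by simp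
    finally have "v \<epsilon> x \<le> (\<kappa> + \<eta> * \<delta>) / \<eta>" using \<eta>_pos by (simp add: pos_le_divide_eq mult.commute)
    also have "\<dots> = ?C" using \<eta>_pos by (simp add: add_divide_distrib)
    finally have "v \<epsilon> x \<le> ?C" .
    moreover have "?C \<le> \<phi> x" using q0[of x] L by (simp add: \<phi>_def)
    ultimately have "v \<epsilon> y - \<phi> y \<le> 0" using x[of y] by linarith
    then show "v \<epsilon> y \<le> kappa V (p i) / \<eta> + \<delta> + (q y + L * (q y)\<^sup>2)"
      by (simp add: \<phi>_def \<kappa>_def)
  qed
qed

section \<open>The upper relaxed limit\<close>

text \<open>
  The number \<open>c\<close> is an upper bound for \<open>v\<close> near \<open>x\<close> for all small \<open>\<epsilon>\<close>. One radius serves both variables.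
\<close>

definition asym_bound :: "real^'n \<Rightarrow> real \<Rightarrow> bool" where
  "asym_bound x c \<longleftrightarrow> (\<exists>r>0. \<forall>\<epsilon> y. 0 < \<epsilon> \<and> \<epsilon> < r \<and> dist x y < r \<longrightarrow> v \<epsilon> y \<le> c)"

lemma asym_boundE:
  assumes "asym_bound x c"
  obtains r where "r > 0" "\<And>\<epsilon> y. 0 < \<epsilon> \<Longrightarrow> \<epsilon> < r \<Longrightarrow> dist x y < r \<Longrightarrow> v \<epsilon> y \<le> c"
  using assms unfolding asym_bound_def by blast

lemma asym_bound_mono: "asym_bound x c \<Longrightarrow> c \<le> c' \<Longrightarrow> asym_bound x c'"
  unfolding asym_bound_def by (meson order_trans)

lemma asym_bound_nonneg:
  assumes "asym_bound x c"
  shows "c \<ge> 0"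
proof -
  obtain r where r: "r > 0" "\<And>\<epsilon> y. 0 < \<epsilon> \<Longrightarrow> \<epsilon> < r \<Longrightarrow> dist x y < r \<Longrightarrow> v \<epsilon> y \<le> c"
    by (rule asym_boundE[OF assms]) blast
  have "v (r/2) x \<le> c" by (rule r(2)) (use r(1) in auto)
  moreover have "0 \<le> v (r/2) x" using r(1) by (intro v_nonneg) simp
  ultimately show ?thesis by linarith
qed

lemma asym_bound_torus:
  assumes "asym_bound x c" "torus_eq x' x"
  shows "asym_bound x' c"
proof -
  obtain r where r: "r > 0" "\<And>\<epsilon> y. 0 < \<epsilon> \<Longrightarrow> \<epsilon> < r \<Longrightarrow> dist x y < r \<Longrightarrow> v \<epsilon> y \<le> c"
    by (rule asym_boundE[OF assms(1)]) blast
  show ?thesis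
    unfolding asym_bound_def
  proof (intro exI[of _ r] conjI r(1) allI impI)
    fix \<epsilon> y assume e: "0 < \<epsilon> \<and> \<epsilon> < r \<and> dist x' y < r"
    have "torus_eq (y + (x - x')) y" using torus_eq_shift[OF torus_eq_sym[OF assms(2)]] .
    then have "v \<epsilon> y = v \<epsilon> (y + (x - x'))" using torus_funD[OF v_torus \<open>torus_eq (y + (x - x')) y\<close>] e by simp
    also have "\<dots> \<le> c" by (rule r(2)) (use e in \<open>auto simp: dist_norm\<close>)
    finally show "v \<epsilon> y \<le> c" .
  qed
qed

lemma asym_bound_well:
  assumes i: "i \<in> {1..m}" and "\<delta> > 0"
  shows "asym_bound (p i) (kappa V (p i) / \<eta> + \<delta>)"
proof -
  have "\<delta> / 2 > 0" using \<open>\<delta> > 0\<close> by simp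
  then obtain \<epsilon>0 \<psi> where *: "\<epsilon>0 > 0" "continuous_on UNIV \<psi>" "\<psi> (p i) = 0"
    "\<And>\<epsilon> y. 0 < \<epsilon> \<Longrightarrow> \<epsilon> < \<epsilon>0 \<Longrightarrow> v \<epsilon> y \<le> kappa V (p i) / \<eta> + \<delta> / 2 + \<psi> y"
    by (rule upper_barrier[OF i]) blast
  obtain d where d: "d > 0" "\<And>y. dist y (p i) < d \<Longrightarrow> dist (\<psi> y) (\<psi> (p i)) < \<delta> / 2"
    using *(2) \<open>\<delta> / 2 > 0\<close> unfolding continuous_on_iff by blast
  show ?thesis
    unfolding asym_bound_def
  proof (intro exI[of _ "min d \<epsilon>0"] conjI allI impI)
    fix \<epsilon> y assume e: "0 < \<epsilon> \<and> \<epsilon> < min d \<epsilon>0 \<and> dist (p i) y < min d \<epsilon>0"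
    have "\<psi> y < \<delta> / 2" using d(2)[of y] e *(3) by (simp add: dist_commute dist_real_def)
    moreover have "v \<epsilon> y \<le> kappa V (p i) / \<eta> + \<delta> / 2 + \<psi> y" using *(4) e by simp
    ultimately show "v \<epsilon> y \<le> kappa V (p i) / \<eta> + \<delta>" by linarith
  qed (use d(1) *(1) in simp)
qed

text \<open>
  Testing with constants would only give a bound of order \<open>1 / \<epsilon>\<close>; the barrier at a single well gives one that
  is independent of \<open>\<epsilon>\<close>.
\<close>

lemma v_uniformly_bounded:
  obtains M \<epsilon>0 where "M > 0" "\<epsilon>0 > 0" "\<And>\<epsilon> x. 0 < \<epsilon> \<Longrightarrow> \<epsilon> < \<epsilon>0 \<Longrightarrow> v \<epsilon> x \<le> M"
proof -
  have 1: "1 \<in> {1..m}" using m_pos by simp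
  obtain \<epsilon>0 \<psi> where *: "\<epsilon>0 > 0" "continuous_on UNIV \<psi>" "\<psi> (p 1) = 0"
    "\<And>\<epsilon> y. 0 < \<epsilon> \<Longrightarrow> \<epsilon> < \<epsilon>0 \<Longrightarrow> v \<epsilon> y \<le> kappa V (p 1) / \<eta> + 1 + \<psi> y"
    by (rule upper_barrier[OF 1 zero_less_one]) blast
  have "compact (\<psi> ` cbox 0 (vec 1))"
    by (intro compact_continuous_image continuous_on_subset[OF *(2)]) auto
  then obtain B where B: "\<forall>z\<in>\<psi> ` cbox 0 (vec 1). norm z \<le> B" using compact_imp_bounded bounded_iff by blast
  show thesis
  proof (rule that[of "\<bar>kappa V (p 1) / \<eta> + 1 + B\<bar> + 1", OF _ *(1)])
    fix \<epsilon> x assume e: "0 < \<epsilon>" "\<epsilon> < \<epsilon>0"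
    obtain y :: "real^'n" where y: "y \<in> cbox 0 (vec 1)" "torus_eq y x" by (rule torus_representative)
    have "\<psi> y \<le> B" using B y(1) by force
    then have "v \<epsilon> y \<le> kappa V (p 1) / \<eta> + 1 + B" using *(4)[OF e, of y] by linarith
    moreover have "v \<epsilon> y = v \<epsilon> x" by (rule torus_funD[OF v_torus[OF e(1)] y(2)])
    ultimately show "v \<epsilon> x \<le> \<bar>kappa V (p 1) / \<eta> + 1 + B\<bar> + 1" by linarith
  qed simp
qed

text \<open>
  The cone \<open>c + L |x - y| + K |x - y|\<^sup>2\<close> with \<open>L\<^sup>2 = V y + 2\<sigma>\<close> has squared slope at least \<open>V + \<sigma>\<close> away from its vertex, \<open>K\<close> being chosen from the modulus of continuity and the maximum of \<open>V\<close>. After smoothing at scale \<open>a\<close> it remains steep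
  enough outside the small ball on which \<open>v \<le> c\<close> is known, so that \<open>v\<close> minus the cone must attain its maximum
  in that ball.
\<close>

lemma cone_comparison:
  assumes "\<sigma> > 0"
  obtains K where "K > 0" "\<And>y c x h. asym_bound y c \<Longrightarrow> h > 0 \<Longrightarrow>
    asym_bound x (c + sqrt (V y + 2 * \<sigma>) * norm (x - y) + K * (norm (x - y))\<^sup>2 + h)"
proof -
  obtain d where d: "d > 0" "\<And>x y. norm (x - y) < d \<Longrightarrow> \<bar>V x - V y\<bar> < \<sigma>"
    by (rule torus_fun_uniformly_continuous[OF V_per V_continuous assms]) blast
  obtain M where M: "M > 0" "\<And>x. V x \<le> M" by (rule V_bounded) blast
  \<comment> \<open>So that \<open>4 K\<^sup>2 |x - y|\<^sup>2 \<ge> M\<close> beyond the distance \<open>d\<close> of uniform continuity.\<close>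
  define K where "K = (M + 1) / (2 * d)"
  have K: "K > 0" using M d by (simp add: K_def)
  have Vup: "V x \<le> V y + \<sigma> + 4 * K\<^sup>2 * (norm (x - y))\<^sup>2" for x y
  proof (cases "norm (x - y) < d")
    case True
    moreover have "0 \<le> 4 * K\<^sup>2 * (norm (x - y))\<^sup>2" by simp
    ultimately show ?thesis using d(2)[of x y] by linarith
  next
    case False
    have "M \<le> (M + 1)\<^sup>2" using M(1) by (simp add: power2_eq_square algebra_simps)
    also have "\<dots> = 4 * K\<^sup>2 * d\<^sup>2" using d(1) by (simp add: K_def power_divide power_mult_distrib)
    also have "\<dots> \<le> 4 * K\<^sup>2 * (norm (x - y))\<^sup>2"
      using False d(1) by (intro mult_left_mono power_mono) auto
    finally show ?thesis using M(2)[of x] V_nonneg[of y] assms by linarith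
  qed
  show thesis
  proof (rule that[OF K])
    fix y c x h assume yc: "asym_bound y c" and h: "(h::real) > 0"
    define L where "L = sqrt (V y + 2 * \<sigma>)"
    have L: "L > 0" "L\<^sup>2 = V y + 2 * \<sigma>" using V_nonneg[of y] assms by (auto simp: L_def add_nonneg_pos)
    obtain r0 where r0: "r0 > 0" "\<And>\<epsilon> x. 0 < \<epsilon> \<Longrightarrow> \<epsilon> < r0 \<Longrightarrow> dist y x < r0 \<Longrightarrow> v \<epsilon> x \<le> c"
      by (rule asym_boundE[OF yc]) blast
    have c0: "c \<ge> 0" by (rule asym_bound_nonneg[OF yc])
    \<comment> \<open>Small enough for the height of the smoothed cone and for its slope outside the ball of radius \<open>r0\<close>.\<close>
    define a where "a = min (h / (2 * L)) (r0 * sqrt (\<sigma> / 2) / L)"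
    have a: "a > 0" using h L r0(1) assms by (simp add: a_def)
    have aL: "L * a \<le> h / 2"
    proof -
      have "a \<le> h / (2 * L)" by (simp add: a_def)
      then show ?thesis using L(1) by (simp add: pos_le_divide_eq mult.commute mult.left_commute)
    qed
    have aL2: "L\<^sup>2 * a\<^sup>2 \<le> \<sigma> / 2 * r0\<^sup>2"
    proof -
      have "a \<le> r0 * sqrt (\<sigma> / 2) / L" by (simp add: a_def)
      then have "L * a \<le> r0 * sqrt (\<sigma> / 2)" using L(1) by (simp add: pos_le_divide_eq mult.commute)
      then have "(L * a)\<^sup>2 \<le> (r0 * sqrt (\<sigma> / 2))\<^sup>2" using L a by (intro power_mono) auto
      then show ?thesis using assms by (simp add: power_mult_distrib mult.commute)
    qed
    define N where "N = real CARD('n) * (L / a + 2 * K)"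
    have N: "N > 0" unfolding N_def using L a K by (intro mult_pos_pos add_pos_pos) auto
    define \<phi> where "\<phi> = (\<lambda>x. L * sqrt ((norm (x - y))\<^sup>2 + a\<^sup>2) + K * (norm (x - y))\<^sup>2)"
    note cone = smoothed_cone_test[OF a less_imp_le[OF L(1)] less_imp_le[OF K], of y, folded \<phi>_def]
    have \<phi>low: "\<phi> x \<ge> L * a + K * (norm (x - y))\<^sup>2" for x
    proof -
      have "a \<le> sqrt ((norm (x - y))\<^sup>2 + a\<^sup>2)" by (rule real_le_rsqrt) simp
      then show ?thesis unfolding \<phi>_def using L(1) by simp
    qed
    have \<phi>up: "\<phi> x \<le> L * norm (x - y) + h / 2 + K * (norm (x - y))\<^sup>2" for x
    proof -
      have "sqrt ((norm (x - y))\<^sup>2 + a\<^sup>2) \<le> norm (x - y) + a"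
        using a by (intro real_le_lsqrt) (auto simp: power2_sum)
      then have "L * sqrt ((norm (x - y))\<^sup>2 + a\<^sup>2) \<le> L * (norm (x - y) + a)" using L(1) by simp
      also have "\<dots> \<le> L * norm (x - y) + h / 2" using aL by (simp add: distrib_left)
      finally show ?thesis unfolding \<phi>_def by simp
    qed
    have slope: "V x + \<sigma> / 2 \<le> (norm (grad \<phi> x))\<^sup>2" if far: "r0 \<le> norm (x - y)" for x
    proof -
      let ?\<rho> = "(norm (x - y))\<^sup>2"
      define s where "s = sqrt (?\<rho> + a\<^sup>2)"
      have r2: "r0\<^sup>2 \<le> ?\<rho>" using far r0(1) by (intro power_mono) auto
      have s2: "s\<^sup>2 = ?\<rho> + a\<^sup>2" by (simp add: s_def)
      have s0: "s > 0" using a by (simp add: s_def add_nonneg_pos)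
      have "L\<^sup>2 * a\<^sup>2 \<le> \<sigma> / 2 * s\<^sup>2"
      proof -
        have "L\<^sup>2 * a\<^sup>2 \<le> \<sigma> / 2 * r0\<^sup>2" by (rule aL2)
        also have "\<dots> \<le> \<sigma> / 2 * s\<^sup>2" unfolding s2 using r2 assms by (intro mult_left_mono add_increasing2) auto
        finally show ?thesis .
      qed
      then have "(L\<^sup>2 - \<sigma> / 2) * s\<^sup>2 \<le> L\<^sup>2 * ?\<rho>" by (simp add: s2 algebra_simps)
      then have A: "L\<^sup>2 - \<sigma> / 2 \<le> (L / s)\<^sup>2 * ?\<rho>"
        using s0 by (simp add: power_divide pos_le_divide_eq)
      have "(L / s)\<^sup>2 + (2 * K)\<^sup>2 \<le> (L / s + 2 * K)\<^sup>2"
        using L(1) s0 K by (simp add: power2_sum)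
      then have "((L / s)\<^sup>2 + (2 * K)\<^sup>2) * ?\<rho> \<le> (L / s + 2 * K)\<^sup>2 * ?\<rho>" by (rule mult_right_mono) simp
      moreover have "(norm (grad \<phi> x))\<^sup>2 = (L / s + 2 * K)\<^sup>2 * ?\<rho>"
        unfolding cone(2) norm_scaleR power_mult_distrib s_def by simp
      moreover have "((L / s)\<^sup>2 + (2 * K)\<^sup>2) * ?\<rho> = (L / s)\<^sup>2 * ?\<rho> + 4 * K\<^sup>2 * ?\<rho>"
        by (simp add: distrib_right power_mult_distrib)
      ultimately show ?thesis using A L(2) Vup[of x y] by linarith
    qed
    define \<epsilon>1 where "\<epsilon>1 = min r0 (\<sigma> / 2 / N)"
    have e1: "\<epsilon>1 > 0" using r0(1) assms N by (simp add: \<epsilon>1_def)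
    have glob: "v \<epsilon> w \<le> c + \<phi> w" if \<epsilon>: "0 < \<epsilon>" "\<epsilon> < \<epsilon>1" for \<epsilon> w
    proof -
      obtain Mv where Mv: "\<And>x. \<bar>v \<epsilon> x\<bar> \<le> Mv"
        by (rule torus_fun_bounded[OF v_torus[OF \<epsilon>(1)] v_continuous[OF \<epsilon>(1)]]) blast
      have co: "\<phi> x \<ge> \<phi> y + K * (norm (x - y))\<^sup>2" for x
        using \<phi>low[of x] a unfolding \<phi>_def by simp
      obtain z where z: "\<And>w. v \<epsilon> w - \<phi> w \<le> v \<epsilon> z - \<phi> z"
        by (rule coercive_attains_max[OF v_continuous[OF \<epsilon>(1)] Mv C2_continuous[OF cone(1)] K co]) blast
      have "dist y z < r0"
      proof (rule ccontr)
        assume "\<not> dist y z < r0"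
        then have far: "r0 \<le> norm (z - y)" by (simp add: dist_norm norm_minus_commute)
        have "\<epsilon> * \<eta> * v \<epsilon> z - \<epsilon> * laplacian \<phi> z + (norm (grad \<phi> z))\<^sup>2 \<le> V z"
          by (rule subsolution_test[OF \<epsilon>(1) cone(1) z])
        moreover have "0 \<le> \<epsilon> * \<eta> * v \<epsilon> z" using \<epsilon>(1) \<eta>_pos v_nonneg[OF \<epsilon>(1)] by simp
        moreover have "\<epsilon> * laplacian \<phi> z \<le> \<epsilon> * N"
          unfolding N_def using \<epsilon>(1) cone(3) by (intro mult_left_mono) auto
        moreover have "\<epsilon> * N < \<sigma> / 2"
        proof -
          have "\<epsilon> < \<sigma> / 2 / N" using \<epsilon>(2) by (simp add: \<epsilon>1_def)
          then show ?thesis using N by (simp add: pos_less_divide_eq)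
        qed
        ultimately show False using slope[OF far] by linarith
      qed
      then have "v \<epsilon> z \<le> c" by (intro r0(2)[OF \<epsilon>(1)]) (use \<epsilon>(2) in \<open>auto simp: \<epsilon>1_def\<close>)
      moreover have "0 \<le> \<phi> z" unfolding \<phi>_def using L(1) K by simp
      ultimately show ?thesis using z[of w] by linarith
    qed
    let ?\<psi> = "\<lambda>w. L * norm (w - y) + K * (norm (w - y))\<^sup>2"
    have "continuous_on UNIV ?\<psi>" by (intro continuous_intros)
    then obtain r where r: "r > 0" "\<And>w. dist w x < r \<Longrightarrow> dist (?\<psi> w) (?\<psi> x) < h / 2"
      using half_gt_zero[OF h] unfolding continuous_on_iff by blast
    show "asym_bound x (c + sqrt (V y + 2 * \<sigma>) * norm (x - y) + K * (norm (x - y))\<^sup>2 + h)"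
      unfolding asym_bound_def L_def[symmetric]
    proof (intro exI[of _ "min r \<epsilon>1"] conjI allI impI)
      fix \<epsilon> w assume e: "0 < \<epsilon> \<and> \<epsilon> < min r \<epsilon>1 \<and> dist x w < min r \<epsilon>1"
      have "v \<epsilon> w \<le> c + \<phi> w" using glob e by simp
      moreover have "dist (?\<psi> w) (?\<psi> x) < h / 2" using e by (intro r(2)) (simp add: dist_commute)
      then have "?\<psi> w < ?\<psi> x + h / 2" unfolding dist_real_def by linarith
      ultimately show "v \<epsilon> w \<le> c + L * norm (x - y) + K * (norm (x - y))\<^sup>2 + h"
        using \<phi>up[of w] by linarith
    qed (use r(1) e1 in simp)
  qed
qed

text \<open>
  The upper relaxed limit of \<open>v\<close> as \<open>\<epsilon>\<close> tends to 0.
\<close>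

definition upper_limit :: "real^'n \<Rightarrow> real" where
  "upper_limit x = Inf {c. asym_bound x c}"

lemma asym_bound_exists: "\<exists>c. asym_bound x c"
proof -
  obtain M \<epsilon>0 where "M > 0" "\<epsilon>0 > 0" "\<And>\<epsilon> x. 0 < \<epsilon> \<Longrightarrow> \<epsilon> < \<epsilon>0 \<Longrightarrow> v \<epsilon> x \<le> M"
    by (rule v_uniformly_bounded) blast
  then show ?thesis unfolding asym_bound_def by (intro exI[of _ M] exI[of _ \<epsilon>0]) auto
qed

lemma upper_limit_le: "asym_bound x c \<Longrightarrow> upper_limit x \<le> c"
  unfolding upper_limit_def
  by (rule cInf_lower) (auto intro: bdd_belowI[of _ 0] asym_bound_nonneg)

lemma asym_bound_above_upper_limit:
  assumes "upper_limit x < c"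
  shows "asym_bound x c"
proof -
  have "{c. asym_bound x c} \<noteq> {}" using asym_bound_exists by blast
  then obtain c' where "asym_bound x c'" "c' < c"
    using cInf_lessD[of "{c. asym_bound x c}" c] assms unfolding upper_limit_def by auto
  then show ?thesis using asym_bound_mono less_imp_le by blast
qed

lemma upper_limit_torus: "torus_eq x y \<Longrightarrow> upper_limit x = upper_limit y"
proof -
  assume "torus_eq x y"
  then have "asym_bound x = asym_bound y"
    using asym_bound_torus torus_eq_sym by blast
  then show ?thesis unfolding upper_limit_def by simp
qed

lemma upper_limit_well:
  assumes "i \<in> {1..m}"
  shows "upper_limit (p i) \<le> kappa V (p i) / \<eta>"
  by (rule field_le_epsilon) (rule upper_limit_le[OF asym_bound_well[OF assms]])

lemma upper_limit_cone:
  assumes "\<sigma> > 0"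
  obtains K where "K > 0"
    "\<And>x y. upper_limit x \<le> upper_limit y + sqrt (V y + 2 * \<sigma>) * norm (x - y) + K * (norm (x - y))\<^sup>2"
proof -
  obtain K where K: "K > 0" "\<And>y c x h. asym_bound y c \<Longrightarrow> h > 0 \<Longrightarrow>
    asym_bound x (c + sqrt (V y + 2 * \<sigma>) * norm (x - y) + K * (norm (x - y))\<^sup>2 + h)"
    by (rule cone_comparison[OF assms]) blast
  show thesis
  proof (rule that[OF K(1)], rule field_le_epsilon)
    fix x y and e :: real assume "e > 0"
    then have e2: "e / 2 > 0" by simp
    have "asym_bound y (upper_limit y + e / 2)"
      by (rule asym_bound_above_upper_limit) (use e2 in simp)
    from upper_limit_le[OF K(2)[OF this e2]]
    show "upper_limit x \<le> upper_limit y + sqrt (V y + 2 * \<sigma>) * norm (x - y) + K * (norm (x - y))\<^sup>2 + e"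
      by (rule order_trans) simp
  qed
qed

lemma eikonal_sub_upper_limit: "eikonal_sub V upper_limit"
  unfolding eikonal_sub_def
proof (intro allI impI)
  fix z :: "real^'n" and e :: real assume e: "e > 0"
  \<comment> \<open>Of the \<open>3\<sigma>\<close>, two come from the cone and one from the variation of \<open>V\<close>.\<close>
  define \<sigma> where "\<sigma> = (e / 2)\<^sup>2 / 3"
  have \<sigma>: "\<sigma> > 0" using e by (simp add: \<sigma>_def)
  obtain K where K: "K > 0"
    "\<And>x y. upper_limit x \<le> upper_limit y + sqrt (V y + 2 * \<sigma>) * norm (x - y) + K * (norm (x - y))\<^sup>2"
    by (rule upper_limit_cone[OF \<sigma>]) blast
  obtain d where d: "d > 0" "\<And>x. dist x z < d \<Longrightarrow> dist (V x) (V z) < \<sigma>"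
    using V_continuous \<sigma> unfolding continuous_on_iff by blast
  have sq: "sqrt (V y + 2 * \<sigma>) \<le> sqrt (V z) + e / 2" if "dist y z < d" for y
  proof -
    have "V y + 2 * \<sigma> \<le> V z + 3 * \<sigma>" using d(2)[OF that] unfolding dist_real_def by linarith
    also have "\<dots> \<le> (sqrt (V z) + e / 2)\<^sup>2"
      using V_nonneg[of z] e by (simp add: \<sigma>_def power2_sum)
    finally show ?thesis using V_nonneg[of z] e by (intro real_le_lsqrt) auto
  qed
  define \<delta> where "\<delta> = min d (e / (4 * K))"
  show "\<exists>\<delta>>0. \<forall>a\<in>ball z \<delta>. \<forall>b\<in>ball z \<delta>. \<bar>upper_limit a - upper_limit b\<bar> \<le> (sqrt (V z) + e) * norm (a - b)"
  proof (intro exI[of _ \<delta>] conjI ballI)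
    show "\<delta> > 0" using d(1) e K(1) by (simp add: \<delta>_def)
    have one: "upper_limit a \<le> upper_limit b + (sqrt (V z) + e) * norm (a - b)"
      if ab: "a \<in> ball z \<delta>" "b \<in> ball z \<delta>" for a b
    proof -
      have "dist a b < 2 * \<delta>" using ab dist_triangle2[of a b z] by (simp add: dist_commute)
      also have "\<dots> \<le> e / (2 * K)" using K(1) by (simp add: \<delta>_def min_def field_simps)
      finally have n: "K * norm (a - b) \<le> e / 2" using K(1) by (simp add: dist_norm field_simps)
      have "upper_limit a \<le> upper_limit b + sqrt (V b + 2 * \<sigma>) * norm (a - b) + (K * norm (a - b)) * norm (a - b)"
        using K(2)[of a b] by (simp add: power2_eq_square)
      also have "\<dots> \<le> upper_limit b + (sqrt (V z) + e / 2) * norm (a - b) + e / 2 * norm (a - b)"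
        using sq[of b] ab(2) n by (intro add_mono mult_right_mono order_refl) (auto simp: \<delta>_def dist_commute)
      finally show ?thesis by (simp add: distrib_right)
    qed
    fix a b assume ab: "a \<in> ball z \<delta>" "b \<in> ball z \<delta>"
    show "\<bar>upper_limit a - upper_limit b\<bar> \<le> (sqrt (V z) + e) * norm (a - b)"
      using one[OF ab] one[OF ab(2,1)] by (simp add: norm_minus_commute abs_le_iff)
  qed
qed

lemma upper_limit_le_mane:
  assumes i: "i \<in> {1..m}"
  shows "upper_limit x \<le> kappa V (p i) / \<eta> + mane V (p i) x"
proof -
  obtain M where M: "M > 0" "\<And>x. V x \<le> M" by (rule V_bounded) blast
  have "ennreal (upper_limit x - upper_limit (p i)) \<le> mane_inf V (p i) x"
  proof (rule mane_inf_greatest)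
    fix T \<gamma> assume T: "(T::real) > 0" and "\<gamma> \<in> torus_curves T (p i) x"
    then have \<gamma>: "abs_continuous_on_Icc 0 T \<gamma>" "torus_eq (\<gamma> 0) (p i)" "torus_eq (\<gamma> T) x"
      by (auto simp: torus_curves_def)
    have "ennreal (upper_limit (\<gamma> T) - upper_limit (\<gamma> 0)) \<le> action V T \<gamma>"
      by (rule eikonal_sub_action[OF \<gamma>(1) T eikonal_sub_upper_limit V_continuous V_nonneg M(2)])
    then show "ennreal (upper_limit x - upper_limit (p i)) \<le> action V T \<gamma>"
      using upper_limit_torus[OF \<gamma>(2)] upper_limit_torus[OF \<gamma>(3)] by simp
  qed
  also have "mane_inf V (p i) x = ennreal (mane V (p i) x)"
    using mane_inf_finite[OF V_per V_continuous V_nonneg, of "p i" x]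
    by (simp add: mane_def mane_inf_def)
  finally have "upper_limit x - upper_limit (p i) \<le> mane V (p i) x"
    by (subst (asm) ennreal_le_iff) (simp_all add: mane_def)
  with upper_limit_well[OF i] show ?thesis by linarith
qed

section \<open>The bound from below\<close>

text \<open>
  The test function is \<open>q - L q\<^sup>2\<close> with \<open>q\<close> the quadratic of \<open>(1 - \<theta>) A\<close>. It vanishes at the well and on the boundary of the
  ellipsoid \<open>q < 1 / L\<close> and is nonnegative in between. Hence if \<open>v\<close> has its minimum over a neighbourhood inside the
  ellipsoid, so has \<open>v\<close> minus the test function. As the gradient is \<open>(1 - 2Lq)\<close> times that of \<open>q\<close> and
  \<open>|1 - 2Lq| \<le> 1\<close>, no case distinction is needed in the inequality at the contact point. Large \<open>L\<close> makes the ellipsoid and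
  the test function small.
\<close>

lemma lower_bound_at_well:
  assumes i: "i \<in> {1..m}" and \<delta>: "\<delta> > 0" and r2: "r2 > 0"
  obtains r1 \<epsilon>0 where "r1 > 0" "r1 < r2" "\<epsilon>0 > 0"
    "\<And>\<epsilon> x. 0 < \<epsilon> \<Longrightarrow> \<epsilon> < \<epsilon>0 \<Longrightarrow> dist (p i) x < r1 \<Longrightarrow> (\<And>y. dist (p i) y < r2 \<Longrightarrow> v \<epsilon> x \<le> v \<epsilon> y) \<Longrightarrow>
        kappa V (p i) / \<eta> - \<delta> \<le> v \<epsilon> x"
proof -
  obtain A c where wr: "well_root V (p i) A c" and \<kappa>A: "kappa V (p i) = trace A" by (rule well_data[OF i])
  note c = well_rootD(2)[OF wr]
  define \<kappa> where "\<kappa> = kappa V (p i)"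
  have \<kappa>: "\<kappa> \<ge> 0" unfolding \<kappa>_def \<kappa>A by (rule trace_sym_pos_def_nonneg[OF well_rootD(1)[OF wr]])
  define \<theta> where "\<theta> = min (1/2) (\<eta> * \<delta> / (2 * (\<kappa> + 1)))"
  have \<theta>: "0 < \<theta>" "\<theta> \<le> 1/2" "\<theta> * \<kappa> \<le> \<eta> * \<delta> / 2"
  proof -
    show "0 < \<theta>" using \<eta>_pos \<delta> \<kappa> by (simp add: \<theta>_def)
    show "\<theta> \<le> 1/2" unfolding \<theta>_def by (rule min.cobounded1)
    have "\<theta> \<le> \<eta> * \<delta> / (2 * (\<kappa> + 1))" by (simp add: \<theta>_def)
    then have "\<theta> * (2 * (\<kappa> + 1)) \<le> \<eta> * \<delta>" using \<kappa> by (simp add: pos_le_divide_eq)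
    then show "\<theta> * \<kappa> \<le> \<eta> * \<delta> / 2" using \<open>0 < \<theta>\<close> by (simp add: distrib_left)
  qed
  obtain r where r: "r > 0" "\<And>x. norm (x - p i) < r \<Longrightarrow>
     \<bar>V x - (norm (A *v (x - p i)))\<^sup>2\<bar> \<le> \<theta> * (norm (A *v (x - p i)))\<^sup>2"
    using well_rootD(5)[OF wr \<theta>(1)] by blast
  obtain C where C: "C > 0" "\<And>z. norm (A *v z) \<le> C * norm z" by (rule matrix_norm_bound) blast
  define B where "B = (1 - \<theta>) *\<^sub>R A"
  define q where "q = quad B (p i)"
  define a where "a = (\<lambda>x. (norm (A *v (x - p i)))\<^sup>2)"
  have s: "1/2 \<le> 1 - \<theta>" "1 - \<theta> \<le> 2" using \<theta> by simp_all
  note sq = scaled_root_quad[OF wr s, folded B_def]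
  note tB = sq(1) and qlow = sq(4)[folded q_def] and q0 = sq(5)[folded q_def]
  have qup: "q x \<le> a x / c" for x unfolding q_def a_def by (rule sq(7))
  have trB: "trace B = (1 - \<theta>) * \<kappa>" by (simp add: sq(2) \<kappa>_def \<kappa>A)
  have trB0: "trace B \<ge> 0" unfolding trB using \<kappa> \<theta>(2) by simp
  have nB: "(norm (B *v (x - p i)))\<^sup>2 = (1 - \<theta>)\<^sup>2 * a x" for x unfolding a_def by (rule sq(3))
  have a0: "a x \<ge> 0" for x by (simp add: a_def)
  have qC: "q x \<le> C * (norm (x - p i))\<^sup>2" for x
  proof -
    let ?z = "x - p i"
    have "norm ?z * norm (A *v ?z) \<le> norm ?z * (C * norm ?z)" by (rule mult_left_mono[OF C(2)]) simp
    also have "\<dots> = C * (norm ?z)\<^sup>2" by (simp add: power2_eq_square)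
    finally show ?thesis using sq(6)[of x] unfolding q_def by linarith
  qed
  define r' where "r' = min r r2 / 2"
  have r': "r' > 0" "r' < r" "r' < r2" using r(1) r2 by (auto simp: r'_def)
  \<comment> \<open>The first summand puts the ellipsoid into the ball of radius \<open>r'\<close>, the second bounds the test function by \<open>\<delta> / 2\<close>.\<close>
  define L where "L = 4 / (c * r'\<^sup>2) + 1 / (2 * \<delta>)"
  have L: "L > 0" using c r'(1) \<delta> by (simp add: L_def add_pos_pos)
  have L1: "4 \<le> L * (c * r'\<^sup>2)"
  proof -
    have "4 / (c * r'\<^sup>2) \<le> L" using \<delta> by (simp add: L_def)
    then show ?thesis using c r'(1) by (simp add: pos_divide_le_eq)
  qed
  have L2: "1 / (4 * L) \<le> \<delta> / 2"
  proof -
    have "1 / (2 * \<delta>) \<le> L" using c by (simp add: L_def)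
    then have "1 \<le> L * (2 * \<delta>)" using pos_divide_le_eq[of "2 * \<delta>" 1 L] \<delta> by simp
    then have "1 \<le> \<delta> / 2 * (4 * L)" by (simp add: mult.commute mult.left_commute)
    then show ?thesis using pos_divide_le_eq[of "4 * L" 1 "\<delta> / 2"] L by simp
  qed
  have small: "norm (x - p i) \<le> r'" if "q x \<le> 1 / L" for x
  proof -
    have "c / 4 * (norm (x - p i))\<^sup>2 \<le> 1 / L" using qlow[of x] that by linarith
    then have "(c / 4 * (norm (x - p i))\<^sup>2) * L \<le> 1" using L by (simp only: pos_le_divide_eq)
    then have "L * c * (norm (x - p i))\<^sup>2 \<le> 4" by (simp add: mult_ac)
    also have "\<dots> \<le> L * c * r'\<^sup>2" using L1 by (simp add: mult.assoc)
    finally have "(norm (x - p i))\<^sup>2 \<le> r'\<^sup>2"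
      by (rule mult_left_le_imp_le) (use L c in simp)
    then show ?thesis by (rule power2_le_imp_le) (use r'(1) in simp)
  qed
  define r1 where "r1 = min (r2 / 2) (1 / sqrt (2 * (C * L)))"
  have CL: "C * L > 0" using C(1) L by simp
  have r1: "r1 > 0" "r1 < r2" using r2 CL by (simp_all add: r1_def)
  have near: "q x < 1 / L" if "dist (p i) x < r1" for x
  proof -
    have "norm (x - p i) \<le> 1 / sqrt (2 * (C * L))" using that by (simp add: r1_def dist_norm norm_minus_commute)
    then have "(norm (x - p i))\<^sup>2 \<le> (1 / sqrt (2 * (C * L)))\<^sup>2" by (rule power_mono) simp
    also have "\<dots> = 1 / (2 * (C * L))" using CL by (simp add: power_divide)
    finally have "C * (norm (x - p i))\<^sup>2 \<le> C * (1 / (2 * (C * L)))" by (rule mult_left_mono) (use C(1) in simp)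
    also have "\<dots> = 1 / L / 2" using C(1) by simp
    finally have "C * (norm (x - p i))\<^sup>2 \<le> 1 / L / 2" .
    moreover have "1 / L / 2 < 1 / L" using L by (simp add: field_simps)
    ultimately show ?thesis using qC[of x] by linarith
  qed
  define \<phi> where "\<phi> = (\<lambda>x. 0 + 1 * q x + (- L) * (q x)\<^sup>2)"
  have C2: "C2 \<phi>" unfolding \<phi>_def q_def by (rule polynomial_test(1)[OF tB])
  have gr: "grad \<phi> x = (1 + 2 * (- L) * q x) *\<^sub>R (B *v (x - p i))" for x
    unfolding \<phi>_def q_def by (rule polynomial_test(2)[OF tB])
  have la: "laplacian \<phi> x = 2 * (- L) * (norm (B *v (x - p i)))\<^sup>2 + (1 + 2 * (- L) * q x) * trace B" for x
    unfolding \<phi>_def q_def by (rule polynomial_test(3)[OF tB])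
  have \<phi>fac: "\<phi> x = q x * (1 - L * q x)" for x by (simp add: \<phi>_def power2_eq_square algebra_simps)
  have \<phi>nn: "0 \<le> \<phi> x" if "q x \<le> 1 / L" for x
  proof -
    have "L * q x \<le> 1" using that L by (simp add: pos_le_divide_eq mult.commute)
    then show ?thesis unfolding \<phi>fac using q0[of x] by simp
  qed
  have \<phi>up: "\<phi> x \<le> \<delta> / 2" for x
  proof -
    have "0 \<le> (1 - 2 * (L * q x))\<^sup>2" by simp
    then have "4 * L * \<phi> x \<le> 1" unfolding \<phi>fac by (simp add: power2_eq_square algebra_simps)
    then have "\<phi> x \<le> 1 / (4 * L)" using L by (simp add: pos_le_divide_eq mult.commute mult.left_commute)
    then show ?thesis using L2 by linarith
  qed
  define K where "K = 2 * L + 2 * L * trace B / c"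
  have K: "K > 0" using L trB0 c by (simp add: K_def add_pos_nonneg)
  define \<epsilon>0 where "\<epsilon>0 = \<theta> * (1 - \<theta>) / K"
  have \<epsilon>0: "\<epsilon>0 > 0" using \<theta> K by (simp add: \<epsilon>0_def)
  have cq: "continuous_on UNIV q" unfolding q_def by (rule continuous_on_quad[OF tB])
  show thesis
  proof (rule that[OF r1 \<epsilon>0])
    fix \<epsilon> x assume \<epsilon>: "0 < \<epsilon>" "\<epsilon> < \<epsilon>0" and x: "dist (p i) x < r1"
      and xmin: "\<And>y. dist (p i) y < r2 \<Longrightarrow> v \<epsilon> x \<le> v \<epsilon> y"
    define S where "S = {y. q y \<le> 1 / L}"
    have "closed S" unfolding S_def by (intro closed_Collect_le cq continuous_intros)
    moreover have "S \<subseteq> cball (p i) r'" using small by (auto simp: S_def dist_norm norm_minus_commute)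
    ultimately have compS: "compact S"
      using bounded_subset[OF bounded_cball] compact_eq_bounded_closed by blast
    have xS: "x \<in> S" using near[OF x] by (simp add: S_def)
    then have Sne: "S \<noteq> {}" by blast
    have contS: "continuous_on S (\<lambda>y. v \<epsilon> y - \<phi> y)"
      by (intro continuous_on_diff continuous_on_subset[OF v_continuous[OF \<epsilon>(1)]]
          continuous_on_subset[OF C2_continuous[OF C2]]) auto
    obtain x' where x': "x' \<in> S" "\<forall>y\<in>S. v \<epsilon> x' - \<phi> x' \<le> v \<epsilon> y - \<phi> y"
      using continuous_attains_inf[OF compS Sne contS] by blast
    \<comment> \<open>A minimum on the boundary, where the test function vanishes, is matched by one at \<open>x\<close>.\<close>
    have "\<exists>x1. q x1 < 1 / L \<and> (\<forall>y\<in>S. v \<epsilon> x1 - \<phi> x1 \<le> v \<epsilon> y - \<phi> y)"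
    proof (cases "q x' < 1 / L")
      case False
      with x'(1) have eq: "q x' = 1 / L" by (simp add: S_def)
      then have "\<phi> x' = 0" unfolding \<phi>fac using L by simp
      moreover have "norm (x' - p i) \<le> r'" by (rule small) (simp add: eq)
      then have "v \<epsilon> x \<le> v \<epsilon> x'" using r'(3) by (intro xmin) (simp add: dist_norm norm_minus_commute)
      moreover have "0 \<le> \<phi> x" using near[OF x] by (intro \<phi>nn) simp
      ultimately have "v \<epsilon> x - \<phi> x \<le> v \<epsilon> x' - \<phi> x'" by linarith
      with x'(2) have "\<forall>y\<in>S. v \<epsilon> x - \<phi> x \<le> v \<epsilon> y - \<phi> y" using order_trans by blast
      then show ?thesis using near[OF x] by blast
    qed (use x'(2) in blast)
    then obtain x1 where x1: "q x1 < 1 / L" "\<And>y. y \<in> S \<Longrightarrow> v \<epsilon> x1 - \<phi> x1 \<le> v \<epsilon> y - \<phi> y" by blast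
    have "open {y. q y < 1 / L}" by (intro open_Collect_less cq continuous_intros)
    from eventually_nhds_in_open[OF this, of x1] x1(1)
    have "\<forall>\<^sub>F y in nhds x1. y \<in> {y. q y < 1 / L}" by simp
    then have ev: "\<forall>\<^sub>F y in nhds x1. v \<epsilon> y - \<phi> y \<ge> v \<epsilon> x1 - \<phi> x1"
      by (rule eventually_mono) (simp add: x1(2) S_def)
    have test: "V x1 \<le> \<epsilon> * \<eta> * v \<epsilon> x1 - \<epsilon> * laplacian \<phi> x1 + (norm (grad \<phi> x1))\<^sup>2"
      by (rule supersolution_test[OF \<epsilon>(1) C2 ev])
    have Lq: "0 \<le> L * q x1" "L * q x1 \<le> 1"
      using q0[of x1] L x1(1) by (simp_all add: pos_less_divide_eq mult.commute less_imp_le)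
    have g1: "(norm (grad \<phi> x1))\<^sup>2 \<le> (1 - \<theta>)\<^sup>2 * a x1"
    proof -
      have "\<bar>1 + 2 * (- L) * q x1\<bar> \<le> 1" using Lq by (simp add: abs_le_iff)
      then have "(1 + 2 * (- L) * q x1)\<^sup>2 \<le> 1" by (simp add: abs_square_le_1)
      then have "(1 + 2 * (- L) * q x1)\<^sup>2 * ((1 - \<theta>)\<^sup>2 * a x1) \<le> 1 * ((1 - \<theta>)\<^sup>2 * a x1)"
        using a0 by (intro mult_right_mono) auto
      then show ?thesis unfolding gr norm_scaleR power_mult_distrib nB by simp
    qed
    have l1: "\<epsilon> * trace B - \<theta> * (1 - \<theta>) * a x1 \<le> \<epsilon> * laplacian \<phi> x1"
    proof -
      have "(1 - \<theta>)\<^sup>2 \<le> 1" using \<theta> by (simp add: abs_square_le_1[symmetric] power_le_one)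
      then have "(1 - \<theta>)\<^sup>2 * a x1 \<le> 1 * a x1" using a0 by (intro mult_right_mono)
      then have "2 * L * ((1 - \<theta>)\<^sup>2 * a x1) \<le> 2 * L * a x1" using L by simp
      moreover have "2 * L * q x1 * trace B \<le> 2 * L * (a x1 / c) * trace B"
        using qup L trB0 by (intro mult_right_mono mult_left_mono) auto
      moreover have "K * a x1 = 2 * L * a x1 + 2 * L * (a x1 / c) * trace B"
        by (simp add: K_def distrib_right)
      ultimately have "2 * L * ((1 - \<theta>)\<^sup>2 * a x1) + 2 * L * q x1 * trace B \<le> K * a x1" by linarith
      moreover have "laplacian \<phi> x1 = trace B - (2 * L * ((1 - \<theta>)\<^sup>2 * a x1) + 2 * L * q x1 * trace B)"
        unfolding la nB by (simp add: algebra_simps)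
      ultimately have "trace B - K * a x1 \<le> laplacian \<phi> x1" by linarith
      then have "\<epsilon> * (trace B - K * a x1) \<le> \<epsilon> * laplacian \<phi> x1" using \<epsilon>(1) by simp
      moreover have "\<epsilon> * (K * a x1) \<le> \<epsilon>0 * (K * a x1)"
        by (rule mult_right_mono[OF less_imp_le[OF \<epsilon>(2)]]) (use K a0[of x1] in simp)
      moreover have "\<epsilon>0 * (K * a x1) = \<theta> * (1 - \<theta>) * a x1" using K by (simp add: \<epsilon>0_def)
      ultimately show ?thesis by (simp add: right_diff_distrib)
    qed
    have V1: "(1 - \<theta>) * a x1 \<le> V x1"
    proof -
      have "norm (x1 - p i) \<le> r'" using x1(1) by (intro small) simp
      then have "\<bar>V x1 - a x1\<bar> \<le> \<theta> * a x1" unfolding a_def using r'(2) by (intro r(2)) simp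
      then have "a x1 - \<theta> * a x1 \<le> V x1" by linarith
      then show ?thesis by (simp add: left_diff_distrib)
    qed
    have "(1 - \<theta>) * a x1 = (1 - \<theta>)\<^sup>2 * a x1 + \<theta> * (1 - \<theta>) * a x1"
      by (simp add: power2_eq_square algebra_simps)
    with test g1 l1 V1 have "\<epsilon> * trace B \<le> \<epsilon> * \<eta> * v \<epsilon> x1" by linarith
    then have "trace B \<le> \<eta> * v \<epsilon> x1" using \<epsilon>(1) by (simp add: mult.assoc)
    moreover have "\<kappa> - \<eta> * \<delta> / 2 \<le> trace B" using \<theta>(3) by (simp add: trB left_diff_distrib)
    ultimately have "\<kappa> - \<eta> * \<delta> / 2 \<le> \<eta> * v \<epsilon> x1" by linarith
    then have "(\<kappa> - \<eta> * \<delta> / 2) / \<eta> \<le> v \<epsilon> x1" using \<eta>_pos by (simp add: pos_divide_le_eq mult.commute)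
    moreover have "(\<kappa> - \<eta> * \<delta> / 2) / \<eta> = \<kappa> / \<eta> - \<delta> / 2" using \<eta>_pos by (simp add: diff_divide_distrib)
    moreover have "v \<epsilon> x1 - \<phi> x1 \<le> v \<epsilon> x - \<phi> x" by (rule x1(2)[OF xS])
    moreover have "0 \<le> \<phi> x1" using x1(1) by (intro \<phi>nn) simp
    moreover have "0 \<le> \<phi> x" using near[OF x] by (intro \<phi>nn) simp
    ultimately show "kappa V (p i) / \<eta> - \<delta> \<le> v \<epsilon> x"
      unfolding \<kappa>_def[symmetric] using \<phi>up[of x1] by linarith
  qed
qed

lemma V_positive_away_from_zeros:
  assumes "r > 0"
  obtains c where "c > 0" "\<And>x. (\<And>z. V z = 0 \<Longrightarrow> r \<le> dist z x) \<Longrightarrow> c \<le> V x"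
proof -
  define S where "S = cbox 0 (vec 1) \<inter> (\<Inter>z\<in>{z. V z = 0}. {x. r \<le> dist z x})"
  have "closed (\<Inter>z\<in>{z. V z = 0}. {x. r \<le> dist z x})"
    by (intro closed_INT ballI closed_Collect_le continuous_intros)
  then have S: "compact S" unfolding S_def by (rule compact_Int_closed[OF compact_cbox])
  obtain c where c: "c > 0" "\<And>x. x \<in> S \<Longrightarrow> c \<le> V x"
  proof (cases "S = {}")
    case True
    then show ?thesis using that[of 1] by simp
  next
    case False
    obtain x0 where x0: "x0 \<in> S" "\<forall>y\<in>S. V x0 \<le> V y"
      using continuous_attains_inf[OF S False continuous_on_subset[OF V_continuous subset_UNIV]] by blast
    have "V x0 \<noteq> 0"
    proof
      assume "V x0 = 0"
      then have "r \<le> dist x0 x0" using x0(1) unfolding S_def by blast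
      with assms show False by simp
    qed
    then have "V x0 > 0" using V_nonneg[of x0] by linarith
    with x0(2) show ?thesis using that by blast
  qed
  show thesis
  proof (rule that[OF c(1)])
    fix x assume far: "\<And>z. V z = 0 \<Longrightarrow> r \<le> dist z x"
    obtain y :: "real^'n" where y: "y \<in> cbox 0 (vec 1)" "torus_eq y x" by (rule torus_representative)
    have "r \<le> dist z y" if z: "V z = 0" for z
    proof -
      have "torus_eq (z + (x - y)) z" by (rule torus_eq_shift[OF torus_eq_sym[OF y(2)]])
      then have "V (z + (x - y)) = 0" using torus_funD[OF V_per] z by metis
      then have "r \<le> dist (z + (x - y)) x" by (rule far)
      then show ?thesis by (simp add: dist_norm algebra_simps)
    qed
    then have "y \<in> S" using y(1) by (simp add: S_def)
    then show "c \<le> V x" using c(2) torus_funD[OF V_per y(2)] by metis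
  qed
qed

lemma lower_bound_at_all_wells:
  assumes \<delta>: "\<delta> > 0" and r2: "r2 > 0"
  obtains r1 \<epsilon>0 where "r1 > 0" "r1 < r2" "\<epsilon>0 > 0"
    "\<And>i \<epsilon> x. i \<in> {1..m} \<Longrightarrow> 0 < \<epsilon> \<Longrightarrow> \<epsilon> < \<epsilon>0 \<Longrightarrow> dist (p i) x < r1 \<Longrightarrow>
        (\<And>y. dist (p i) y < r2 \<Longrightarrow> v \<epsilon> x \<le> v \<epsilon> y) \<Longrightarrow> kappa V (p i) / \<eta> - \<delta> \<le> v \<epsilon> x"
proof -
  define good where "good = (\<lambda>i r. \<forall>\<epsilon> x. 0 < \<epsilon> \<and> \<epsilon> < r \<and> dist (p i) x < r \<and> (\<forall>y. dist (p i) y < r2 \<longrightarrow> v \<epsilon> x \<le> v \<epsilon> y)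
      \<longrightarrow> kappa V (p i) / \<eta> - \<delta> \<le> v \<epsilon> x)"
  have "\<exists>r>0. r < r2 \<and> good i r" if i: "i \<in> {1..m}" for i
  proof -
    obtain r1 \<epsilon>0 where *: "r1 > 0" "r1 < r2" "\<epsilon>0 > 0"
      "\<And>\<epsilon> x. 0 < \<epsilon> \<Longrightarrow> \<epsilon> < \<epsilon>0 \<Longrightarrow> dist (p i) x < r1 \<Longrightarrow> (\<And>y. dist (p i) y < r2 \<Longrightarrow> v \<epsilon> x \<le> v \<epsilon> y) \<Longrightarrow>
        kappa V (p i) / \<eta> - \<delta> \<le> v \<epsilon> x"
      using lower_bound_at_well[OF i \<delta> r2] by blast
    have "good i (min r1 \<epsilon>0)" unfolding good_def by (intro allI impI *(4)) auto
    then show ?thesis using *(1-3) by (intro exI[of _ "min r1 \<epsilon>0"]) auto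
  qed
  then obtain R where R: "\<And>i. i \<in> {1..m} \<Longrightarrow> R i > 0 \<and> R i < r2 \<and> good i (R i)" by metis
  define r where "r = Min (R ` {1..m})"
  have ne: "finite (R ` {1..m})" "R ` {1..m} \<noteq> {}" using m_pos by auto
  have rle: "r \<le> R i" if "i \<in> {1..m}" for i unfolding r_def using ne that by (intro Min_le) auto
  have r0: "r > 0" unfolding r_def using Min_gr_iff[OF ne] R by auto
  have "1 \<in> {1..m}" using m_pos by simp
  then have rr2: "r < r2" using rle[of 1] R[of 1] by linarith
  show thesis
  proof (rule that[OF r0 rr2 r0])
    fix i \<epsilon> x assume i: "i \<in> {1..m}" and *: "0 < \<epsilon>" "\<epsilon> < r" "dist (p i) x < r"
      "\<And>y. dist (p i) y < r2 \<Longrightarrow> v \<epsilon> x \<le> v \<epsilon> y"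
    have "good i (R i)" using R[OF i] by blast
    moreover have "\<epsilon> < R i" "dist (p i) x < R i" using rle[OF i] * by linarith+
    ultimately show "kappa V (p i) / \<eta> - \<delta> \<le> v \<epsilon> x" unfolding good_def using *(1,4) by blast
  qed
qed

text \<open>
  The three small parameters are chosen in the order \<open>\<theta>\<close>, \<open>s\<close>, \<open>\<epsilon>\<close>: \<open>\<theta>\<close> opens a gap \<open>\<theta> c\<^sub>0\<close> in the equation away from the
  zeros of \<open>V\<close>, a large \<open>s\<close> keeps the two points of the minimum close together, and a small \<open>\<epsilon>\<close>
  makes the terms of order \<open>\<epsilon>\<close>, among them the Laplacian of the penalty, smaller than the gap.
\<close>

lemma lower_comparison:
  fixes W :: "real^'n \<Rightarrow> real"
  assumes per: "torus_fun W" and eik: "eikonal_sub V W"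
    and wells: "\<And>i. i \<in> {1..m} \<Longrightarrow> W (p i) \<le> kappa V (p i) / \<eta>" and h: "h > 0"
  obtains \<epsilon>0 where "\<epsilon>0 > 0" "\<And>\<epsilon> x. 0 < \<epsilon> \<Longrightarrow> \<epsilon> < \<epsilon>0 \<Longrightarrow> W x - h \<le> v \<epsilon> x"
proof -
  \<comment> \<open>Both the threshold and the factor \<open>1 - \<theta>\<close> cost \<open>k\<close>; this is paid at the well and at \<open>x\<close>, and the bound at the well costs another \<open>k\<close>.\<close>
  define k where "k = h / 5"
  have k: "k > 0" using h by (simp add: k_def)
  have contW: "continuous_on UNIV W" by (rule eikonal_sub_continuous[OF eik V_nonneg])
  obtain B where B: "\<And>x. \<bar>W x\<bar> \<le> B" by (rule torus_fun_bounded[OF per contW]) blast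
  have B0: "B \<ge> 0" using B[of 0] by linarith

  define C where "C = (\<lambda>i. W (p i)) ` {1..m}"
  have finC: "finite C" by (simp add: C_def)
  have cardC: "real (card C) \<le> real m" using card_image_le[of "{1..m}" "\<lambda>i. W (p i)"] by (simp add: C_def)
  define h' where "h' = k / real m"
  have mpos: "real m > 0" using m_pos by simp
  have h': "h' > 0" using k mpos by (simp add: h'_def)
  obtain \<tau> where \<tau>: "\<And>s t. \<bar>\<tau> s - \<tau> t\<bar> \<le> \<bar>s - t\<bar>" "\<And>s. \<bar>\<tau> s - s\<bar> \<le> real (card C) * h'"
     "\<And>c s. c \<in> C \<Longrightarrow> \<bar>s - c\<bar> \<le> h' \<Longrightarrow> \<tau> s = \<tau> c"
    using soft_threshold[OF finC h'] by blast
  have \<tau>k: "\<bar>\<tau> s - s\<bar> \<le> k" for s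
  proof -
    have "real (card C) * h' \<le> real m * h'" using cardC h' by (intro mult_right_mono) auto
    also have "\<dots> = k" using mpos by (simp add: h'_def)
    finally show ?thesis using \<tau>(2)[of s] by linarith
  qed
  have eik\<tau>: "eikonal_sub V (\<lambda>x. \<tau> (W x))" by (rule eikonal_sub_contraction[OF eik \<tau>(1)])

  define \<theta> where "\<theta> = min (1/2) (k / (B + k))"
  have Bk: "B + k > 0" using B0 k by linarith
  have "\<theta> > 0" using k Bk by (simp add: \<theta>_def)
  moreover have "\<theta> \<le> 1/2" unfolding \<theta>_def by (rule min.cobounded1)
  moreover have "\<theta> * (B + k) \<le> k"
  proof -
    have "\<theta> \<le> k / (B + k)" by (simp add: \<theta>_def)
    then show ?thesis using Bk by (simp add: pos_le_divide_eq)
  qed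
  ultimately have \<theta>: "\<theta> > 0" "\<theta> \<le> 1/2" "\<theta> * (B + k) \<le> k" by simp_all
  define t where "t = 1 - \<theta>"
  have t: "t \<ge> 0" "t < 1" using \<theta> by (simp_all add: t_def)
  have t\<tau>: "\<bar>t * \<tau> (W x) - W x\<bar> \<le> 2 * k" for x
  proof -
    have "\<bar>\<tau> (W x)\<bar> \<le> B + k" using \<tau>k[of "W x"] B[of x] by linarith
    then have "\<theta> * \<bar>\<tau> (W x)\<bar> \<le> \<theta> * (B + k)" by (rule mult_left_mono) (use \<theta>(1) in simp)
    also have "\<dots> \<le> k" by (rule \<theta>(3))
    finally have "\<bar>\<theta> * \<tau> (W x)\<bar> \<le> k" using \<theta>(1) by (simp add: abs_mult)
    moreover have "t * \<tau> (W x) = \<tau> (W x) - \<theta> * \<tau> (W x)" by (simp add: t_def left_diff_distrib)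
    ultimately show ?thesis using \<tau>k[of "W x"] by linarith
  qed

  obtain r2 where r2: "r2 > 0" "\<And>x y. norm (x - y) < r2 \<Longrightarrow> \<bar>W x - W y\<bar> < h'"
    by (rule torus_fun_uniformly_continuous[OF per contW h']) blast
  have flat: "\<tau> (W y) = \<tau> (W (p i))" if "i \<in> {1..m}" "torus_eq z (p i)" "dist z y < r2" for i y z
  proof -
    have "\<bar>W y - W z\<bar> < h'" using that(3) by (intro r2(2)) (simp add: dist_norm norm_minus_commute)
    moreover have "W z = W (p i)" by (rule torus_funD[OF per that(2)])
    ultimately show ?thesis using that(1) by (intro \<tau>(3)) (auto simp: C_def)
  qed
  obtain r1 \<epsilon>w where r1: "r1 > 0" "r1 < r2" and \<epsilon>w: "\<epsilon>w > 0"
    "\<And>i \<epsilon> x. i \<in> {1..m} \<Longrightarrow> 0 < \<epsilon> \<Longrightarrow> \<epsilon> < \<epsilon>w \<Longrightarrow> dist (p i) x < r1 \<Longrightarrow>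
        (\<And>y. dist (p i) y < r2 \<Longrightarrow> v \<epsilon> x \<le> v \<epsilon> y) \<Longrightarrow> kappa V (p i) / \<eta> - k \<le> v \<epsilon> x"
    using lower_bound_at_all_wells[OF k r2(1)] by blast
  obtain c0 where c0: "c0 > 0" "\<And>x. (\<And>z. V z = 0 \<Longrightarrow> r1 \<le> dist z x) \<Longrightarrow> c0 \<le> V x"
    using V_positive_away_from_zeros[OF r1(1)] by blast
  have \<omega>: "\<theta> * c0 / 2 > 0" using \<theta>(1) c0(1) by simp
  obtain dV where dV: "dV > 0" "\<And>x y. norm (x - y) < dV \<Longrightarrow> \<bar>V x - V y\<bar> < \<theta> * c0 / 2"
    by (rule torus_fun_uniformly_continuous[OF V_per V_continuous \<omega>]) blast
  obtain M where M: "M > 0" "\<And>x. V x \<le> M" by (rule V_bounded) blast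
  obtain Mv \<epsilon>v where Mv: "Mv > 0" "\<epsilon>v > 0" "\<And>\<epsilon> x. 0 < \<epsilon> \<Longrightarrow> \<epsilon> < \<epsilon>v \<Longrightarrow> v \<epsilon> x \<le> Mv"
    by (rule v_uniformly_bounded) blast

  define \<mu> where "\<mu> = min dV (r2 - r1)"
  have \<mu>: "\<mu> > 0" "\<mu> \<le> dV" "\<mu> \<le> r2 - r1" using dV(1) r1 by (auto simp: \<mu>_def)
  \<comment> \<open>The minimising points then have distance at most \<open>sqrt M / (2 s) < \<mu>\<close>.\<close>
  define s where "s = (sqrt M + 1) / (2 * \<mu>)"
  have sM: "sqrt M \<ge> 0" using M(1) by simp
  have s: "s > 0" using sM \<mu>(1) by (simp add: s_def add_nonneg_pos)
  have s\<mu>: "2 * s * \<mu> = sqrt M + 1" using \<mu>(1) by (simp add: s_def)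
  define N where "N = \<eta> * Mv + 2 * s * real CARD('n)"
  have N: "N > 0" unfolding N_def using \<eta>_pos Mv(1) s by (intro add_pos_nonneg) auto
  define \<epsilon>0 where "\<epsilon>0 = min (min \<epsilon>w \<epsilon>v) (\<theta> * c0 / 2 / N)"
  have \<epsilon>0: "\<epsilon>0 > 0" using \<epsilon>w(1) Mv(2) \<omega> N by (simp add: \<epsilon>0_def)

  show thesis
  proof (rule that[OF \<epsilon>0])
    fix \<epsilon> x assume \<epsilon>: "0 < \<epsilon>" "\<epsilon> < \<epsilon>0"
    have \<epsilon>wv: "\<epsilon> < \<epsilon>w" "\<epsilon> < \<epsilon>v" "\<epsilon> < \<theta> * c0 / 2 / N" using \<epsilon>(2) by (simp_all add: \<epsilon>0_def)
    have gper: "torus_fun (\<lambda>x. t * \<tau> (W x))" using per unfolding torus_fun_def by metis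
    have gcont: "continuous_on UNIV (\<lambda>x. t * \<tau> (W x))"
      by (intro continuous_on_mult continuous_on_const eikonal_sub_continuous[OF eik\<tau> V_nonneg])
    obtain x0 z0 where min: "\<And>x z. v \<epsilon> x0 - t * \<tau> (W (x0 + z0)) + s * (norm z0)\<^sup>2
        \<le> v \<epsilon> x - t * \<tau> (W (x + z)) + s * (norm z)\<^sup>2"
      by (rule doubling_min_exists[OF v_torus[OF \<epsilon>(1)] v_continuous[OF \<epsilon>(1)] gper gcont s]) blast
    define y0 where "y0 = x0 + z0"
    have slope: "2 * s * norm (x0 - y0) \<le> t * sqrt (V y0)"
    proof (rule eikonal_sub_penalised_max[OF eik\<tau> t(1) s _ V_nonneg])
      fix y'
      show "t * \<tau> (W y') - s * (norm (x0 - y'))\<^sup>2 \<le> t * \<tau> (W y0) - s * (norm (x0 - y0))\<^sup>2"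
        using min[of x0 "y' - x0"] by (simp add: y0_def norm_minus_commute)
    qed
    have nz: "norm (x0 - y0) = norm z0" by (simp add: y0_def)
    have z\<mu>: "norm z0 < \<mu>"
    proof -
      have "t * sqrt (V y0) \<le> 1 * sqrt M"
        using t M(2)[of y0] V_nonneg[of y0] by (intro mult_mono) auto
      then have "(2 * s) * norm z0 < (2 * s) * \<mu>" using slope nz s\<mu> by simp
      then show ?thesis using s by simp
    qed
    have low: "- 3 * k \<le> v \<epsilon> x0 - t * \<tau> (W y0) + s * (norm z0)\<^sup>2"
    proof (cases "\<exists>z. V z = 0 \<and> dist z x0 < r1")
      case True
      then obtain z i where z: "dist z x0 < r1" "i \<in> {1..m}" "torus_eq z (p i)" using V_zero by blast
      have "dist z y0 \<le> dist z x0 + dist x0 y0" by (rule dist_triangle)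
      also have "\<dots> < r2" using z(1) z\<mu> \<mu>(3) nz by (simp add: dist_norm)
      finally have \<tau>y: "\<tau> (W y0) = \<tau> (W (p i))" by (rule flat[OF z(2,3)])
      \<comment> \<open>The bound is available at the representative \<open>p i\<close> of the zero \<open>z\<close>.\<close>
      define x1 where "x1 = x0 + (p i - z)"
      have "torus_eq x1 x0" unfolding x1_def by (rule torus_eq_shift[OF torus_eq_sym[OF z(3)]])
      then have vx1: "v \<epsilon> x1 = v \<epsilon> x0" by (rule torus_funD[OF v_torus[OF \<epsilon>(1)]])
      have "kappa V (p i) / \<eta> - k \<le> v \<epsilon> x1"
      proof (rule \<epsilon>w(2)[OF z(2) \<epsilon>(1) \<epsilon>wv(1)])
        show "dist (p i) x1 < r1" using z(1) by (simp add: x1_def dist_norm algebra_simps)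
        fix y assume "dist (p i) y < r2"
        then have "\<tau> (W y) = \<tau> (W (p i))" by (rule flat[OF z(2) torus_eq_refl])
        then have "v \<epsilon> x0 + s * (norm z0)\<^sup>2 \<le> v \<epsilon> y"
          using min[of y 0] \<tau>y by (simp add: y0_def)
        moreover have "0 \<le> s * (norm z0)\<^sup>2" using s by simp
        ultimately show "v \<epsilon> x1 \<le> v \<epsilon> y" unfolding vx1 by linarith
      qed
      moreover have "t * \<tau> (W y0) \<le> kappa V (p i) / \<eta> + 2 * k"
        using t\<tau>[of "p i"] wells[OF z(2)] unfolding \<tau>y by linarith
      moreover have "0 \<le> s * (norm z0)\<^sup>2" using s by simp
      ultimately show ?thesis unfolding vx1 by linarith
    next
      case False
      have Vx0: "c0 \<le> V x0" by (rule c0(2)) (use False in force)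
      have tI: "transpose (mat 1 :: real^'n^'n) = mat 1" by simp
      define \<phi> where "\<phi> = (\<lambda>x. 0 + (- 2 * s) * quad (mat 1) y0 x + 0 * (quad (mat 1) y0 x)\<^sup>2)"
      have \<phi>eq: "\<phi> x = - s * (norm (x - y0))\<^sup>2" for x
        by (simp add: \<phi>_def quad_def power2_norm_eq_inner)
      have C2: "C2 \<phi>" unfolding \<phi>_def by (rule polynomial_test(1)[OF tI])
      have "grad \<phi> x0 = (- 2 * s + 2 * 0 * quad (mat 1) y0 x0) *\<^sub>R (mat 1 *v (x0 - y0))"
        unfolding \<phi>_def by (rule polynomial_test(2)[OF tI])
      then have "norm (grad \<phi> x0) = 2 * s * norm (x0 - y0)" using s by simp
      then have gr: "(norm (grad \<phi> x0))\<^sup>2 \<le> t\<^sup>2 * V y0"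
      proof -
        have "(2 * s * norm (x0 - y0))\<^sup>2 \<le> (t * sqrt (V y0))\<^sup>2"
          by (rule power_mono[OF slope]) (use s in simp)
        then show ?thesis using \<open>norm (grad \<phi> x0) = _\<close> V_nonneg[of y0] by (simp add: power_mult_distrib)
      qed
      have "laplacian \<phi> x0 = 2 * 0 * (norm (mat 1 *v (x0 - y0)))\<^sup>2 + (- 2 * s + 2 * 0 * quad (mat 1) y0 x0) * trace (mat 1 :: real^'n^'n)"
        unfolding \<phi>_def by (rule polynomial_test(3)[OF tI])
      then have la: "laplacian \<phi> x0 = - 2 * s * real CARD('n)" by (simp add: trace_I)
      have "v \<epsilon> x0 - \<phi> x0 \<le> v \<epsilon> y - \<phi> y" for y
        using min[of y "y0 - y"] unfolding \<phi>eq nz by (simp add: y0_def norm_minus_commute)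
      then have "V x0 \<le> \<epsilon> * \<eta> * v \<epsilon> x0 - \<epsilon> * laplacian \<phi> x0 + (norm (grad \<phi> x0))\<^sup>2"
        by (intro supersolution_test[OF \<epsilon>(1) C2] always_eventually allI)
      also have "\<epsilon> * \<eta> * v \<epsilon> x0 - \<epsilon> * laplacian \<phi> x0 \<le> \<epsilon> * N"
      proof -
        have "\<epsilon> * (\<eta> * v \<epsilon> x0) \<le> \<epsilon> * (\<eta> * Mv)"
          using \<epsilon>(1) \<eta>_pos Mv(3)[OF \<epsilon>(1) \<epsilon>wv(2)] by (intro mult_left_mono) auto
        then show ?thesis unfolding la N_def by (simp add: algebra_simps)
      qed
      also have "\<epsilon> * N < \<theta> * c0 / 2" using \<epsilon>wv(3) N by (simp only: pos_less_divide_eq)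
      finally have A: "V x0 < \<theta> * c0 / 2 + t\<^sup>2 * V y0" using gr by linarith
      have "\<bar>V x0 - V y0\<bar> < \<theta> * c0 / 2" by (rule dV(2)) (use z\<mu> \<mu>(2) nz in linarith)
      then have "V y0 \<le> V x0 + \<theta> * c0 / 2" by linarith
      then have "t\<^sup>2 * V y0 \<le> t\<^sup>2 * (V x0 + \<theta> * c0 / 2)" by (rule mult_left_mono) simp
      also have "\<dots> \<le> t * (V x0 + \<theta> * c0 / 2)"
      proof (rule mult_right_mono)
        show "t\<^sup>2 \<le> t" using t by (simp add: power2_eq_square mult_left_le_one_le)
        show "0 \<le> V x0 + \<theta> * c0 / 2" using V_nonneg[of x0] \<omega> by linarith
      qed
      also have "\<dots> = V x0 - \<theta> * V x0 + \<theta> * c0 / 2 - \<theta> * (\<theta> * c0 / 2)"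
        by (simp add: t_def left_diff_distrib distrib_left)
      finally have "V x0 < \<theta> * c0 + V x0 - \<theta> * V x0 - \<theta> * (\<theta> * c0 / 2)" using A by linarith
      moreover have "\<theta> * c0 \<le> \<theta> * V x0" using Vx0 \<theta>(1) by simp
      moreover have "0 < \<theta> * (\<theta> * c0 / 2)" using \<theta>(1) \<omega> by simp
      ultimately show ?thesis by linarith
    qed
    have "- 3 * k \<le> v \<epsilon> x - t * \<tau> (W x)" using low min[of x 0] by (simp add: y0_def)
    then show "W x - h \<le> v \<epsilon> x" using t\<tau>[of x] k_def by linarith
  qed
qed

section \<open>Uniform convergence\<close>

text \<open>
  The relaxed limit already controls \<open>v\<close> on a ball around every point, and finitely many of these balls cover the
  unit cube.
\<close>

lemma upper_comparison:
  fixes U :: "real^'n \<Rightarrow> real"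
  assumes per: "torus_fun U" and cont: "continuous_on UNIV U"
    and le: "\<And>x. upper_limit x \<le> U x" and h: "h > 0"
  obtains \<epsilon>0 where "\<epsilon>0 > 0" "\<And>\<epsilon> x. 0 < \<epsilon> \<Longrightarrow> \<epsilon> < \<epsilon>0 \<Longrightarrow> v \<epsilon> x \<le> U x + h"
proof -
  have h2: "h / 2 > 0" using h by simp
  obtain d where d: "d > 0" "\<And>x y. norm (x - y) < d \<Longrightarrow> \<bar>U x - U y\<bar> < h / 2"
    by (rule torus_fun_uniformly_continuous[OF per cont h2]) blast
  have "\<exists>r>0. \<forall>\<epsilon> y. 0 < \<epsilon> \<and> \<epsilon> < r \<and> dist x y < r \<longrightarrow> v \<epsilon> y \<le> U x + h / 2" for x
    using asym_bound_above_upper_limit[of x "U x + h / 2"] le[of x] h2 unfolding asym_bound_def by auto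
  then obtain r where r: "\<And>x. r x > 0" "\<And>x \<epsilon> y. 0 < \<epsilon> \<Longrightarrow> \<epsilon> < r x \<Longrightarrow> dist x y < r x \<Longrightarrow> v \<epsilon> y \<le> U x + h / 2"
    by metis
  let ?Q = "cbox (0 :: real^'n) (vec 1)"
  have "?Q \<subseteq> (\<Union>x\<in>?Q. ball x (min (r x) d))"
  proof
    fix x assume "x \<in> ?Q"
    moreover have "x \<in> ball x (min (r x) d)" using r(1)[of x] d(1) by simp
    ultimately show "x \<in> (\<Union>x\<in>?Q. ball x (min (r x) d))" by blast
  qed
  then obtain D where D: "D \<subseteq> ?Q" "finite D" "?Q \<subseteq> (\<Union>x\<in>D. ball x (min (r x) d))"
    by (rule compactE_image[OF compact_cbox open_ball])
  obtain y0 :: "real^'n" where "y0 \<in> ?Q" by (rule torus_representative)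
  then have "D \<noteq> {}" using D(3) by blast
  then have ne: "finite (r ` D)" "r ` D \<noteq> {}" using D(2) by auto
  define \<epsilon>0 where "\<epsilon>0 = Min (r ` D)"
  have \<epsilon>0: "\<epsilon>0 > 0" unfolding \<epsilon>0_def using Min_gr_iff[OF ne] r(1) by auto
  show thesis
  proof (rule that[OF \<epsilon>0])
    fix \<epsilon> x assume \<epsilon>: "0 < \<epsilon>" "\<epsilon> < \<epsilon>0"
    obtain y :: "real^'n" where y: "y \<in> ?Q" "torus_eq y x" by (rule torus_representative)
    then obtain z where z: "z \<in> D" "y \<in> ball z (min (r z) d)" using D(3) by blast
    have "\<epsilon>0 \<le> r z" unfolding \<epsilon>0_def using ne z(1) by (intro Min_le) auto
    then have "v \<epsilon> y \<le> U z + h / 2" using \<epsilon> z(2) by (intro r(2)) auto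
    moreover have "\<bar>U z - U y\<bar> < h / 2" using z(2) by (intro d(2)) (simp add: dist_norm)
    moreover have "v \<epsilon> y = v \<epsilon> x" by (rule torus_funD[OF v_torus[OF \<epsilon>(1)] y(2)])
    moreover have "U y = U x" by (rule torus_funD[OF per y(2)])
    ultimately show "v \<epsilon> x \<le> U x + h" by linarith
  qed
qed

theorem vanishing_viscosity_limit:
  "uniform_limit UNIV v (\<lambda>y. MIN i\<in>{1..m}. kappa V (p i) / \<eta> + mane V (p i) y) (at_right 0)"
proof -
  define U where "U = (\<lambda>y. MIN i\<in>{1..m}. kappa V (p i) / \<eta> + mane V (p i) y)"
  have ne: "finite {1..m}" "{1..m} \<noteq> {}" using m_pos by auto
  have eik: "eikonal_sub V U"
    unfolding U_def
  proof (rule eikonal_sub_Min[OF ne])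
    fix i
    show "eikonal_sub V (\<lambda>y. kappa V (p i) / \<eta> + mane V (p i) y)"
      by (rule eikonal_sub_contraction[OF eikonal_sub_mane[OF V_per V_continuous V_nonneg]]) simp
  qed
  have per: "torus_fun U"
    unfolding torus_fun_def
  proof (intro allI impI)
    fix a b :: "real^'n" assume "torus_eq a b"
    then have "mane V (p i) a = mane V (p i) b" for i by (rule torus_funD[OF torus_fun_mane])
    then show "U a = U b" unfolding U_def by simp
  qed
  have wells: "U (p i) \<le> kappa V (p i) / \<eta>" if i: "i \<in> {1..m}" for i
  proof -
    have "U (p i) \<le> kappa V (p i) / \<eta> + mane V (p i) (p i)"
      unfolding U_def using i by (intro Min_le) auto
    also have "mane V (p i) (p i) = 0"
      using V_zero[of "p i"] i torus_eq_refl by (intro mane_self_zero V_nonneg) blast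
    finally show ?thesis by simp
  qed
  have le: "upper_limit x \<le> U x" for x
    unfolding U_def using ne upper_limit_le_mane by (subst Min_ge_iff) auto
  have cont: "continuous_on UNIV U" by (rule eikonal_sub_continuous[OF eik V_nonneg])
  show ?thesis
    unfolding uniform_limit_iff U_def[symmetric]
  proof (intro allI impI)
    fix e :: real assume "e > 0"
    then have e2: "e / 2 > 0" by simp
    obtain \<epsilon>1 where \<epsilon>1: "\<epsilon>1 > 0" "\<And>\<epsilon> x. 0 < \<epsilon> \<Longrightarrow> \<epsilon> < \<epsilon>1 \<Longrightarrow> U x - e / 2 \<le> v \<epsilon> x"
      using lower_comparison[OF per eik wells e2] by blast
    obtain \<epsilon>2 where \<epsilon>2: "\<epsilon>2 > 0" "\<And>\<epsilon> x. 0 < \<epsilon> \<Longrightarrow> \<epsilon> < \<epsilon>2 \<Longrightarrow> v \<epsilon> x \<le> U x + e / 2"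
      using upper_comparison[OF per cont le e2] by blast
    show "\<forall>\<^sub>F \<epsilon> in at_right 0. \<forall>x\<in>UNIV. dist (v \<epsilon> x) (U x) < e"
      unfolding eventually_at_right_field
    proof (intro exI[of _ "min \<epsilon>1 \<epsilon>2"] conjI allI impI ballI)
      fix \<epsilon> x assume \<epsilon>: "0 < \<epsilon>" "\<epsilon> < min \<epsilon>1 \<epsilon>2"
      have "U x - e / 2 \<le> v \<epsilon> x" "v \<epsilon> x \<le> U x + e / 2" using \<epsilon>1(2) \<epsilon>2(2) \<epsilon> by auto
      then show "dist (v \<epsilon> x) (U x) < e" unfolding dist_real_def using \<open>e > 0\<close> by linarith
    qed (use \<epsilon>1(1) \<epsilon>2(1) in simp)
  qed
qed

end

theorem corollary1p2:
  fixes V :: "real^'n \<Rightarrow> real"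
    and m :: nat
    and x :: "nat \<Rightarrow> real^'n"
    and \<eta> :: real
    and v :: "real \<Rightarrow> real^'n \<Rightarrow> real"
  assumes "torus_fun V" and "C2 V"
    and "\<And>y. V y \<ge> 0"
    and "m \<ge> 1"
    and "\<And>y. V y = 0 \<longleftrightarrow> (\<exists>i\<in>{1..m}. torus_eq y (x i))"
    and "\<And>i j. i \<in> {1..m} \<Longrightarrow> j \<in> {1..m} \<Longrightarrow> i \<noteq> j \<Longrightarrow> \<not> torus_eq (x i) (x j)"
    and "\<And>i. i \<in> {1..m} \<Longrightarrow> sym_pos_def (hessian V (x i))"
    and "\<eta> > 0"
    and "\<And>\<epsilon>. \<epsilon> > 0 \<Longrightarrow> viscosity_solution V \<eta> \<epsilon> (v \<epsilon>)"
  shows "uniform_limit UNIV v (\<lambda>y. MIN i\<in>{1..m}. kappa V (x i) / \<eta> + mane V (x i) y) (at_right 0)"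
proof -
  interpret potential_wells V m x \<eta> v
    by unfold_locales (use assms in auto)
  show ?thesis by (rule vanishing_viscosity_limit)
qed

end
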